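(* There is a randomized polynomial-time algorithm that, given any instance $(G,\mathcal M)$ of MaxEDP with $k=|\mathcal M|$ terminal pairs on a graph $G$ with feedback vertex set number $r$, outputs, with constant probability, a routing of $\Omega(\mathsf{opt})$ terminal pairs of $\mathcal M$ with congestion $\mathcal O\left(\frac{\log kr}{\log\log kr}\right)$, where $\mathsf{opt}$ is the maximum number of pairs of $\mathcal M$ that can be routed by pairwise edge-disjoint paths. In other words, there is an efficient $\mathcal O(1)$-approximation algorithm for MaxEDP with congestion $\mathcal O\left(\frac{\log kr}{\log\log kr}\right)$. *)

theory Defs
  imports
    "HOL-Probability.Probability"
    "HOL-Computational_Algebra.Polynomial"
    "HOL-Library.Log_Nat"
begin

section \<open>Graphs, feedback vertex sets and disjoint paths\<close>

text \<open>Finite simple undirected graphs with vertex set \<open>V\<close>; edges are two-element vertex sets.\<close>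

definition simple_graph :: "'a set \<Rightarrow> 'a set set \<Rightarrow> bool" where
  "simple_graph V E \<longleftrightarrow> finite V \<and> (\<forall>e\<in>E. e \<subseteq> V \<and> card e = 2)"

definition path_edges :: "'a list \<Rightarrow> 'a set set" where
  "path_edges p = (\<lambda>(u, v). {u, v}) ` set (zip p (tl p))"

definition is_path :: "'a set \<Rightarrow> 'a set set \<Rightarrow> 'a list \<Rightarrow> bool" where
  "is_path V E p \<longleftrightarrow> p \<noteq> [] \<and> distinct p \<and> set p \<subseteq> V \<and> path_edges p \<subseteq> E"

definition is_cycle :: "'a set set \<Rightarrow> 'a list \<Rightarrow> bool" where
  "is_cycle E p \<longleftrightarrow> 3 \<le> length p \<and> distinct p \<and> path_edges p \<subseteq> E \<and> {last p, hd p} \<in> E"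

definition forest :: "'a set set \<Rightarrow> bool" where
  "forest E \<longleftrightarrow> (\<nexists>p. is_cycle E p)"

definition feedback_vertex_set :: "'a set \<Rightarrow> 'a set set \<Rightarrow> 'a set \<Rightarrow> bool" where
  "feedback_vertex_set V E X \<longleftrightarrow> X \<subseteq> V \<and> forest {e \<in> E. e \<inter> X = {}}"

definition fvs_number :: "'a set \<Rightarrow> 'a set set \<Rightarrow> nat" where
  "fvs_number V E = Min (card ` {X. feedback_vertex_set V E X})"

text \<open>
  The terminal pairs form a collection indexed by \<open>{..<k}\<close>, given as a list of length \<open>k\<close>.
  A routing is a partial map from indices to paths; its domain is the set of routed pairs.
\<close>

definition maxedp_instance :: "'a set \<Rightarrow> 'a set set \<Rightarrow> ('a \<times> 'a) list \<Rightarrow> bool" where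
  "maxedp_instance V E M \<longleftrightarrow> simple_graph V E \<and> set M \<subseteq> V \<times> V"

definition routing ::
  "'a set \<Rightarrow> 'a set set \<Rightarrow> ('a \<times> 'a) list \<Rightarrow> (nat \<rightharpoonup> 'a list) \<Rightarrow> bool" where
  "routing V E M R \<longleftrightarrow> dom R \<subseteq> {..<length M} \<and>
     (\<forall>i p. R i = Some p \<longrightarrow> is_path V E p \<and> (hd p, last p) = M ! i)"

definition edge_disjoint :: "(nat \<rightharpoonup> 'a list) \<Rightarrow> bool" where
  "edge_disjoint R \<longleftrightarrow> (\<forall>i\<in>dom R. \<forall>j\<in>dom R. i \<noteq> j \<longrightarrow>
     path_edges (the (R i)) \<inter> path_edges (the (R j)) = {})"

definition edge_load :: "(nat \<rightharpoonup> 'a list) \<Rightarrow> 'a set \<Rightarrow> nat" where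
  "edge_load R e = card {i \<in> dom R. e \<in> path_edges (the (R i))}"

definition congestion_at_most :: "'a set set \<Rightarrow> (nat \<rightharpoonup> 'a list) \<Rightarrow> real \<Rightarrow> bool" where
  "congestion_at_most E R c \<longleftrightarrow> (\<forall>e\<in>E. real (edge_load R e) \<le> c)"

definition maxedp_opt :: "'a set \<Rightarrow> 'a set set \<Rightarrow> ('a \<times> 'a) list \<Rightarrow> nat" where
  "maxedp_opt V E M = Max {card (dom R) | R. routing V E M R \<and> edge_disjoint R}"

text \<open>
  The function inside the \<open>O\<close> bound on the congestion. For \<open>n \<ge> 3\<close> it is well-defined and
  at least \<open>exp 1\<close>; below that, \<open>ln (ln n)\<close> is undefined or negative and the bound is read
  as a constant.
\<close>

definition log_over_loglog :: "nat \<Rightarrow> real" where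
  "log_over_loglog n = (if 3 \<le> n then ln (real n) / ln (ln (real n)) else 1)"

section \<open>Randomized polynomial-time algorithms\<close>

text \<open>
  The machine model is a while language over binary trees with natural numbers at the leaves,
  with a fair coin-flip command. Every evaluated (sub)expression is charged the bit size
  of its value, so that running times agree with those of Turing machines up to a polynomial.
\<close>

datatype val = Num nat | Cell val val

fun val_size :: "val \<Rightarrow> nat" where
  "val_size (Num n) = 1 + floorlog 2 n"
| "val_size (Cell a b) = 1 + val_size a + val_size b"

datatype binop = Plus | Minus | Times | Div | Less

datatype expr =
    Var nat
  | Const nat
  | Pack expr expr
  | Head expr
  | Tail expr
  | Is_Num expr
  | Equal expr expr
  | Op binop expr expr

fun apply_op :: "binop \<Rightarrow> nat \<Rightarrow> nat \<Rightarrow> nat" where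
  "apply_op Plus m n = m + n"
| "apply_op Minus m n = m - n"
| "apply_op Times m n = m * n"
| "apply_op Div m n = m div n"
| "apply_op Less m n = of_bool (m < n)"

type_synonym store = "nat \<Rightarrow> val"

text \<open>Ill-typed operations return \<open>Num 0\<close>.\<close>

fun eval_expr :: "expr \<Rightarrow> store \<Rightarrow> val" where
  "eval_expr (Var x) s = s x"
| "eval_expr (Const n) s = Num n"
| "eval_expr (Pack a b) s = Cell (eval_expr a s) (eval_expr b s)"
| "eval_expr (Head a) s = (case eval_expr a s of Cell u v \<Rightarrow> u | Num _ \<Rightarrow> Num 0)"
| "eval_expr (Tail a) s = (case eval_expr a s of Cell u v \<Rightarrow> v | Num _ \<Rightarrow> Num 0)"
| "eval_expr (Is_Num a) s = (case eval_expr a s of Cell u v \<Rightarrow> Num 0 | Num _ \<Rightarrow> Num 1)"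
| "eval_expr (Equal a b) s = Num (of_bool (eval_expr a s = eval_expr b s))"
| "eval_expr (Op f a b) s =
     (case (eval_expr a s, eval_expr b s) of
        (Num m, Num n) \<Rightarrow> Num (apply_op f m n)
      | _ \<Rightarrow> Num 0)"

fun expr_cost :: "expr \<Rightarrow> store \<Rightarrow> nat" where
  "expr_cost (Var x) s = val_size (eval_expr (Var x) s)"
| "expr_cost (Const n) s = val_size (eval_expr (Const n) s)"
| "expr_cost (Pack a b) s = val_size (eval_expr (Pack a b) s) + expr_cost a s + expr_cost b s"
| "expr_cost (Head a) s = val_size (eval_expr (Head a) s) + expr_cost a s"
| "expr_cost (Tail a) s = val_size (eval_expr (Tail a) s) + expr_cost a s"
| "expr_cost (Is_Num a) s = val_size (eval_expr (Is_Num a) s) + expr_cost a s"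
| "expr_cost (Equal a b) s = val_size (eval_expr (Equal a b) s) + expr_cost a s + expr_cost b s"
| "expr_cost (Op f a b) s = val_size (eval_expr (Op f a b) s) + expr_cost a s + expr_cost b s"

datatype com =
    Skip
  | Assign nat expr
  | Flip nat
  | Seq com com
  | Cond expr com com
  | While expr com

text \<open>
  \<open>exec c s w t s' w'\<close>: started in store \<open>s\<close> with random bits \<open>w\<close>, the program \<open>c\<close> terminates
  after time \<open>t\<close> in store \<open>s'\<close>, leaving the random bits \<open>w'\<close> unused. Any value other than
  \<open>Num 0\<close> counts as true.
\<close>

inductive exec :: "com \<Rightarrow> store \<Rightarrow> bool list \<Rightarrow> nat \<Rightarrow> store \<Rightarrow> bool list \<Rightarrow> bool" where
  Skip: "exec Skip s w 1 s w"
| Assign: "exec (Assign x e) s w (1 + expr_cost e s) (s(x := eval_expr e s)) w"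
| Flip: "exec (Flip x) s (b # w) 1 (s(x := Num (of_bool b))) w"
| Seq: "\<lbrakk>exec c1 s w t1 s1 w1; exec c2 s1 w1 t2 s2 w2\<rbrakk>
    \<Longrightarrow> exec (Seq c1 c2) s w (1 + t1 + t2) s2 w2"
| Cond_True: "\<lbrakk>eval_expr e s \<noteq> Num 0; exec c1 s w t s' w'\<rbrakk>
    \<Longrightarrow> exec (Cond e c1 c2) s w (1 + expr_cost e s + t) s' w'"
| Cond_False: "\<lbrakk>eval_expr e s = Num 0; exec c2 s w t s' w'\<rbrakk>
    \<Longrightarrow> exec (Cond e c1 c2) s w (1 + expr_cost e s + t) s' w'"
| While_True: "\<lbrakk>eval_expr e s \<noteq> Num 0; exec c s w t1 s1 w1; exec (While e c) s1 w1 t2 s2 w2\<rbrakk>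
    \<Longrightarrow> exec (While e c) s w (1 + expr_cost e s + t1 + t2) s2 w2"
| While_False: "eval_expr e s = Num 0
    \<Longrightarrow> exec (While e c) s w (1 + expr_cost e s) s w"

inductive_cases exec_SkipE: "exec Skip s w t s' w'"
inductive_cases exec_AssignE: "exec (Assign x e) s w t s' w'"
inductive_cases exec_FlipE: "exec (Flip x) s w t s' w'"
inductive_cases exec_SeqE: "exec (Seq c1 c2) s w t s' w'"
inductive_cases exec_CondE: "exec (Cond e c1 c2) s w t s' w'"
inductive_cases exec_WhileE: "exec (While e c) s w t s' w'"

lemma exec_deterministic:
  "exec c s w t s' w' \<Longrightarrow> exec c s w u s'' w'' \<Longrightarrow> u = t \<and> s'' = s' \<and> w'' = w'"
proof (induction arbitrary: u s'' w'' rule: exec.induct)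
  case Skip
  then show ?case by (auto elim: exec_SkipE)
next
  case Assign
  then show ?case by (auto elim: exec_AssignE)
next
  case Flip
  from Flip.prems show ?case by (rule exec_FlipE) simp
next
  case (Seq c1 s w t1 s1 w1 c2 t2 s2 w2)
  from Seq.prems obtain u1 r1 v1 u2 where u: "u = 1 + u1 + u2"
    and 1: "exec c1 s w u1 r1 v1" and 2: "exec c2 r1 v1 u2 s'' w''"
    by (rule exec_SeqE) simp
  from Seq.IH(1)[OF 1] 2 have 3: "u1 = t1" "exec c2 s1 w1 u2 s'' w''" by simp_all
  from Seq.IH(2)[OF 3(2)] 3(1) u show ?case by simp
next
  case (Cond_True e s c1 w t s' w' c2)
  from Cond_True.prems show ?case
    by (rule exec_CondE) (simp_all add: Cond_True.hyps, metis Cond_True.IH)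
next
  case (Cond_False e s c2 w t s' w' c1)
  from Cond_False.prems show ?case
    by (rule exec_CondE) (simp_all add: Cond_False.hyps, metis Cond_False.IH)
next
  case (While_True e s c w t1 s1 w1 t2 s2 w2)
  from While_True.prems obtain u1 r1 v1 u2 where u: "u = 1 + expr_cost e s + u1 + u2"
    and 1: "exec c s w u1 r1 v1" and 2: "exec (While e c) r1 v1 u2 s'' w''"
    by (rule exec_WhileE) (simp_all add: While_True.hyps)
  from While_True.IH(1)[OF 1] 2 have 3: "u1 = t1" "exec (While e c) s1 w1 u2 s'' w''"
    by simp_all
  from While_True.IH(2)[OF 3(2)] 3(1) u show ?case by simp
next
  case (While_False e s c w)
  from While_False.prems show ?case
    by (rule exec_WhileE) (simp_all add: While_False.hyps)
qed

text \<open>Input and output are passed in variable \<open>0\<close>; all other variables start as \<open>Num 0\<close>.\<close>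

definition computes :: "com \<Rightarrow> val \<Rightarrow> bool list \<Rightarrow> nat \<Rightarrow> val \<Rightarrow> bool" where
  "computes A x w t y \<longleftrightarrow> (\<exists>s w'. exec A ((\<lambda>_. Num 0)(0 := x)) w t s w' \<and> s 0 = y)"

definition halts_within :: "com \<Rightarrow> val \<Rightarrow> nat \<Rightarrow> bool" where
  "halts_within A x T \<longleftrightarrow> (\<forall>w. length w = T \<longrightarrow> (\<exists>t y. computes A x w t y \<and> t \<le> T))"

text \<open>
  A run that halts within time \<open>T\<close> flips at most \<open>T\<close> coins, so its coin flips can be drawn
  in advance as a uniformly random bit string of length \<open>T\<close>.
\<close>

definition output_prob :: "com \<Rightarrow> val \<Rightarrow> nat \<Rightarrow> (val \<Rightarrow> bool) \<Rightarrow> real" where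
  "output_prob A x T Q =
     measure_pmf.prob (pmf_of_set {w :: bool list. length w = T}) {w. \<exists>t y. computes A x w t y \<and> Q y}"

section \<open>Encoding of instances and routings\<close>

fun enc_list :: "('a \<Rightarrow> val) \<Rightarrow> 'a list \<Rightarrow> val" where
  "enc_list f [] = Num 0"
| "enc_list f (x # xs) = Cell (f x) (enc_list f xs)"

fun enc_option :: "('a \<Rightarrow> val) \<Rightarrow> 'a option \<Rightarrow> val" where
  "enc_option f None = Num 0"
| "enc_option f (Some x) = Cell (Num 0) (f x)"

definition enc_pair :: "nat \<times> nat \<Rightarrow> val" where
  "enc_pair = (\<lambda>(u, v). Cell (Num u) (Num v))"

text \<open>
  A graph is presented by any duplicate-free list of its vertices and of its edges, each edge
  being written once, in either orientation.
\<close>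

definition encodes_instance ::
  "val \<Rightarrow> nat set \<Rightarrow> nat set set \<Rightarrow> (nat \<times> nat) list \<Rightarrow> bool" where
  "encodes_instance x V E M \<longleftrightarrow> (\<exists>vs es.
     distinct vs \<and> set vs = V \<and>
     distinct (map (\<lambda>(u, v). {u, v}) es) \<and> (\<lambda>(u, v). {u, v}) ` set es = E \<and>
     x = Cell (enc_list Num vs) (Cell (enc_list enc_pair es) (enc_list enc_pair M)))"

definition enc_routing :: "nat \<Rightarrow> (nat \<rightharpoonup> nat list) \<Rightarrow> val" where
  "enc_routing k R = enc_list (\<lambda>i. enc_option (enc_list Num) (R i)) [0..<k]"

end

theory Submission
  imports Defs
begin

text \<open>
  The algorithm is deterministic. Let \<open>k\<close> be the number of terminal pairs and \<open>K = |E| + 1\<close>.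

  (1) Make \<open>K\<close> copies of every pair and repeatedly route the copy whose shortest path is cheapest, where an
  edge of load \<open>l\<close> has length \<open>2 ^ l\<close> and is closed at load \<open>3 K\<close>. Since an optimal solution is edge-disjoint,
  its cheapest remaining path costs at most \<open>2 / opt\<close> times the total edge length \<open>\<Phi>\<close> until
  \<open>K opt / 2\<close> copies are routed; hence \<open>\<Phi> \<le> |E| exp K\<close> up to that point and no edge is closed. This is a
  fractional solution of value \<open>opt / 2\<close> and congestion \<open>3\<close>.

  (2) For each pair, the integrality of single-commodity flows turns the fractional flow into a multiple of
  \<open>1 / k\<close>. The rounding error is at most \<open>2 / k\<close> per edge and pair, so \<open>k\<close> pairs raise the congestion by at
  most \<open>2\<close>. Now there are at most \<open>k ^ 2\<close> candidate paths.

  (3) If \<open>X\<close> is a feedback vertex set of size \<open>r\<close>, the candidate paths consist of \<open>O (k ^ 2 r)\<close> upward chains of the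
  forest \<open>G - X\<close> and \<open>O (k ^ 2 r)\<close> edges at \<open>X\<close>. Two chains meet in an interval, so the edges have only
  polynomially many (in \<open>k r\<close>) different signatures, the signature being the set of candidates through the edge.
  Choosing candidates greedily with weights \<open>b ^ l\<close> on one edge per signature, where \<open>b\<close> is logarithmic in the
  number of signatures, selects a constant fraction of the fractional value before the potential exceeds
  \<open>exp (O b)\<close>, that is, with all loads \<open>O (b / ln b)\<close>.

  (4) For \<open>r = 0\<close> constant congestion is required. In a forest, a path whose top vertex is deepest has two edges
  hitting every path that meets it; selecting such paths one after the other gives disjoint paths of
  \<open>\<Omega> (opt)\<close> pairs. The algorithm therefore first tries to proceed in this way and uses (3) when this gets stuck,
  which only happens for \<open>r > 0\<close>.
\<close>

section \<open>Polynomial-time computable functions\<close>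

text \<open>The congestion may depend on \<open>k\<close> and \<open>r\<close> only, while the graph
  is arbitrarily large. The solution of (1) has a number of paths that grows with the graph, and
  rounding it over all edges would cost a logarithm of the number of edges. After (2) there are few
  paths, and edges of equal signature have equal load throughout the rounding, so one of them can
  represent all.

  The base in (3) comes from a balance. On N representatives the potential starts at N and stays
  below N exp (O b), so every load l satisfies b ^ l \<le> N exp (O b), that is, l \<le> (ln N + O
  b) / ln b. A base of order ln N makes both terms equal and gives O (ln N / ln ln N), the
  congestion expected of randomized rounding.

  The machine model shapes the definitions. Numbers are binary, so counting up to a number can take
  exponentially long. Loops therefore run along lists, and numbers used as exponents or as round
  counts are dominated by lengths of lists; this explains the form of \<open>copies\<close>,
  \<open>scaled\<close>, \<open>loglist\<close> and \<open>cap_range\<close>.\<close>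

class encodable =
  fixes enc :: "'a \<Rightarrow> val"
  assumes enc_inject [simp]: "enc x = enc y \<longleftrightarrow> x = y"

instantiation nat :: encodable
begin
definition [simp]: "enc (n :: nat) = Num n"
instance by standard simp
end

instantiation bool :: encodable
begin
definition [simp]: "enc b = Num (of_bool b)"
instance by standard simp
end

instantiation prod :: (encodable, encodable) encodable
begin
definition [simp]: "enc z = Cell (enc (fst z)) (enc (snd z))"
instance by standard (auto simp: prod_eq_iff)
end

lemma enc_list_inject: "enc_list enc xs = enc_list enc ys \<longleftrightarrow> xs = (ys :: 'a::encodable list)"
proof (induction xs arbitrary: ys)
  case Nil
  then show ?case by (cases ys) auto
next
  case (Cons x xs)
  then show ?case by (cases ys) auto
qed

instantiation list :: (encodable) encodable
begin
definition "enc (xs :: 'a list) = enc_list enc xs"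
instance by standard (simp add: enc_list_def enc_list_inject)
end

instantiation option :: (encodable) encodable
begin
definition "enc (x :: 'a option) = enc_option enc x"
instance
proof
  fix x y :: "'a option"
  show "enc x = enc y \<longleftrightarrow> x = y" by (cases x; cases y) (auto simp: enc_option_def)
qed
end

abbreviation esize :: "'a::encodable \<Rightarrow> nat" where
  "esize x \<equiv> val_size (enc x)"

lemma enc_Nil [simp]: "enc ([] :: 'a::encodable list) = Num 0"
  and enc_Cons [simp]: "enc (x # xs :: 'a::encodable list) = Cell (enc x) (enc xs)"
  and enc_None [simp]: "enc (None :: 'a::encodable option) = Num 0"
  and enc_Some [simp]: "enc (Some x :: 'a::encodable option) = Cell (Num 0) (enc x)"
  by (auto simp: enc_list_def enc_option_def)

subsection \<open>Polynomial bounds\<close>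

text \<open>The base of the power is at least 2, so constants and sums are absorbed by a larger
  exponent and each closure property is arithmetic on exponents. The final polynomial can be read
  off as \<open>[:2, 1:] ^ a\<close>.\<close>

definition polybound :: "('a::encodable \<Rightarrow> nat) \<Rightarrow> bool" where
  "polybound h \<longleftrightarrow> (\<exists>a. \<forall>x. h x \<le> (esize x + 2) ^ a)"

lemma polybound_const: "polybound (\<lambda>x. c)"
proof -
  have "c \<le> (s + 2) ^ c" for s :: nat
  proof -
    have "c \<le> 2 ^ c" by (simp add: less_imp_le)
    also have "\<dots> \<le> (s + 2) ^ c" by (intro power_mono) auto
    finally show ?thesis .
  qed
  then show ?thesis unfolding polybound_def by blast
qed

lemma polybound_esize: "polybound esize"
  unfolding polybound_def by (rule exI[of _ 1]) simp

lemma polybound_add: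
  assumes "polybound g" and "polybound h"
  shows "polybound (\<lambda>x. g x + h x)"
proof -
  obtain a b where g: "\<And>x. g x \<le> (esize x + 2) ^ a" and h: "\<And>x. h x \<le> (esize x + 2) ^ b"
    using assms unfolding polybound_def by blast
  have "g x + h x \<le> (esize x + 2) ^ (Suc (a + b))" for x
  proof -
    have "g x + h x \<le> (esize x + 2) ^ a + (esize x + 2) ^ b" using g h by (rule add_mono)
    also have "\<dots> \<le> (esize x + 2) ^ (a + b) + (esize x + 2) ^ (a + b)"
      by (intro add_mono power_increasing) auto
    also have "\<dots> \<le> (esize x + 2) ^ (Suc (a + b))" by simp
    finally show ?thesis .
  qed
  then show ?thesis unfolding polybound_def by blast
qed

lemma polybound_mult:
  assumes "polybound g" and "polybound h"
  shows "polybound (\<lambda>x. g x * h x)"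
proof -
  obtain a b where g: "\<And>x. g x \<le> (esize x + 2) ^ a" and h: "\<And>x. h x \<le> (esize x + 2) ^ b"
    using assms unfolding polybound_def by blast
  have "g x * h x \<le> (esize x + 2) ^ (a + b)" for x
    using mult_mono[OF g h] by (simp add: power_add)
  then show ?thesis unfolding polybound_def by blast
qed

lemma polybound_power: "polybound g \<Longrightarrow> polybound (\<lambda>x. g x ^ n)"
  by (induction n) (auto intro: polybound_const polybound_mult)

lemma polybound_mono: "polybound h \<Longrightarrow> (\<And>x. g x \<le> h x) \<Longrightarrow> polybound g"
  unfolding polybound_def by (meson order_trans)

lemma polybound_comp:
  assumes "polybound h" and "polybound (\<lambda>x. esize (f x))"
  shows "polybound (\<lambda>x. h (f x))"
proof -
  obtain a where h: "\<And>y. h y \<le> (esize y + 2) ^ a"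
    using assms unfolding polybound_def by blast
  have "polybound (\<lambda>x. (esize (f x) + 2) ^ a)"
    by (intro polybound_power polybound_add polybound_const assms)
  then show ?thesis by (rule polybound_mono) (rule h)
qed

lemmas polybound_intros = polybound_const polybound_esize polybound_add polybound_mult polybound_power

subsection \<open>The class of functions\<close>

text \<open>A contract made for nesting programs. Only register 0 is prescribed at the start, so a
  program can be run again after others have left garbage in low registers. Registers from
  \<open>n\<close> on are preserved, so a caller can keep data there. The bits \<open>w\<close> come
  back unchanged, so no coin is flipped.\<close>

definition runs ::
  "com \<Rightarrow> nat \<Rightarrow> ('a::encodable \<Rightarrow> 'b::encodable) \<Rightarrow> ('a \<Rightarrow> nat) \<Rightarrow> bool" where
  "runs c n f h \<longleftrightarrow> (\<forall>x s w. s 0 = enc x \<longrightarrow>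
     (\<exists>t s'. exec c s w t s' w \<and> t \<le> h x \<and> s' 0 = enc (f x) \<and> (\<forall>y\<ge>n. s' y = s y)))"

text \<open>The output size is bounded along with the time because in a composition the output of
  one program is the argument of the next time bound.\<close>

definition polytime :: "('a::encodable \<Rightarrow> 'b::encodable) \<Rightarrow> bool" where
  "polytime f \<longleftrightarrow> (\<exists>c n h. runs c n f h \<and> polybound h) \<and> polybound (\<lambda>x. esize (f x))"

lemma runsE:
  assumes "runs c n f h" and "s 0 = enc x"
  obtains t s' where "exec c s w t s' w" "t \<le> h x" "s' 0 = enc (f x)" "\<And>y. y \<ge> n \<Longrightarrow> s' y = s y"
  using assms unfolding runs_def by blast

lemma polytimeE:
  fixes f :: "'a::encodable \<Rightarrow> 'b::encodable"
  assumes "polytime f"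
  obtains c n h where "runs c n f h" "polybound h" "polybound (\<lambda>x. esize (f x))" "n > 0"
proof -
  obtain c n h where c: "runs c n f h" "polybound h" "polybound (\<lambda>x. esize (f x))"
    using assms unfolding polytime_def by blast
  \<comment> \<open>Enlarging the frame bound makes it positive, so that register \<open>n\<close>,
    where callers store data, is never the input register 0.\<close>
  have "runs c (Suc n) f h"
    unfolding runs_def
  proof (intro allI impI)
    fix x :: 'a and s :: store and w assume "s 0 = enc x"
    from c(1) this obtain t s' where "exec c s w t s' w" "t \<le> h x" "s' 0 = enc (f x)"
      "\<And>y. y \<ge> n \<Longrightarrow> s' y = s y"
      by (rule runsE) blast
    then show "\<exists>t s'. exec c s w t s' w \<and> t \<le> h x \<and> s' 0 = enc (f x) \<and> (\<forall>y\<ge>Suc n. s' y = s y)"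
      by (intro exI[of _ t] exI[of _ s']) auto
  qed
  with c that show ?thesis by blast
qed

lemma polytime_esize: "polytime f \<Longrightarrow> polybound (\<lambda>x. esize (f x))"
  by (simp add: polytime_def)

lemma polytime_expr:
  fixes f :: "'a::encodable \<Rightarrow> 'b::encodable" and h :: "'a \<Rightarrow> nat"
  assumes "\<And>x s. s 0 = enc x \<Longrightarrow> eval_expr e s = enc (f x)"
    and "\<And>x s. s 0 = enc x \<Longrightarrow> expr_cost e s \<le> h x" and "polybound h"
    and "polybound (\<lambda>x. esize (f x))"
  shows "polytime f"
proof -
  have "runs (Assign 0 e) 1 f (\<lambda>x. 1 + h x)"
    unfolding runs_def
  proof (intro allI impI)
    fix x :: 'a and s :: store and w assume s: "s 0 = enc x"
    have "exec (Assign 0 e) s w (1 + expr_cost e s) (s(0 := eval_expr e s)) w" by (rule exec.Assign)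
    then show "\<exists>t s'. exec (Assign 0 e) s w t s' w \<and> t \<le> 1 + h x \<and> s' 0 = enc (f x) \<and>
        (\<forall>y\<ge>1. s' y = s y)"
      using assms(1)[of s x, OF s] assms(2)[of s x, OF s] by (intro exI[of _ "1 + expr_cost e s"] exI[of _ "s(0 := eval_expr e s)"]) auto
  qed
  moreover have "polybound (\<lambda>x. 1 + h x)" by (intro polybound_intros assms)
  ultimately show ?thesis using assms(4) unfolding polytime_def by blast
qed

lemma polytime_const: "polytime (\<lambda>x. c)"
proof -
  \<comment> \<open>The literal becomes an expression with one \<open>Pack\<close> per cell; its
    cost is the same in every store.\<close>
  define cexp where "cexp = rec_val Const (\<lambda>_ _. Pack)"
  have ev: "eval_expr (cexp v) s = v" for v s
    by (induction v) (auto simp: cexp_def)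
  have co: "expr_cost (cexp v) s = expr_cost (cexp v) (\<lambda>_. Num 0)" for v s
    by (induction v) (use ev in \<open>auto simp: cexp_def\<close>)
  show ?thesis
    by (rule polytime_expr[of "cexp (enc c)" _ "\<lambda>_. expr_cost (cexp (enc c)) (\<lambda>_. Num 0)"])
      (auto simp: ev polybound_const intro: eq_refl[OF co])
qed

lemma polytime_id: "polytime (\<lambda>x. x)"
  by (rule polytime_expr[of "Var 0" _ esize]) (auto intro: polybound_esize)

lemma exec_Assign':
  "t = 1 + expr_cost e s \<Longrightarrow> s' = s(x := eval_expr e s) \<Longrightarrow> exec (Assign x e) s w t s' w"
  using exec.Assign[of x e s w] by simp

lemma polytime_comp:
  fixes f :: "'b::encodable \<Rightarrow> 'c::encodable" and g :: "'a::encodable \<Rightarrow> 'b"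
  assumes "polytime f" and "polytime g"
  shows "polytime (\<lambda>x. f (g x))"
proof -
  obtain cf nf hf where f: "runs cf nf f hf" "polybound hf" "polybound (\<lambda>x. esize (f x))"
    using assms(1) by (rule polytimeE)
  obtain cg ng hg where g: "runs cg ng g hg" "polybound hg" "polybound (\<lambda>x. esize (g x))"
    using assms(2) by (rule polytimeE)
  have "runs (Seq cg cf) (max nf ng) (\<lambda>x. f (g x)) (\<lambda>x. 1 + hg x + hf (g x))"
    unfolding runs_def
  proof (intro allI impI)
    fix x :: 'a and s :: store and w assume s: "s 0 = enc x"
    obtain t1 s1 where 1: "exec cg s w t1 s1 w" "t1 \<le> hg x" "s1 0 = enc (g x)"
      "\<And>y. y \<ge> ng \<Longrightarrow> s1 y = s y" using g(1) s by (rule runsE) blast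
    obtain t2 s2 where 2: "exec cf s1 w t2 s2 w" "t2 \<le> hf (g x)" "s2 0 = enc (f (g x))"
      "\<And>y. y \<ge> nf \<Longrightarrow> s2 y = s1 y" using f(1) 1(3) by (rule runsE) blast
    have "exec (Seq cg cf) s w (1 + t1 + t2) s2 w" by (rule exec.Seq[OF 1(1) 2(1)])
    then show "\<exists>t s'. exec (Seq cg cf) s w t s' w \<and> t \<le> 1 + hg x + hf (g x) \<and>
        s' 0 = enc (f (g x)) \<and> (\<forall>y\<ge>max nf ng. s' y = s y)"
      using 1 2 by (intro exI[of _ "1 + t1 + t2"] exI[of _ s2]) auto
  qed
  moreover have "polybound (\<lambda>x. 1 + hg x + hf (g x))"
    by (intro polybound_intros g polybound_comp[OF f(2) g(3)])
  moreover have "polybound (\<lambda>x. esize (f (g x)))" by (rule polybound_comp[OF f(3) g(3)])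
  ultimately show ?thesis unfolding polytime_def by blast
qed

lemma polytime_Pair:
  fixes f :: "'a::encodable \<Rightarrow> 'b::encodable" and g :: "'a \<Rightarrow> 'c::encodable"
  assumes "polytime f" and "polytime g"
  shows "polytime (\<lambda>x. (f x, g x))"
proof -
  obtain cf nf hf where f: "runs cf nf f hf" "polybound hf" "polybound (\<lambda>x. esize (f x))" "nf > 0"
    using assms(1) by (rule polytimeE)
  obtain cg ng hg where g: "runs cg ng g hg" "polybound hg" "polybound (\<lambda>x. esize (g x))" "ng > 0"
    using assms(2) by (rule polytimeE)
  define n where "n = max nf ng"
  \<comment> \<open>Register \<open>n\<close> keeps the input and register \<open>Suc n\<close> the
    first result; both are out of reach of the two subprograms.\<close>
  define c where "c = Seq (Assign n (Var 0)) (Seq cf (Seq (Assign (Suc n) (Var 0))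
    (Seq (Assign 0 (Var n)) (Seq cg (Assign 0 (Pack (Var (Suc n)) (Var 0)))))))"
  define h where "h x = 10 + 2 * esize x + 4 * esize (f x) + 4 * esize (g x) + hf x + hg x" for x
  have "runs c (n + 2) (\<lambda>x. (f x, g x)) h"
    unfolding runs_def
  proof (intro allI impI)
    fix x :: 'a and s :: store and w assume s: "s 0 = enc x"
    define s1 where "s1 = s(n := enc x)"
    have "s1 0 = enc x" using s f(4) by (simp add: s1_def)
    with f(1) obtain t2 s2 where 2: "exec cf s1 w t2 s2 w" "t2 \<le> hf x" "s2 0 = enc (f x)"
      "\<And>y. y \<ge> nf \<Longrightarrow> s2 y = s1 y" by (rule runsE) blast
    define s3 where "s3 = s2(Suc n := enc (f x), 0 := enc x)"
    have "s3 0 = enc x" by (simp add: s3_def)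
    with g(1) obtain t4 s4 where 4: "exec cg s3 w t4 s4 w" "t4 \<le> hg x" "s4 0 = enc (g x)"
      "\<And>y. y \<ge> ng \<Longrightarrow> s4 y = s3 y" by (rule runsE) blast
    have n: "n > 0" "n \<ge> nf" "n \<ge> ng" using f(4) by (auto simp: n_def)
    have s2n: "s2 n = enc x" using 2(4)[of n] n by (simp add: s1_def)
    have s4n: "s4 (Suc n) = enc (f x)" using 4(4)[of "Suc n"] n by (simp add: s3_def)
    let ?s5 = "s4(0 := enc (f x, g x))"
    have ex: "exec c s w (1 + (1 + esize x) + (1 + t2 + (1 + (1 + esize (f x)) +
       (1 + (1 + esize x) + (1 + t4 + (1 + (esize (f x, g x) + esize (f x) + esize (g x)))))))) ?s5 w"
      unfolding c_def
      apply (rule exec.Seq[of _ _ _ _ s1 w])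
       apply (rule exec_Assign'; simp add: s1_def s)
      apply (rule exec.Seq[OF 2(1)])
      apply (rule exec.Seq[of _ _ _ _ "s2(Suc n := enc (f x))" w])
       apply (rule exec_Assign'; simp add: 2)
      apply (rule exec.Seq[of _ _ _ _ s3 w])
       apply (rule exec_Assign'; simp add: s2n s3_def)
      apply (rule exec.Seq[OF 4(1)])
      apply (rule exec_Assign'; simp add: s4n 4(3))
      done
    moreover have "s4 y = s y" if "y \<ge> n + 2" for y
      using that n 4(4)[of y] 2(4)[of y] by (simp add: s3_def s1_def)
    ultimately show "\<exists>t s'. exec c s w t s' w \<and> t \<le> h x \<and> s' 0 = enc (f x, g x) \<and>
        (\<forall>y\<ge>n + 2. s' y = s y)"
      using 2(2) 4(2) by - (intro exI conjI, rule ex, auto simp: h_def)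
  qed
  moreover have "polybound h" unfolding h_def by (intro polybound_intros f g)
  moreover have "polybound (\<lambda>x. esize (f x, g x))" 
    by (rule polybound_mono[OF polybound_add[OF polybound_const polybound_add[OF f(3) g(3)], of 1]]) simp
  ultimately show ?thesis unfolding polytime_def by blast
qed

lemma polytime_comp2:
  "polytime (\<lambda>z. f (fst z) (snd z)) \<Longrightarrow> polytime g \<Longrightarrow> polytime h \<Longrightarrow> polytime (\<lambda>x. f (g x) (h x))"
  using polytime_comp[OF _ polytime_Pair, of "\<lambda>z. f (fst z) (snd z)" g h] by simp

lemma polytime_fst: "polytime f \<Longrightarrow> polytime (\<lambda>x. fst (f x))"
  by (rule polytime_comp[OF polytime_expr[of "Head (Var 0)" fst "\<lambda>x. 2 * esize x"]];
      (intro polybound_intros polybound_mono[OF polybound_esize])?) auto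

lemma polytime_snd: "polytime f \<Longrightarrow> polytime (\<lambda>x. snd (f x))"
  by (rule polytime_comp[OF polytime_expr[of "Tail (Var 0)" snd "\<lambda>x. 2 * esize x"]];
      (intro polybound_intros polybound_mono[OF polybound_esize])?) auto

lemma polytime_If:
  fixes b :: "'a::encodable \<Rightarrow> bool" and f g :: "'a \<Rightarrow> 'b::encodable"
  assumes "polytime b" and "polytime f" and "polytime g"
  shows "polytime (\<lambda>x. if b x then f x else g x)"
proof -
  obtain cb nb hb where b: "runs cb nb b hb" "polybound hb" "polybound (\<lambda>x. esize (b x))" "nb > 0"
    using assms(1) by (rule polytimeE)
  obtain cf nf hf where f: "runs cf nf f hf" "polybound hf" "polybound (\<lambda>x. esize (f x))" "nf > 0"
    using assms(2) by (rule polytimeE)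
  obtain cg ng hg where g: "runs cg ng g hg" "polybound hg" "polybound (\<lambda>x. esize (g x))" "ng > 0"
    using assms(3) by (rule polytimeE)
  define n where "n = max nb (max nf ng)"
  define c where "c = Seq (Assign n (Var 0)) (Seq cb (Cond (Var 0)
    (Seq (Assign 0 (Var n)) cf) (Seq (Assign 0 (Var n)) cg)))"
  define h where "h x = 10 + 2 * esize x + hb x + esize (b x) + hf x + hg x" for x
  have "runs c (n + 1) (\<lambda>x. if b x then f x else g x) h"
    unfolding runs_def
  proof (intro allI impI)
    fix x :: 'a and s :: store and w assume s: "s 0 = enc x"
    have n: "n > 0" "n \<ge> nf" "n \<ge> ng" "n \<ge> nb" using f(4) by (auto simp: n_def)
    define s1 where "s1 = s(n := enc x)"
    have "s1 0 = enc x" using s n by (simp add: s1_def)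
    with b(1) obtain t2 s2 where 2: "exec cb s1 w t2 s2 w" "t2 \<le> hb x" "s2 0 = enc (b x)"
      "\<And>y. y \<ge> nb \<Longrightarrow> s2 y = s1 y" by (rule runsE) blast
    have s2n: "s2 n = enc x" using 2(4)[of n] n by (simp add: s1_def)
    let ?s3 = "s2(0 := enc x)"
    have s3: "?s3 0 = enc x" by simp
    have fr: "?s3 y = s y" if "y \<ge> n + 1" for y using that n 2(4)[of y] by (simp add: s1_def)
    show "\<exists>t s'. exec c s w t s' w \<and> t \<le> h x \<and> s' 0 = enc (if b x then f x else g x) \<and>
        (\<forall>y\<ge>n + 1. s' y = s y)"
    proof (cases "b x")
      case True
      from f(1) s3 obtain t4 s4 where 4: "exec cf ?s3 w t4 s4 w" "t4 \<le> hf x" "s4 0 = enc (f x)"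
        "\<And>y. y \<ge> nf \<Longrightarrow> s4 y = ?s3 y" by (rule runsE) blast
      have ex: "exec c s w (1 + (1 + esize x) + (1 + t2 + (1 + esize (b x) +
          (1 + (1 + esize x) + t4)))) s4 w"
        unfolding c_def
        apply (rule exec.Seq[of _ _ _ _ s1 w])
         apply (rule exec_Assign'; simp add: s1_def s)
        apply (rule exec.Seq[OF 2(1)])
        apply (subst 2(3)[symmetric], subst expr_cost.simps(1)[of 0 s2, unfolded eval_expr.simps(1), symmetric])
        apply (rule exec.Cond_True)
         apply (simp add: 2 True)
        apply (rule exec.Seq[OF _ 4(1)])
        apply (rule exec_Assign'; simp add: s2n)
        done
      moreover have "s4 y = s y" if "y \<ge> n + 1" for y using 4(4)[of y] fr[of y] that n by simp
      ultimately show ?thesis using 2(2) 4(2,3) True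
        by - (intro exI conjI, rule ex, auto simp: h_def)
    next
      case False
      from g(1) s3 obtain t4 s4 where 4: "exec cg ?s3 w t4 s4 w" "t4 \<le> hg x" "s4 0 = enc (g x)"
        "\<And>y. y \<ge> ng \<Longrightarrow> s4 y = ?s3 y" by (rule runsE) blast
      have ex: "exec c s w (1 + (1 + esize x) + (1 + t2 + (1 + esize (b x) +
          (1 + (1 + esize x) + t4)))) s4 w"
        unfolding c_def
        apply (rule exec.Seq[of _ _ _ _ s1 w])
         apply (rule exec_Assign'; simp add: s1_def s)
        apply (rule exec.Seq[OF 2(1)])
        apply (subst 2(3)[symmetric], subst expr_cost.simps(1)[of 0 s2, unfolded eval_expr.simps(1), symmetric])
        apply (rule exec.Cond_False)
         apply (simp add: 2 False)
        apply (rule exec.Seq[OF _ 4(1)])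
        apply (rule exec_Assign'; simp add: s2n)
        done
      moreover have "s4 y = s y" if "y \<ge> n + 1" for y using 4(4)[of y] fr[of y] that n by simp
      ultimately show ?thesis using 2(2) 4(2,3) False
        by - (intro exI conjI, rule ex, auto simp: h_def)
    qed
  qed
  moreover have "polybound h" unfolding h_def by (intro polybound_intros b f g)
  moreover have "polybound (\<lambda>x. esize (if b x then f x else g x))"
    by (rule polybound_mono[OF polybound_add[OF f(3) g(3)]]) auto
  ultimately show ?thesis unfolding polytime_def by blast
qed

text \<open>Iterating a polynomial-time step need not be polynomial: the accumulator could square
  its size in every round. Hence \<open>B\<close> has to bound the accumulator after every prefix of
  the list, and then all rounds are charged the same amount.\<close>

lemma polytime_foldl:
  fixes f :: "'a::encodable \<Rightarrow> 'b::encodable \<Rightarrow> 'c::encodable \<Rightarrow> 'b" and a :: "'a \<Rightarrow> 'b" and l :: "'a \<Rightarrow> 'c list"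
  assumes "polytime (\<lambda>z. f (fst (fst z)) (snd (fst z)) (snd z))"
    and "polytime a" and "polytime l"
    and bound: "polybound B"
    and B: "\<And>x ys zs. l x = ys @ zs \<Longrightarrow> esize (foldl (f x) (a x) ys) \<le> B x"
  shows "polytime (\<lambda>x. foldl (f x) (a x) (l x))"
proof -
  let ?f = "\<lambda>z. f (fst (fst z)) (snd (fst z)) (snd z)"
  obtain cf nf hf where f: "runs cf nf ?f hf" "polybound hf" "polybound (\<lambda>z. esize (?f z))" "nf > 0"
    using assms(1) by (rule polytimeE)
  obtain ca na ha where a: "runs ca na a ha" "polybound ha" "polybound (\<lambda>x. esize (a x))" "na > 0"
    using assms(2) by (rule polytimeE)
  obtain cl nl hl where l: "runs cl nl l hl" "polybound hl" "polybound (\<lambda>x. esize (l x))" "nl > 0"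
    using assms(3) by (rule polytimeE)
  obtain af where af: "\<And>z. hf z \<le> (esize z + 2) ^ af" using f(2) unfolding polybound_def by blast
  define n where "n = max nf (max na nl)"
  have n: "n > 0" "n \<ge> nf" "n \<ge> na" "n \<ge> nl" using f(4) by (auto simp: n_def)
  define vx where "vx = n"
  define va where "va = n + 1"
  define vl where "vl = n + 2"
  \<comment> \<open>The empty list is encoded by a number and a nonempty one by a
    \<open>Cell\<close>, so the loop goes on while register \<open>vl\<close> does not hold a
    number.\<close>
  define test where "test = Equal (Is_Num (Var vl)) (Const 0)"
  define body where "body = Seq (Assign 0 (Pack (Pack (Var vx) (Var va)) (Head (Var vl))))
    (Seq cf (Seq (Assign va (Var 0)) (Assign vl (Tail (Var vl)))))"
  define c where "c = Seq (Assign vx (Var 0)) (Seq ca (Seq (Assign va (Var 0)) (Seq (Assign 0 (Var vx))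
    (Seq cl (Seq (Assign vl (Var 0)) (Seq (While test body) (Assign 0 (Var va))))))))"
  \<comment> \<open>\<open>S\<close> bounds the argument of \<open>cf\<close> in every round, and
    \<open>st\<close> bounds the time of a whole round; its power is the time bound of
    \<open>cf\<close>.\<close>
  define S where "S x = 8 + esize x + esize (l x) + B x" for x
  define st where "st x = 20 * S x + (S x + 2) ^ af" for x
  have loop: "\<exists>t s'. exec (While test body) s w t s' w \<and> t \<le> (1 + length zs) * st x \<and>
      s' va = enc (foldl (f x) (a x) (l x)) \<and> (\<forall>y\<ge>n + 3. s' y = s y)"
    if "l x = ys @ zs" and "s vx = enc x" and "s va = enc (foldl (f x) (a x) ys)" and "s vl = enc zs"
    for x ys zs s w
    using that
  proof (induction zs arbitrary: ys s)
    case Nil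
    have "exec (While test body) s w (1 + expr_cost test s) s w"
      by (rule exec.While_False) (simp add: test_def Nil)
    moreover have "1 + expr_cost test s \<le> 20 * S x"
      by (simp add: test_def Nil S_def floorlog_eq_zero_iff) (simp add: floorlog_def)
    ultimately show ?case using Nil
      by (intro exI[of _ "1 + expr_cost test s"] exI[of _ s]) (auto simp: st_def)
  next
    case (Cons z zs)
    define u where "u = foldl (f x) (a x) ys"
    have eu: "esize u \<le> B x" using B[OF Cons.prems(1)] by (simp add: u_def)
    have eu': "esize (f x u z) \<le> B x"
      using B[of x "ys @ [z]" zs] Cons.prems(1) by (simp add: u_def)
    have el: "esize z + esize zs < esize (l x)"
    proof -
      have "esize z + esize zs < esize (ws @ z # zs)" for ws
        by (induction ws) auto
      then show ?thesis using Cons.prems(1) by simp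
    qed
    define s1 where "s1 = s(0 := enc ((x, u), z))"
    have "s1 0 = enc ((x, u), z)" by (simp add: s1_def)
    with f(1) obtain t2 s2 where 2: "exec cf s1 w t2 s2 w" "t2 \<le> hf ((x, u), z)"
      "s2 0 = enc (?f ((x, u), z))" "\<And>y. y \<ge> nf \<Longrightarrow> s2 y = s1 y" by (rule runsE) blast
    define s3 where "s3 = s2(va := enc (f x u z), vl := enc zs)"
    have keep: "s2 y = s y" if "y \<ge> n" for y
      using that 2(4)[of y] n by (simp add: s1_def)
    have vs: "s2 vl = Cell (enc z) (enc zs)" "s2 vx = enc x"
      using keep[of vl] keep[of vx] Cons.prems by (auto simp: vl_def vx_def)
    let ?t1 = "1 + expr_cost (Pack (Pack (Var vx) (Var va)) (Head (Var vl))) s"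
    let ?t3 = "1 + esize (f x u z)"
    let ?t4 = "1 + expr_cost (Tail (Var vl)) (s2(va := enc (f x u z)))"
    have b: "exec body s w (1 + ?t1 + (1 + t2 + (1 + ?t3 + ?t4))) s3 w"
      unfolding body_def
      apply (rule exec.Seq[of _ _ _ _ s1 w])
       apply (rule exec_Assign'; simp add: s1_def Cons.prems u_def)
      apply (rule exec.Seq[OF 2(1)])
      apply (rule exec.Seq[of _ _ _ _ "s2(va := enc (f x u z))" w])
       apply (rule exec_Assign'; simp add: 2)
      apply (rule exec_Assign'; simp add: s3_def vs va_def vl_def)
      using vs by (simp_all add: vl_def va_def)
    have "\<exists>t s'. exec (While test body) s3 w t s' w \<and> t \<le> (1 + length zs) * st x \<and>
        s' va = enc (foldl (f x) (a x) (l x)) \<and> (\<forall>y\<ge>n + 3. s' y = s3 y)"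
      by (rule Cons.IH[of "ys @ [z]"])
        (use Cons.prems vs in \<open>auto simp: s3_def u_def va_def vl_def vx_def\<close>)
    then obtain t' s' where IH: "exec (While test body) s3 w t' s' w" "t' \<le> (1 + length zs) * st x"
      "s' va = enc (foldl (f x) (a x) (l x))" "\<And>y. y \<ge> n + 3 \<Longrightarrow> s' y = s3 y" by blast
    let ?t = "1 + expr_cost test s + (1 + ?t1 + (1 + t2 + (1 + ?t3 + ?t4))) + t'"
    have ex: "exec (While test body) s w ?t s' w"
      by (rule exec.While_True[OF _ b IH(1)]) (simp add: test_def Cons.prems)
    have fl: "floorlog 2 (Suc 0) = Suc 0" "floorlog 2 0 = 0" by (simp_all add: floorlog_def)
    have t2: "t2 \<le> (S x + 2) ^ af"
    proof -
      have "esize ((x, u), z) \<le> S x" using eu el by (simp add: S_def)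
      then have "(esize ((x, u), z) + 2) ^ af \<le> (S x + 2) ^ af" by (intro power_mono) auto
      then show ?thesis using 2(2) af[of "((x, u), z)"] by linarith
    qed
    have ct: "expr_cost test s \<le> 8 + esize (l x)"
      using el by (simp add: test_def Cons.prems fl)
    have c1: "?t1 \<le> 20 + 4 * esize x + 4 * B x + 4 * esize (l x)"
      using el eu by (simp add: Cons.prems u_def[symmetric])
    have c4: "?t4 \<le> 2 + 2 * esize (l x)"
      using el vs by (simp add: va_def vl_def)
    have "?t \<le> st x + t'"
      using t2 ct c1 c4 eu' by (simp add: st_def S_def)
    then have "?t \<le> (1 + length (z # zs)) * st x" using IH(2) by simp
    moreover have "s' y = s y" if "y \<ge> n + 3" for y
      using IH(4)[of y] keep[of y] that by (simp add: s3_def va_def vl_def)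
    ultimately show ?case using ex IH(3) by blast
  qed
  define h where "h x = 20 + 4 * esize x + 4 * esize (a x) + 4 * esize (l x) + ha x + hl x
     + (1 + esize (l x)) * st x + 4 * B x" for x
  have "runs c (n + 3) (\<lambda>x. foldl (f x) (a x) (l x)) h"
    unfolding runs_def
  proof (intro allI impI)
    fix x :: 'a and s :: store and w assume s: "s 0 = enc x"
    define s1 where "s1 = s(vx := enc x)"
    have "s1 0 = enc x" using s n by (simp add: s1_def)
    with a(1) obtain t2 s2 where 2: "exec ca s1 w t2 s2 w" "t2 \<le> ha x" "s2 0 = enc (a x)"
      "\<And>y. y \<ge> na \<Longrightarrow> s2 y = s1 y" by (rule runsE) blast
    define s3 where "s3 = s2(va := enc (a x), 0 := enc x)"
    have s2x: "s2 vx = enc x" using 2(4)[of vx] n by (simp add: s1_def vx_def)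
    have "s3 0 = enc x" by (simp add: s3_def)
    with l(1) obtain t4 s4 where 4: "exec cl s3 w t4 s4 w" "t4 \<le> hl x" "s4 0 = enc (l x)"
      "\<And>y. y \<ge> nl \<Longrightarrow> s4 y = s3 y" by (rule runsE) blast
    define s5 where "s5 = s4(vl := enc (l x))"
    have s5: "s5 vx = enc x" "s5 va = enc (a x)" "s5 vl = enc (l x)"
      using 4(4)[of vx] 4(4)[of va] n s2x by (auto simp: s5_def s3_def vx_def va_def vl_def)
    obtain t6 s6 where 6: "exec (While test body) s5 w t6 s6 w" "t6 \<le> (1 + length (l x)) * st x"
      "s6 va = enc (foldl (f x) (a x) (l x))" "\<And>y. y \<ge> n + 3 \<Longrightarrow> s6 y = s5 y"
      using loop[of x "[]" "l x" s5 w] s5 by auto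
    let ?s7 = "s6(0 := enc (foldl (f x) (a x) (l x)))"
    have ex: "exec c s w (1 + (1 + esize x) + (1 + t2 + (1 + (1 + esize (a x)) + (1 + (1 + esize x) +
        (1 + t4 + (1 + (1 + esize (l x)) + (1 + t6 + (1 + esize (foldl (f x) (a x) (l x)))))))))) ?s7 w"
      unfolding c_def
      apply (rule exec.Seq[of _ _ _ _ s1 w])
       apply (rule exec_Assign'; simp add: s1_def s)
      apply (rule exec.Seq[OF 2(1)])
      apply (rule exec.Seq[of _ _ _ _ "s2(va := enc (a x))" w])
       apply (rule exec_Assign'; simp add: 2)
      apply (rule exec.Seq[of _ _ _ _ s3 w])
       apply (rule exec_Assign'; use s2x in \<open>simp add: s3_def va_def vx_def\<close>)
      apply (rule exec.Seq[OF 4(1)])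
      apply (rule exec.Seq[of _ _ _ _ s5 w])
       apply (rule exec_Assign'; simp add: 4(3) s5_def)
      apply (rule exec.Seq[OF 6(1)])
      apply (rule exec_Assign'; simp add: 6(3))
      done
    moreover have "s6 y = s y" if "y \<ge> n + 3" for y
      using that n 6(4)[of y] 4(4)[of y] 2(4)[of y]
      by (simp add: s5_def s3_def s1_def vx_def va_def vl_def)
    moreover have "length (l x) \<le> esize (l x)"
    proof -
      have "length ws \<le> esize ws" for ws :: "'c list" by (induction ws) auto
      then show ?thesis .
    qed
    then have "(1 + length (l x)) * st x \<le> (1 + esize (l x)) * st x" by (intro mult_right_mono) auto
    then have "t6 \<le> (1 + esize (l x)) * st x" using 6(2) by linarith
    moreover have "esize (foldl (f x) (a x) (l x)) \<le> B x" using B[of x "l x" "[]"] by simp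
    ultimately show "\<exists>t s'. exec c s w t s' w \<and> t \<le> h x \<and>
        s' 0 = enc (foldl (f x) (a x) (l x)) \<and> (\<forall>y\<ge>n + 3. s' y = s y)"
      using 2(2) 4(2) n by - (intro exI conjI, rule ex, auto simp: h_def)
  qed
  moreover have "polybound h"
    unfolding h_def st_def S_def by (intro polybound_intros a l bound)
  moreover have "polybound (\<lambda>x. esize (foldl (f x) (a x) (l x)))"
    by (rule polybound_mono[OF bound]) (use B[of _ _ "[]"] in simp)
  ultimately show ?thesis unfolding polytime_def by blast
qed

subsection \<open>Sizes of encodings\<close>

lemma floorlog_2_0 [simp]: "floorlog 2 0 = 0" and floorlog_2_1 [simp]: "floorlog 2 (Suc 0) = Suc 0"
  by (simp_all add: floorlog_def)

lemma floorlog_2_le: "floorlog 2 n \<le> n"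
proof (rule floorlog_leI)
  show "n < 2 ^ n" by simp
qed auto

lemma esize_nat_le: "esize (n :: nat) \<le> Suc n"
  by (simp add: floorlog_2_le)

lemma floorlog_2_add: "floorlog 2 (m + n) \<le> Suc (floorlog 2 m + floorlog 2 n)"
proof (cases "m = 0 \<or> n = 0")
  case True
  then show ?thesis by auto
next
  case False
  show ?thesis
  proof (rule floorlog_leI)
    have "m < 2 ^ floorlog 2 m" "n < 2 ^ floorlog 2 n"
      using False floorlog_bounds[of m 2] floorlog_bounds[of n 2] by auto
    moreover have "(2 :: nat) ^ a + 2 ^ b \<le> 2 ^ Suc (a + b)" for a b
    proof -
      have "(2 :: nat) ^ a \<le> 2 ^ (a + b)" "(2 :: nat) ^ b \<le> 2 ^ (a + b)"
        by (simp_all add: power_increasing)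
      then have "(2 :: nat) ^ a + 2 ^ b \<le> 2 ^ (a + b) + 2 ^ (a + b)" by (rule add_mono)
      then show ?thesis by simp
    qed
    ultimately have "m + n < 2 ^ Suc (floorlog 2 m + floorlog 2 n)"
      by (meson add_strict_mono less_le_trans)
    then show "m + n < 2 ^ Suc (floorlog 2 m + floorlog 2 n)" .
  qed auto
qed

lemma floorlog_2_mult: "floorlog 2 (m * n) \<le> floorlog 2 m + floorlog 2 n"
proof (cases "m = 0 \<or> n = 0")
  case True
  then show ?thesis by (auto simp: floorlog_def)
next
  case False
  show ?thesis
  proof (rule floorlog_leI)
    have "m < 2 ^ floorlog 2 m" "n < 2 ^ floorlog 2 n"
      using False floorlog_bounds[of m 2] floorlog_bounds[of n 2] by auto
    then have "m * n < 2 ^ floorlog 2 m * 2 ^ floorlog 2 n"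
      by (intro mult_strict_mono) auto
    then have "m * n < 2 ^ (floorlog 2 m + floorlog 2 n)"
      by (simp add: power_add)
    then show "m * n < 2 ^ (floorlog 2 m + floorlog 2 n)" .
  qed auto
qed

lemma esize_list: "esize xs = Suc (\<Sum>x\<leftarrow>xs. Suc (esize x))"
  by (induction xs) auto

lemma esize_append: "esize (xs @ ys) = esize xs + esize ys - 1"
  by (simp add: esize_list)

lemma esize_member: "x \<in> set xs \<Longrightarrow> esize x < esize xs"
  by (induction xs) auto

lemma length_le_esize: "length xs \<le> esize xs"
  by (induction xs) auto

lemma esize_list_le: "(\<And>x. x \<in> set xs \<Longrightarrow> esize x \<le> b) \<Longrightarrow> esize xs \<le> Suc (length xs * Suc b)"
proof (induction xs)
  case (Cons x xs)
  then have "esize x \<le> b" "esize xs \<le> Suc (length xs * Suc b)" by simp_all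
  then show ?case by simp
qed simp

lemma polybound_length: "polytime l \<Longrightarrow> polybound (\<lambda>x. length (l x))"
  by (rule polybound_mono[OF polytime_esize length_le_esize])

lemma polybound_member:
  assumes "polytime (\<lambda>z. f (fst z) (snd z))" and "polytime l"
  obtains g where "polybound g" "\<And>x y. y \<in> set (l x) \<Longrightarrow> esize (f x y) \<le> g x"
proof -
  obtain a where a: "\<And>z. esize (f (fst z) (snd z)) \<le> (esize z + 2) ^ a"
    using polytime_esize[OF assms(1)] unfolding polybound_def by blast
  let ?g = "\<lambda>x. (esize x + esize (l x) + 3) ^ a"
  have "esize (f x y) \<le> ?g x" if "y \<in> set (l x)" for x y
  proof -
    have "esize (f x y) \<le> (esize (x, y) + 2) ^ a" using a[of "(x, y)"] by simp
    also have "\<dots> \<le> ?g x" using esize_member[OF that] by (intro power_mono) auto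
    finally show ?thesis .
  qed
  moreover have "polybound ?g" by (intro polybound_intros polytime_esize assms)
  ultimately show ?thesis using that by blast
qed

text \<open>The usual way to meet the size condition of \<open>polytime_foldl\<close>: growth per
  round that does not depend on the accumulator sums to a product of two polynomial bounds.\<close>

lemma polytime_foldl_additive:
  assumes "polytime (\<lambda>z. f (fst (fst z)) (snd (fst z)) (snd z))"
    and "polytime a" and "polytime l" and "polybound g"
    and f: "\<And>x u y. y \<in> set (l x) \<Longrightarrow> esize (f x u y) \<le> esize u + g x"
  shows "polytime (\<lambda>x. foldl (f x) (a x) (l x))"
proof (rule polytime_foldl[OF assms(1-3), of "\<lambda>x. esize (a x) + length (l x) * g x"])
  show "polybound (\<lambda>x. esize (a x) + length (l x) * g x)"
    by (intro polybound_intros polytime_esize polybound_length assms)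
next
  fix x ys zs assume l: "l x = ys @ zs"
  have "esize (foldl (f x) (a x) ys) \<le> esize (a x) + length ys * g x" if "set ys \<subseteq> set (l x)" for ys
    using that
  proof (induction ys rule: rev_induct)
    case (snoc y ys)
    then have "esize (f x (foldl (f x) (a x) ys) y) \<le> esize (foldl (f x) (a x) ys) + g x"
      by (intro f) auto
    with snoc show ?case by simp
  qed simp
  from this[of ys] l show "esize (foldl (f x) (a x) ys) \<le> esize (a x) + length (l x) * g x"
    by (auto elim!: order_trans)
qed

subsection \<open>Arithmetic and logic\<close>

text \<open>The condition on \<open>floorlog\<close> keeps the number of bits of the result linear
  in those of the operands, which is all the cost model asks for.\<close>

lemma polytime_binop:
  fixes op1 :: "nat \<Rightarrow> nat \<Rightarrow> 'c::encodable"
  assumes "\<And>m n. enc (op1 m n) = Num (apply_op b m n)"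
    and "\<And>m n. floorlog 2 (apply_op b m n) \<le> 4 + floorlog 2 m + floorlog 2 n"
    and "polytime f" and "polytime g"
  shows "polytime (\<lambda>x. op1 (f x) (g x))"
proof (rule polytime_comp2[of op1, OF _ assms(3,4)])
  have e: "esize (op1 m n) \<le> 5 + esize m + esize n" for m n
    using assms(2)[of m n] by (simp add: assms(1))
  show "polytime (\<lambda>z. op1 (fst z) (snd z))"
  proof (rule polytime_expr[of "Op b (Head (Var 0)) (Tail (Var 0))" _ "\<lambda>z. 10 + 6 * esize z"])
    show "polybound (\<lambda>z :: nat \<times> nat. 10 + 6 * esize z)" by (intro polybound_intros)
    show "polybound (\<lambda>z. esize (op1 (fst z) (snd z)))"
      by (rule polybound_mono[OF polybound_add[OF polybound_const polybound_esize], of _ 5])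
        (use order_trans[OF e] in simp)
    fix z :: "nat \<times> nat" and s :: store
    assume s: "s 0 = enc z"
    show "eval_expr (Op b (Head (Var 0)) (Tail (Var 0))) s = enc (op1 (fst z) (snd z))"
      by (simp add: s assms(1))
    have "val_size (Num (apply_op b (fst z) (snd z))) \<le> 5 + esize z"
      using e[of "fst z" "snd z"] by (simp add: assms(1))
    then show "expr_cost (Op b (Head (Var 0)) (Tail (Var 0))) s \<le> 10 + 6 * esize z"
      by (simp add: s)
  qed
qed

lemma polytime_plus: "polytime f \<Longrightarrow> polytime g \<Longrightarrow> polytime (\<lambda>x. f x + g x :: nat)"
  by (rule polytime_binop[of _ Plus]) (auto intro: order_trans[OF floorlog_2_add])

lemma polytime_times: "polytime f \<Longrightarrow> polytime g \<Longrightarrow> polytime (\<lambda>x. f x * g x :: nat)"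
  by (rule polytime_binop[of _ Times]) (auto intro: order_trans[OF floorlog_2_mult])

lemma polytime_less: "polytime f \<Longrightarrow> polytime g \<Longrightarrow> polytime (\<lambda>x. f x < (g x :: nat))"
  by (rule polytime_binop[of _ Less]) (auto simp: floorlog_def)

lemma polytime_not: "polytime b \<Longrightarrow> polytime (\<lambda>x. \<not> b x)"
  by (rule back_subst[of polytime, OF polytime_If[OF _ polytime_const[of False] polytime_const[of True], of b]]) (auto simp: fun_eq_iff)

lemma polytime_conj: "polytime b \<Longrightarrow> polytime c \<Longrightarrow> polytime (\<lambda>x. b x \<and> c x)"
  by (rule back_subst[of polytime, OF polytime_If[OF _ _ polytime_const[of False], of b c]]) (auto simp: fun_eq_iff)

lemma polytime_disj: "polytime b \<Longrightarrow> polytime c \<Longrightarrow> polytime (\<lambda>x. b x \<or> c x)"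
  by (rule back_subst[of polytime, OF polytime_If[OF _ polytime_const[of True], of b c]]) (auto simp: fun_eq_iff)

lemma polytime_imp: "polytime b \<Longrightarrow> polytime c \<Longrightarrow> polytime (\<lambda>x. b x \<longrightarrow> c x)"
  by (rule back_subst[of polytime, OF polytime_If[OF _ _ polytime_const[of True], of b c]]) (auto simp: fun_eq_iff)

lemma polytime_le: "polytime f \<Longrightarrow> polytime g \<Longrightarrow> polytime (\<lambda>x. f x \<le> (g x :: nat))"
  using polytime_not[OF polytime_less[of g f]] by (simp add: not_less)

lemma polytime_eq:
  assumes "polytime f" and "polytime g"
  shows "polytime (\<lambda>x. f x = g x)"
proof (rule polytime_comp2[of "(=)", OF _ assms])
  have b: "esize b \<le> 2" for b :: bool by (simp add: floorlog_def)
  show "polytime (\<lambda>z :: 'b \<times> 'b. fst z = snd z)"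
  proof (rule polytime_expr[of "Equal (Head (Var 0)) (Tail (Var 0))" _ "\<lambda>z. 10 + 6 * esize z"])
    show "polybound (\<lambda>z :: 'b \<times> 'b. 10 + 6 * esize z)" by (intro polybound_intros)
    show "polybound (\<lambda>z :: 'b \<times> 'b. esize (fst z = snd z))"
      by (rule polybound_mono[OF polybound_const b])
    fix z :: "'b \<times> 'b" and s :: store
    assume s: "s 0 = enc z"
    show "eval_expr (Equal (Head (Var 0)) (Tail (Var 0))) s = enc (fst z = snd z)" by (simp add: s)
    show "expr_cost (Equal (Head (Var 0)) (Tail (Var 0))) s \<le> 10 + 6 * esize z"
      using b[of "fst z = snd z"] by (simp add: s)
  qed
qed

lemma polytime_Some: "polytime f \<Longrightarrow> polytime (\<lambda>x. Some (f x))"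
  by (rule polytime_comp[OF polytime_expr[of "Pack (Const 0) (Var 0)" Some "\<lambda>x. 5 + 2 * esize x"]];
      (intro polybound_intros polybound_mono[OF polybound_add[OF polybound_const polybound_esize, of 2]])?)
    (auto simp: floorlog_def)

subsection \<open>Lists\<close>

lemma polytime_Cons:
  "polytime f \<Longrightarrow> polytime g \<Longrightarrow> polytime (\<lambda>x. f x # g x)"
  by (rule polytime_comp2[of "(#)"], rule polytime_expr[of "Var 0" _ esize];
      (intro polybound_intros polybound_mono[OF polybound_esize])?) auto

lemma polytime_tl: "polytime f \<Longrightarrow> polytime (\<lambda>x. tl (f x))"
proof (rule polytime_comp[OF polytime_expr[of "Tail (Var 0)" tl "\<lambda>x. 2 * esize x"]])
  have e: "esize (tl xs) \<le> esize xs" for xs :: "'b list" by (cases xs) auto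
  show "polybound (\<lambda>x :: 'b list. 2 * esize x)" by (intro polybound_intros)
  show "polybound (\<lambda>x :: 'b list. esize (tl x))" by (rule polybound_mono[OF polybound_esize e])
  fix x :: "'b list" and s :: store
  assume s: "s 0 = enc x"
  then show "eval_expr (Tail (Var 0)) s = enc (tl x)" by (cases x) auto
  with s e[of x] show "expr_cost (Tail (Var 0)) s \<le> 2 * esize x" by simp
qed

lemma polytime_rev: "polytime l \<Longrightarrow> polytime (\<lambda>x. rev (l x))"
proof -
  assume l: "polytime l"
  have *: "foldl (\<lambda>u y. y # u) acc ys = rev ys @ acc" for acc ys :: "'b list"
    by (induction ys arbitrary: acc) auto
  have "polytime (\<lambda>x. foldl (\<lambda>u y. y # u) [] (l x))"
  proof (rule polytime_foldl_additive[where g = "\<lambda>x. esize (l x)"])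
    fix x u y assume "y \<in> set (l x)"
    then show "esize (y # u) \<le> esize u + esize (l x)" using esize_member[of y "l x"] by simp
  qed (intro polytime_Cons polytime_fst polytime_snd polytime_id polytime_const l polytime_esize)+
  then show ?thesis by (simp add: *)
qed

lemma polytime_map:
  assumes f: "polytime (\<lambda>z. f (fst z) (snd z))" and l: "polytime l"
  shows "polytime (\<lambda>x. map (f x) (l x))"
proof -
  have *: "foldl (\<lambda>u y. h y # u) acc ys = rev (map h ys) @ acc" for h :: "'b \<Rightarrow> 'c" and acc ys
    by (induction ys arbitrary: acc) auto
  obtain g where g: "polybound g" "\<And>x y. y \<in> set (l x) \<Longrightarrow> esize (f x y) \<le> g x"
    by (rule polybound_member[of f l, OF assms]) blast
  have "polytime (\<lambda>x. foldl (\<lambda>u y. f x y # u) [] (l x))"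
  proof (rule polytime_foldl_additive[where g = "\<lambda>x. Suc (g x)"])
    show "polybound (\<lambda>x. Suc (g x))" using polybound_add[OF polybound_const[of 1] g(1)] by simp
    fix x u y assume "y \<in> set (l x)"
    then show "esize (f x y # u) \<le> esize u + Suc (g x)" using g(2)[of y x] by simp
  qed (intro polytime_Cons polytime_comp2[OF f] polytime_fst polytime_snd polytime_id polytime_const l)+
  from polytime_rev[OF this] show ?thesis by (simp add: *)
qed

lemma polytime_filter:
  assumes f: "polytime (\<lambda>z. P (fst z) (snd z))" and l: "polytime l"
  shows "polytime (\<lambda>x. filter (P x) (l x))"
proof -
  have *: "foldl (\<lambda>u y. if Q y then y # u else u) acc ys = rev (filter Q ys) @ acc"
    for Q :: "'b \<Rightarrow> bool" and acc ys
    by (induction ys arbitrary: acc) auto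
  have "polytime (\<lambda>x. foldl (\<lambda>u y. if P x y then y # u else u) [] (l x))"
  proof (rule polytime_foldl_additive[where g = "\<lambda>x. esize (l x)"])
    fix x u y assume "y \<in> set (l x)"
    then show "esize (if P x y then y # u else u) \<le> esize u + esize (l x)"
      using esize_member[of y "l x"] by simp
  qed (intro polytime_Cons polytime_If polytime_comp2[OF f] polytime_fst polytime_snd polytime_id
      polytime_const l polytime_esize)+
  from polytime_rev[OF this] show ?thesis by (simp add: *)
qed

lemma polytime_append:
  assumes "polytime f" and "polytime g"
  shows "polytime (\<lambda>x. f x @ g x)"
proof -
  have *: "foldl (\<lambda>u y. y # u) acc ys = rev ys @ acc" for acc ys :: "'b list"
    by (induction ys arbitrary: acc) auto
  have "polytime (\<lambda>x. foldl (\<lambda>u y. y # u) (g x) (rev (f x)))"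
  proof (rule polytime_foldl_additive[where g = "\<lambda>x. esize (f x)"])
    fix x u y assume "y \<in> set (rev (f x))"
    then show "esize (y # u) \<le> esize u + esize (f x)" using esize_member[of y "f x"] by simp
  qed (intro polytime_Cons polytime_fst polytime_snd polytime_id polytime_rev assms polytime_esize)+
  then show ?thesis by (simp add: *)
qed

lemma polytime_concat:
  assumes l: "polytime l"
  shows "polytime (\<lambda>x. concat (l x))"
proof -
  have *: "foldl (\<lambda>u y. u @ y) acc ys = acc @ concat ys" for acc :: "'b list" and ys
    by (induction ys arbitrary: acc) auto
  have "polytime (\<lambda>x. foldl (\<lambda>u y. u @ y) [] (l x))"
  proof (rule polytime_foldl_additive[where g = "\<lambda>x. esize (l x)"])
    fix x u y assume "y \<in> set (l x)"
    then show "esize (u @ y) \<le> esize u + esize (l x)"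
      using esize_member[of y "l x"] by (simp add: esize_append)
  qed (intro polytime_append polytime_fst polytime_snd polytime_id polytime_const l polytime_esize)+
  then show ?thesis by (simp add: *)
qed

lemma polytime_Bex:
  assumes f: "polytime (\<lambda>z. P (fst z) (snd z))" and l: "polytime l"
  shows "polytime (\<lambda>x. \<exists>y\<in>set (l x). P x y)"
proof -
  have *: "foldl (\<lambda>u y. u \<or> Q y) acc ys \<longleftrightarrow> acc \<or> (\<exists>y\<in>set ys. Q y)" for Q :: "'b \<Rightarrow> bool" and acc ys
    by (induction ys arbitrary: acc) auto
  have "polytime (\<lambda>x. foldl (\<lambda>u y. u \<or> P x y) False (l x))"
  proof (rule polytime_foldl_additive[where g = "\<lambda>x. 2"])
    fix x u y
    show "esize (u \<or> P x y) \<le> esize u + 2" by (simp add: floorlog_def)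
  qed (intro polytime_disj polytime_comp2[OF f] polytime_fst polytime_snd polytime_id polytime_const l
      polybound_const)+
  then show ?thesis by (simp add: *)
qed

lemma polytime_Ball:
  "polytime (\<lambda>z. P (fst z) (snd z)) \<Longrightarrow> polytime l \<Longrightarrow> polytime (\<lambda>x. \<forall>y\<in>set (l x). P x y)"
  using polytime_not[OF polytime_Bex[OF polytime_not], of P l] by simp

lemma polytime_member:
  assumes f: "polytime f" and l: "polytime l"
  shows "polytime (\<lambda>x. f x \<in> set (l x))"
proof -
  have "polytime (\<lambda>x. \<exists>y\<in>set (l x). f x = y)"
    by (intro polytime_Bex polytime_eq polytime_comp[OF f] polytime_fst polytime_snd polytime_id l)
  then show ?thesis by simp
qed

lemma polytime_length:
  assumes l: "polytime l"
  shows "polytime (\<lambda>x. length (l x))"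
proof -
  have *: "foldl (\<lambda>u y. u + 1) acc ys = acc + length ys" for acc and ys :: "'b list"
    by (induction ys arbitrary: acc) auto
  have "polytime (\<lambda>x. foldl (\<lambda>u y. u + 1) (0 :: nat) (l x))"
  proof (rule polytime_foldl_additive[where g = "\<lambda>x. 5"])
    fix x y and u :: nat
    show "esize (u + 1) \<le> esize u + 5" using floorlog_2_add[of u 1] by (simp add: floorlog_def)
  qed (intro polytime_plus polytime_fst polytime_snd polytime_id polytime_const l
      polybound_const)+
  then show ?thesis unfolding * by simp
qed

lemma polytime_sum_list:
  assumes l: "polytime l"
  shows "polytime (\<lambda>x. sum_list (l x) :: nat)"
proof -
  have *: "foldl (\<lambda>u y. u + y) acc ys = acc + sum_list ys" for acc :: nat and ys
    by (induction ys arbitrary: acc) auto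
  have "polytime (\<lambda>x. foldl (\<lambda>u y. u + y) (0 :: nat) (l x))"
  proof (rule polytime_foldl_additive[where g = "\<lambda>x. esize (l x)"])
    fix x y and u :: nat
    assume "y \<in> set (l x)"
    then show "esize (u + y) \<le> esize u + esize (l x)"
      using floorlog_2_add[of u y] esize_member[of y "l x"] by simp
  qed (intro polytime_plus polytime_fst polytime_snd polytime_id polytime_const l
      polytime_esize)+
  then show ?thesis by (simp add: *)
qed

text \<open>Case distinction is itself built from folds: one fold cuts the list down to its first
  element, and a second fold over this list of length at most 1 applies \<open>f\<close> without
  looking at the accumulator. The branch receives the head only; a tail is taken with
  \<open>tl\<close>.\<close>

lemma polytime_case_list:
  assumes f: "polytime (\<lambda>z. f (fst z) (snd z))" and a: "polytime a" and l: "polytime l"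
  shows "polytime (\<lambda>x. case l x of [] \<Rightarrow> a x | y # ys \<Rightarrow> f x y)"
proof -
  have keep: "foldl (\<lambda>u y. if u = [] then [y] else u) acc ys = (if acc = [] then take 1 ys else acc)"
    for acc ys :: "'b list"
    by (induction ys arbitrary: acc) auto
  have "polytime (\<lambda>x. foldl (\<lambda>u y. if u = [] then [y] else u) [] (l x))"
  proof (rule polytime_foldl_additive[where g = "\<lambda>x. esize (l x)"])
    fix x u y assume "y \<in> set (l x)"
    then show "esize (if u = [] then [y] else u) \<le> esize u + esize (l x)"
      using esize_member[of y "l x"] by (simp add: floorlog_def)
  qed (intro polytime_Cons polytime_If polytime_eq polytime_fst polytime_snd polytime_id
      polytime_const l polytime_esize)+
  then have t: "polytime (\<lambda>x. take 1 (l x))" by (simp add: keep)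
  obtain g where g: "polybound g" "\<And>x y. y \<in> set (take 1 (l x)) \<Longrightarrow> esize (f x y) \<le> g x"
    by (rule polybound_member[of f "\<lambda>x. take 1 (l x)", OF f t]) blast
  have "polytime (\<lambda>x. foldl (\<lambda>u y. f x y) (a x) (take 1 (l x)))"
  proof (rule polytime_foldl_additive[where g = g])
    fix x u y assume "y \<in> set (take 1 (l x))"
    then show "esize (f x y) \<le> esize u + g x" using g(2)[of y x] by simp
  qed (intro polytime_comp2[OF f] polytime_fst polytime_snd polytime_id a t g)+
  moreover have "foldl (\<lambda>u y. f x y) (a x) (take 1 (l x)) = (case l x of [] \<Rightarrow> a x | y # ys \<Rightarrow> f x y)" for x
    by (cases "l x") auto
  ultimately show ?thesis by simp
qed

lemma polytime_zip:
  assumes f: "polytime f" and g: "polytime g"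
  shows "polytime (\<lambda>x. zip (f x) (g x))"
proof -
  define step :: "('b \<times> 'c) list \<times> 'c list \<Rightarrow> 'b \<Rightarrow> ('b \<times> 'c) list \<times> 'c list"
    where "step u y = (case snd u of [] \<Rightarrow> u | z # zs \<Rightarrow> ((y, z) # fst u, tl (snd u)))" for u y
  have *: "foldl step (acc, zs) ys = (rev (zip ys zs) @ acc, drop (length ys) zs)" for acc ys zs
    by (induction ys arbitrary: acc zs) (auto simp: step_def split: list.splits)
  have "polytime (\<lambda>x. foldl step ([], g x) (f x))"
  proof (rule polytime_foldl_additive[where g = "\<lambda>x. 5 + esize (f x)"])
    show "polytime (\<lambda>z. step (snd (fst z)) (snd z))"
      unfolding step_def
      by (intro polytime_case_list polytime_Pair polytime_Cons polytime_tl
          polytime_fst polytime_snd polytime_id)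
    fix x u y assume "y \<in> set (f x)"
    then show "esize (step u y) \<le> esize u + (5 + esize (f x))"
      using esize_member[of y "f x"] by (cases "snd u") (auto simp: step_def)
  qed (intro polytime_Pair polytime_const polytime_esize assms polybound_intros)+
  from polytime_rev[OF polytime_fst[OF this]] show ?thesis by (simp add: *)
qed

lemma polytime_upt_length:
  assumes l: "polytime l"
  shows "polytime (\<lambda>x. [0..<length (l x)])"
proof -
  have *: "foldl (\<lambda>u y. length u # u) [] ys = rev [0..<length ys]" for ys :: "'b list"
    by (induction ys rule: rev_induct) auto
  have "polytime (\<lambda>x. foldl (\<lambda>u y. length u # u) [] (l x))"
  proof (rule polytime_foldl[where B = "\<lambda>x. 1 + length (l x) * (2 + length (l x))"])
    show "polybound (\<lambda>x. 1 + length (l x) * (2 + length (l x)))"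
      by (intro polybound_intros polybound_length l)
    fix x ys zs assume lx: "l x = ys @ zs"
    have "esize (rev [0..<length ys]) \<le> Suc (length (rev [0..<length ys]) * Suc (Suc (length (l x))))"
    proof (rule esize_list_le)
      fix i assume "i \<in> set (rev [0..<length ys])"
      then show "esize i \<le> Suc (length (l x))" using lx esize_nat_le[of i] by simp
    qed
    also have "\<dots> \<le> 1 + length (l x) * (2 + length (l x))"
      using mult_right_mono[of "length ys" "length (l x)" "2 + length (l x)"] lx by simp
    finally show "esize (foldl (\<lambda>u y. length u # u) [] ys) \<le> 1 + length (l x) * (2 + length (l x))"
      by (simp add: *)
  qed (intro polytime_Cons polytime_length polytime_fst polytime_snd polytime_id polytime_const l)+
  from polytime_rev[OF this] show ?thesis by (simp add: *)
qed

text \<open>In binary, \<open>n x\<close> may be exponentially larger than its encoding, and so may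
  the range. The list \<open>l\<close> is a unary bound that excludes this.\<close>

lemma polytime_upt:
  assumes n: "polytime n" and l: "polytime l" and le: "\<And>x. n x \<le> length (l x)"
  shows "polytime (\<lambda>x. [0..<n x])"
proof -
  have "polytime (\<lambda>x. filter (\<lambda>i. i < n x) [0..<length (l x)])"
    by (intro polytime_filter polytime_less polytime_comp[OF n] polytime_fst polytime_snd polytime_id
        polytime_upt_length l)
  moreover have "filter (\<lambda>i. i < n x) [0..<length (l x)] = [0..<n x]" for x
  proof -
    have "filter (\<lambda>i. i < n x) [0..<n x + d] = [0..<n x]" for d by (induction d) auto
    from this[of "length (l x) - n x"] show ?thesis using le[of x] by simp
  qed
  ultimately show ?thesis by simp
qed

lemma foldl_funpow: "foldl (\<lambda>u y. f u) a l = (f ^^ length l) a"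
  by (induction l arbitrary: a) (auto simp: funpow_swap1)

text \<open>The number of rounds is the length of a list, for the same reason as in
  \<open>polytime_upt\<close>.\<close>

lemma polytime_funpow:
  fixes f :: "'a::encodable \<Rightarrow> 'b::encodable \<Rightarrow> 'b" and l :: "'a \<Rightarrow> 'c::encodable list"
  assumes f: "polytime (\<lambda>z. f (fst z) (snd z))" and a: "polytime a" and l: "polytime l"
    and B: "polybound B" "\<And>x j. j \<le> length (l x) \<Longrightarrow> esize ((f x ^^ j) (a x)) \<le> B x"
  shows "polytime (\<lambda>x. (f x ^^ length (l x)) (a x))"
proof -
  have "polytime (\<lambda>x. foldl (\<lambda>u y. f x u) (a x) (l x))"
  proof (rule polytime_foldl[where B = B])
    fix x ys zs assume "l x = ys @ zs"
    then show "esize (foldl (\<lambda>u y. f x u) (a x) ys) \<le> B x" by (simp add: foldl_funpow B)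
  qed (intro polytime_comp2[OF f] polytime_fst polytime_snd polytime_id a l B)+
  then show ?thesis by (simp add: foldl_funpow)
qed

text \<open>The result has about \<open>n x\<close> times as many bits as the base, so the exponent
  must be bounded in unary, here by the length of \<open>l\<close>.\<close>

lemma polytime_power:
  assumes b: "polytime b" and n: "polytime n" and l: "polytime l" and le: "\<And>x. n x \<le> length (l x)"
  shows "polytime (\<lambda>x. b x ^ n x :: nat)"
proof -
  have *: "foldl (\<lambda>u y. u * c) a l = a * c ^ length l" for a c :: nat and l :: "nat list"
    by (induction l arbitrary: a) auto
  have "polytime (\<lambda>x. foldl (\<lambda>u y. u * b x) 1 [0..<n x])"
  proof (rule polytime_foldl_additive[where g = "\<lambda>x. esize (b x)"])
    fix x y and u :: nat
    show "esize (u * b x) \<le> esize u + esize (b x)" using floorlog_2_mult[of u "b x"] by simp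
  qed (intro polytime_times polytime_comp[OF b] polytime_fst polytime_snd polytime_id polytime_const
      polytime_upt[OF n l le] polytime_esize b)+
  then show ?thesis unfolding * by simp
qed

lemma polytime_remove1:
  assumes f: "polytime f" and l: "polytime l"
  shows "polytime (\<lambda>x. remove1 (f x) (l x))"
proof -
  define step where "step c u y = (if \<not> fst u \<and> y = c then (True, snd u) else (fst u, y # snd u))"
    for c :: 'b and u y
  have *: "snd (foldl (step c) (b, acc) ys) = rev (if b then ys else remove1 c ys) @ acc" for b c acc ys
    by (induction ys arbitrary: b acc) (auto simp: step_def)
  have "polytime (\<lambda>x. foldl (step (f x)) (False, []) (l x))"
  proof (rule polytime_foldl_additive[where g = "\<lambda>x. 5 + esize (l x)"])
    show "polytime (\<lambda>z. step (f (fst (fst z))) (snd (fst z)) (snd z))"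
      unfolding step_def
      by (intro polytime_If polytime_conj polytime_not polytime_eq polytime_Pair polytime_Cons
          polytime_fst polytime_snd polytime_id polytime_const polytime_comp[OF f])
    fix x u y assume "y \<in> set (l x)"
    then show "esize (step (f x) u y) \<le> esize u + (5 + esize (l x))"
      using esize_member[of y "l x"] by (auto simp: step_def floorlog_def)
  qed (intro polytime_Pair polytime_const polytime_esize assms polybound_intros)+
  from polytime_rev[OF polytime_snd[OF this]] show ?thesis by (simp add: *)
qed

text \<open>Subtraction of multisets, see \<open>mset_list_diff\<close>. Multiplicities matter
  because arc capacities will be represented by repeated arcs.\<close>

definition list_diff :: "'a list \<Rightarrow> 'a list \<Rightarrow> 'a list" where
  "list_diff xs ys = foldl (\<lambda>u y. remove1 y u) xs ys"

lemma esize_remove1: "esize (remove1 y xs) \<le> esize xs"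
  by (induction xs) auto

lemma polytime_list_diff:
  assumes "polytime f" and "polytime g"
  shows "polytime (\<lambda>x. list_diff (f x) (g x))"
  unfolding list_diff_def
proof (rule polytime_foldl_additive[where g = "\<lambda>x. 0"])
  fix x y and u :: "'b list"
  show "esize (remove1 y u) \<le> esize u + 0" using esize_remove1 by simp
qed (intro polytime_remove1 polytime_fst polytime_snd polytime_id assms polybound_const)+

definition dedup :: "('a \<Rightarrow> 'b) \<Rightarrow> 'a list \<Rightarrow> 'a list" where
  "dedup key xs = foldl (\<lambda>u y. if \<exists>z\<in>set u. key z = key y then u else y # u) [] xs"

lemma polytime_dedup:
  fixes key :: "'a::encodable \<Rightarrow> 'b::encodable \<Rightarrow> 'c::encodable"
  assumes f: "polytime (\<lambda>z. key (fst z) (snd z))" and l: "polytime l"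
  shows "polytime (\<lambda>x. dedup (key x) (l x))"
  unfolding dedup_def
proof (rule polytime_foldl_additive[where g = "\<lambda>x. esize (l x)"])
  fix x u y assume "y \<in> set (l x)"
  then show "esize (if \<exists>z\<in>set u. key x z = key x y then u else y # u) \<le> esize u + esize (l x)"
    using esize_member[of y "l x"] by simp
qed (intro polytime_If polytime_Bex polytime_eq polytime_Cons polytime_comp2[OF f] polytime_fst
      polytime_snd polytime_id polytime_const l polytime_esize)+

text \<open>The minimiser is returned as a list of length at most 1 so that
  \<open>polytime_case_list\<close> can take it apart.\<close>

fun argmin :: "('a \<Rightarrow> nat) \<Rightarrow> 'a list \<Rightarrow> 'a list" where
  "argmin f [] = []"
| "argmin f (x # xs) = (case argmin f xs of [] \<Rightarrow> [x] | y # ys \<Rightarrow> if f y < f x then [y] else [x])"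

lemma argmin_foldl:
  "argmin f xs = foldl (\<lambda>u y. case u of [] \<Rightarrow> [y] | z # zs \<Rightarrow> if f z < f y then [z] else [y]) [] (rev xs)"
  by (induction xs) auto

lemma polytime_argmin:
  assumes f: "polytime (\<lambda>z. f (fst z) (snd z))" and l: "polytime l"
  shows "polytime (\<lambda>x. argmin (f x) (l x))"
  unfolding argmin_foldl
proof (rule polytime_foldl_additive[where g = "\<lambda>x. 5 + esize (l x)"])
  show "polybound (\<lambda>x. 5 + esize (l x))" by (intro polybound_intros polytime_esize l)
  fix x u y assume "y \<in> set (rev (l x))"
  then show "esize (case u of [] \<Rightarrow> [y] | z # zs \<Rightarrow> if f x z < f x y then [z] else [y]) \<le>
      esize u + (5 + esize (l x))"
    using esize_member[of y "l x"] by (auto split: list.splits simp: floorlog_def)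
qed (intro polytime_case_list polytime_If polytime_less polytime_Cons polytime_comp2[OF f] polytime_fst
      polytime_snd polytime_id polytime_const polytime_rev l)+

lemma argmin_Nil_iff: "argmin f xs = [] \<longleftrightarrow> xs = []"
  by (cases xs) (auto split: list.splits)

lemma argmin_ConsD:
  assumes "argmin f xs = z # zs"
  shows "zs = []" "z \<in> set xs" "x \<in> set xs \<Longrightarrow> f z \<le> f x"
proof -
  have "zs = [] \<and> z \<in> set xs \<and> (\<forall>x\<in>set xs. f z \<le> f x)"
    using assms
  proof (induction xs arbitrary: z zs)
    case (Cons x xs)
    then show ?case
      by (cases "argmin f xs") (force split: if_splits simp: argmin_Nil_iff)+
  qed simp
  then show "zs = []" "z \<in> set xs" "x \<in> set xs \<Longrightarrow> f z \<le> f x" by auto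
qed

lemmas polytime_intros = polytime_id polytime_const polytime_Pair polytime_fst polytime_snd polytime_If
  polytime_plus polytime_times polytime_less polytime_le polytime_not polytime_conj polytime_disj
  polytime_imp polytime_eq polytime_Some polytime_Cons polytime_tl polytime_rev polytime_map
  polytime_filter polytime_append polytime_concat polytime_Bex polytime_Ball polytime_member
  polytime_length polytime_sum_list polytime_case_list polytime_zip polytime_upt_length
  polytime_remove1 polytime_list_diff polytime_dedup polytime_argmin

section \<open>The algorithm\<close>

subsection \<open>Loads and greedy selection\<close>

definition arcs :: "'a list \<Rightarrow> ('a \<times> 'a) list" where
  "arcs p = zip p (tl p)"

text \<open>The machine has no sets; an undirected edge is represented by its pair of ends in
  increasing order, so that edges are compared by equality.\<close>

definition norm_edge :: "nat \<times> nat \<Rightarrow> nat \<times> nat" where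
  "norm_edge a = (if fst a < snd a then a else (snd a, fst a))"

definition pedges :: "nat list \<Rightarrow> (nat \<times> nat) list" where
  "pedges p = map norm_edge (arcs p)"

definition load :: "('d \<times> nat list) list \<Rightarrow> nat \<times> nat \<Rightarrow> nat" where
  "load sel e = length (filter (\<lambda>c. e \<in> set (pedges (snd c))) sel)"

text \<open>The sum ranges over \<open>reps\<close> and not over the path, so the same greedy
  procedure serves both phases: with all edges for the fractional solution, and with one edge per
  signature for the rounding.\<close>

definition path_cost :: "nat \<Rightarrow> (nat \<times> nat) list \<Rightarrow> ('d \<times> nat list) list \<Rightarrow> nat list \<Rightarrow> nat" where
  "path_cost b reps sel p = sum_list (map (\<lambda>e. if e \<in> set (pedges p) then b ^ load sel e else 0) reps)"

definition usable :: "nat \<Rightarrow> ('d \<times> nat list) list \<Rightarrow> 'd \<times> nat list \<Rightarrow> bool" where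
  "usable cap sel c \<longleftrightarrow> (\<forall>c'\<in>set sel. fst c' \<noteq> fst c) \<and> (\<forall>e\<in>set (pedges (snd c)). load sel e < cap)"

definition greedy_step ::
  "nat \<Rightarrow> (nat \<times> nat) list \<Rightarrow> nat \<Rightarrow> ('d \<times> nat list) list \<Rightarrow> ('d \<times> nat list) list \<Rightarrow> ('d \<times> nat list) list" where
  "greedy_step b reps cap cands sel =
     (case argmin (\<lambda>c. path_cost b reps sel (snd c)) (filter (usable cap sel) cands) of
        [] \<Rightarrow> sel | c # cs \<Rightarrow> c # sel)"

text \<open>The candidates may depend on the selection made so far. The fractional phase offers the
  currently shortest paths, the rounding phase always the same list.\<close>

definition greedy ::
  "nat \<Rightarrow> (nat \<times> nat) list \<Rightarrow> nat \<Rightarrow> (('d \<times> nat list) list \<Rightarrow> ('d \<times> nat list) list) \<Rightarrow> nat \<Rightarrow>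
     ('d \<times> nat list) list" where
  "greedy b reps cap gen n = ((\<lambda>sel. greedy_step b reps cap (gen sel) sel) ^^ n) []"

section \<open>Running time of the greedy selection\<close>

lemma polytime_arcs: "polytime p \<Longrightarrow> polytime (\<lambda>x. arcs (p x))"
  unfolding arcs_def by (intro polytime_intros)

lemma polytime_norm_edge: "polytime a \<Longrightarrow> polytime (\<lambda>x. norm_edge (a x))"
  unfolding norm_edge_def by (intro polytime_intros)

lemma polytime_pedges: "polytime p \<Longrightarrow> polytime (\<lambda>x. pedges (p x))"
  unfolding pedges_def by (intro polytime_intros polytime_arcs polytime_norm_edge)

lemma polytime_load:
  assumes "polytime sel" and "polytime e"
  shows "polytime (\<lambda>x. load (sel x) (e x))"
  unfolding load_def by (intro polytime_intros polytime_pedges assms[THEN polytime_comp])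

lemma load_le_length: "load sel e \<le> length sel"
  by (simp add: load_def)

lemma polytime_path_cost:
  assumes "polytime b" and "polytime reps" and "polytime sel" and "polytime p"
  shows "polytime (\<lambda>x. path_cost (b x) (reps x) (sel x) (p x))"
  unfolding path_cost_def
  by (intro polytime_intros polytime_pedges polytime_load assms[THEN polytime_comp]
      polytime_power[where l = "\<lambda>z. sel (fst z)"] load_le_length)

lemma polytime_usable:
  assumes "polytime cap" and "polytime sel" and "polytime c"
  shows "polytime (\<lambda>x. usable (cap x) (sel x) (c x))"
  unfolding usable_def
  by (intro polytime_intros polytime_pedges polytime_load assms[THEN polytime_comp])

lemma polytime_greedy_step:
  assumes "polytime b" and "polytime reps" and "polytime cap" and "polytime cands" and "polytime sel"
  shows "polytime (\<lambda>x. greedy_step (b x) (reps x) (cap x) (cands x) (sel x))"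
  unfolding greedy_step_def
  by (intro polytime_intros polytime_path_cost polytime_usable assms[THEN polytime_comp])

lemma greedy_step_cases:
  obtains "greedy_step b reps cap cands sel = sel" "filter (usable cap sel) cands = []"
  | c where "greedy_step b reps cap cands sel = c # sel" "c \<in> set cands" "usable cap sel c"
      "\<And>c'. c' \<in> set cands \<Longrightarrow> usable cap sel c' \<Longrightarrow>
         path_cost b reps sel (snd c) \<le> path_cost b reps sel (snd c')"
proof (cases "argmin (\<lambda>c. path_cost b reps sel (snd c)) (filter (usable cap sel) cands)")
  case Nil
  then show ?thesis using that(1) by (simp add: greedy_step_def argmin_Nil_iff)
next
  case (Cons c cs)
  then show ?thesis
    using that(2)[of c] argmin_ConsD[OF Cons] by (simp add: greedy_step_def)
qed

text \<open>Each round adds at most one candidate, so the selection stays small provided that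
  \<open>g\<close> bounds candidates uniformly in \<open>sel\<close>.\<close>

lemma polytime_greedy:
  assumes "polytime b" and "polytime reps" and "polytime cap" and l: "polytime l"
    and gen: "polytime (\<lambda>z. gen (fst z) (snd z))"
    and g: "polybound g" "\<And>x sel c. c \<in> set (gen x sel) \<Longrightarrow> esize c \<le> g x"
  shows "polytime (\<lambda>x. greedy (b x) (reps x) (cap x) (gen x) (length (l x)))"
  unfolding greedy_def
proof (rule polytime_funpow[OF _ _ l])
  show "polytime (\<lambda>z. greedy_step (b (fst z)) (reps (fst z)) (cap (fst z)) (gen (fst z) (snd z)) (snd z))"
    by (intro polytime_intros polytime_greedy_step polytime_comp2[OF gen] assms(1-3)[THEN polytime_comp])
  show "polybound (\<lambda>x. 1 + length (l x) * (1 + g x))"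
    by (intro polybound_intros polybound_length l g)
  fix x j assume j: "j \<le> length (l x)"
  let ?f = "\<lambda>sel. greedy_step (b x) (reps x) (cap x) (gen x sel) sel"
  have "esize ((?f ^^ j) []) \<le> 1 + j * (1 + g x)" for j
  proof (induction j)
    case (Suc j)
    show ?case
    proof (cases rule: greedy_step_cases[of "b x" "reps x" "cap x" "gen x ((?f ^^ j) [])" "(?f ^^ j) []"])
      case 1
      then show ?thesis using Suc by simp
    next
      case (2 c)
      then show ?thesis using Suc g(2)[OF 2(2)] by simp
    qed
  qed simp
  from this[of j] show "esize ((?f ^^ j) []) \<le> 1 + length (l x) * (1 + g x)"
    using mult_right_mono[OF j, of "1 + g x"] by simp
qed (rule polytime_const)

subsection \<open>Shortest paths\<close>

definition starts :: "'a \<Rightarrow> 'a list \<Rightarrow> bool" where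
  "starts v p = (case p of [] \<Rightarrow> False | u # us \<Rightarrow> u = v)"

text \<open>A table entry is a cost with a path listed backwards: its current end is the head, and
  extending it by an arc is a \<open>Cons\<close>.\<close>

definition relax :: "(('a \<times> 'a) \<times> nat) list \<Rightarrow> (nat \<times> 'a list) list \<Rightarrow> (nat \<times> 'a list) list" where
  "relax as T = concat (map (\<lambda>a. map (\<lambda>e. (fst e + snd a, snd (fst a) # snd e))
     (filter (\<lambda>e. starts (fst (fst a)) (snd e)) T)) as)"

text \<open>Keeping a cheapest entry per vertex is what keeps the table short; without it the table
  would collect all walks.\<close>

definition bf_step :: "'a list \<Rightarrow> (('a \<times> 'a) \<times> nat) list \<Rightarrow> (nat \<times> 'a list) list \<Rightarrow> (nat \<times> 'a list) list" where
  "bf_step vs as T = concat (map (\<lambda>v. argmin fst (filter (\<lambda>e. starts v (snd e)) (T @ relax as T))) vs)"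

definition bellman_ford :: "'a list \<Rightarrow> (('a \<times> 'a) \<times> nat) list \<Rightarrow> 'a \<Rightarrow> (nat \<times> 'a list) list" where
  "bellman_ford vs as s = (bf_step vs as ^^ length vs) [(0, [s])]"

definition shortest_path :: "'a list \<Rightarrow> (('a \<times> 'a) \<times> nat) list \<Rightarrow> 'a \<Rightarrow> 'a \<Rightarrow> 'a list" where
  "shortest_path vs as s t =
     (case filter (\<lambda>e. starts t (snd e)) (bellman_ford vs as s) of [] \<Rightarrow> [] | e # es \<Rightarrow> rev (snd e))"

section \<open>Invariants and running time of the Bellman-Ford algorithm\<close>

lemma starts_iff: "starts v p \<longleftrightarrow> p \<noteq> [] \<and> hd p = v"
  by (cases p) (auto simp: starts_def)

lemma set_relax:
  "set (relax as T) = {(c + w, v # p) | c w u v p. ((u, v), w) \<in> set as \<and> (c, p) \<in> set T \<and> starts u p}"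
  (is "_ = ?R")
proof
  show "set (relax as T) \<subseteq> ?R"
  proof
    fix e assume "e \<in> set (relax as T)"
    then obtain a e' where "a \<in> set as" "e' \<in> set T" "starts (fst (fst a)) (snd e')"
      "e = (fst e' + snd a, snd (fst a) # snd e')"
      by (auto simp: relax_def)
    then show "e \<in> ?R"
      by (intro CollectI exI[of _ "fst e'"] exI[of _ "snd a"] exI[of _ "fst (fst a)"]
          exI[of _ "snd (fst a)"] exI[of _ "snd e'"]) simp
  qed
  show "?R \<subseteq> set (relax as T)"
  proof clarify
    fix c w u v p assume "((u, v), w) \<in> set as" "(c, p) \<in> set T" "starts u p"
    then show "(c + w, v # p) \<in> set (relax as T)"
      unfolding relax_def set_concat set_map
      by (intro UN_I[of "map (\<lambda>e. (fst e + w, v # snd e)) (filter (\<lambda>e. starts u (snd e)) T)"])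
        (auto intro!: rev_image_eqI[of "((u, v), w)"] rev_image_eqI[of "(c, p)"])
  qed
qed

lemma argmin_subset: "set (argmin f xs) \<subseteq> set xs" and length_argmin: "length (argmin f xs) \<le> 1"
proof -
  have "set (argmin f xs) \<subseteq> set xs \<and> length (argmin f xs) \<le> 1"
  proof (induction xs)
    case (Cons x xs)
    then show ?case by (cases "argmin f xs") auto
  qed simp
  then show "set (argmin f xs) \<subseteq> set xs" "length (argmin f xs) \<le> 1" by auto
qed

lemma set_bf_step: "set (bf_step vs as T) \<subseteq> set T \<union> set (relax as T)"
proof
  fix e assume "e \<in> set (bf_step vs as T)"
  then obtain v where "e \<in> set (argmin fst (filter (\<lambda>e. starts v (snd e)) (T @ relax as T)))"
    by (auto simp: bf_step_def)
  from subsetD[OF argmin_subset this] show "e \<in> set T \<union> set (relax as T)" by auto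
qed

lemma length_bf_step: "length (bf_step vs as T) \<le> length vs"
proof -
  have "length (concat (map f vs)) \<le> length vs" if "\<And>v. length (f v) \<le> 1" for f :: "'a \<Rightarrow> (nat \<times> 'a list) list"
  proof (induction vs)
    case (Cons v vs)
    then show ?case using that[of v] by simp
  qed simp
  from this[of "\<lambda>v. argmin fst (filter (\<lambda>e. starts v (snd e)) (T @ relax as T))", OF length_argmin]
  show ?thesis unfolding bf_step_def .
qed

lemma bf_invariant:
  assumes "e \<in> set ((bf_step vs as ^^ j) [(0, [s])])"
  shows "snd e \<noteq> []" "length (snd e) \<le> Suc j" "set (snd e) \<subseteq> insert s ((snd \<circ> fst) ` set as)"
proof -
  have "snd e \<noteq> [] \<and> length (snd e) \<le> Suc j \<and> set (snd e) \<subseteq> insert s ((snd \<circ> fst) ` set as)"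
    using assms
  proof (induction j arbitrary: e)
    case (Suc j)
    then have "e \<in> set ((bf_step vs as ^^ j) [(0, [s])]) \<union> set (relax as ((bf_step vs as ^^ j) [(0, [s])]))"
      using set_bf_step by fastforce
    then show ?case
    proof
      assume "e \<in> set ((bf_step vs as ^^ j) [(0, [s])])"
      then show ?thesis using Suc.IH by fastforce
    next
      assume "e \<in> set (relax as ((bf_step vs as ^^ j) [(0, [s])]))"
      then obtain c w u v p where e: "e = (c + w, v # p)" "((u, v), w) \<in> set as"
        "(c, p) \<in> set ((bf_step vs as ^^ j) [(0, [s])])"
        unfolding set_relax by blast
      then show ?thesis using Suc.IH[OF e(3)] by force
    qed
  qed simp
  then show "snd e \<noteq> []" "length (snd e) \<le> Suc j" "set (snd e) \<subseteq> insert s ((snd \<circ> fst) ` set as)"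
    by auto
qed

text \<open>A round adds one vertex and one weight to an entry, both taken from \<open>as\<close>,
  hence a fixed amount of size.\<close>

lemma bf_esize:
  assumes "e \<in> set ((bf_step vs as ^^ j) [(0, [s])])"
  shows "esize e \<le> 5 + esize s + j * (5 + esize as)"
  using assms
proof (induction j arbitrary: e)
  case (Suc j)
  then have "e \<in> set ((bf_step vs as ^^ j) [(0, [s])]) \<union> set (relax as ((bf_step vs as ^^ j) [(0, [s])]))"
    using set_bf_step by fastforce
  then show ?case
  proof
    assume "e \<in> set ((bf_step vs as ^^ j) [(0, [s])])"
    then show ?thesis using Suc.IH by fastforce
  next
    assume "e \<in> set (relax as ((bf_step vs as ^^ j) [(0, [s])]))"
    then obtain c w u v p where e: "e = (c + w, v # p)" "((u, v), w) \<in> set as"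
      "(c, p) \<in> set ((bf_step vs as ^^ j) [(0, [s])])"
      unfolding set_relax by blast
    then show ?thesis using Suc.IH[OF e(3)] esize_member[OF e(2)] floorlog_2_add[of c w] by simp
  qed
qed simp

lemma length_bf: "length ((bf_step vs as ^^ j) [(0, [s])]) \<le> Suc (length vs)"
  by (cases j) (auto intro: le_SucI[OF length_bf_step])

lemma shortest_path_invariant:
  shows "length (shortest_path vs as s t) \<le> Suc (length vs)"
    and "set (shortest_path vs as s t) \<subseteq> insert s ((snd \<circ> fst) ` set as)"
proof -
  have "length (shortest_path vs as s t) \<le> Suc (length vs) \<and>
     set (shortest_path vs as s t) \<subseteq> insert s ((snd \<circ> fst) ` set as)"
  proof (cases "filter (\<lambda>e. starts t (snd e)) (bellman_ford vs as s)")
    case (Cons e es)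
    then have "e \<in> set (filter (\<lambda>e. starts t (snd e)) (bellman_ford vs as s))" by simp
    then have "e \<in> set (bellman_ford vs as s)" by simp
    then have "length (snd e) \<le> Suc (length vs)" "set (snd e) \<subseteq> insert s ((snd \<circ> fst) ` set as)"
      unfolding bellman_ford_def by (rule bf_invariant)+
    then show ?thesis by (simp add: shortest_path_def Cons)
  qed (simp add: shortest_path_def)
  then show "length (shortest_path vs as s t) \<le> Suc (length vs)"
    and "set (shortest_path vs as s t) \<subseteq> insert s ((snd \<circ> fst) ` set as)" by auto
qed

lemma polytime_starts:
  assumes "polytime v" and "polytime p"
  shows "polytime (\<lambda>x. starts (v x) (p x))"
  unfolding starts_def by (intro polytime_intros assms[THEN polytime_comp])

lemma polytime_relax:
  assumes "polytime as" and "polytime T"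
  shows "polytime (\<lambda>x. relax (as x) (T x))"
  unfolding relax_def by (intro polytime_intros polytime_starts assms[THEN polytime_comp])

lemma polytime_bf_step:
  assumes "polytime vs" and "polytime as" and "polytime T"
  shows "polytime (\<lambda>x. bf_step (vs x) (as x) (T x))"
  unfolding bf_step_def by (intro polytime_intros polytime_relax polytime_starts assms[THEN polytime_comp])

lemma polytime_bellman_ford:
  assumes "polytime vs" and "polytime as" and "polytime s"
  shows "polytime (\<lambda>x. bellman_ford (vs x) (as x) (s x))"
  unfolding bellman_ford_def
proof (rule polytime_funpow)
  let ?B = "\<lambda>x. 1 + (1 + length (vs x)) * (1 + (5 + esize (s x) + length (vs x) * (5 + esize (as x))))"
  show "polybound ?B" by (intro polybound_intros polybound_length polytime_esize assms)
  fix x j assume j: "j \<le> length (vs x)"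
  let ?T = "(bf_step (vs x) (as x) ^^ j) [(0, [s x])]"
  have "esize ?T \<le> Suc (length ?T * Suc (5 + esize (s x) + length (vs x) * (5 + esize (as x))))"
  proof (rule esize_list_le)
    fix e assume "e \<in> set ?T"
    then have "esize e \<le> 5 + esize (s x) + j * (5 + esize (as x))" by (rule bf_esize)
    also have "\<dots> \<le> 5 + esize (s x) + length (vs x) * (5 + esize (as x))"
      using j by (intro add_mono mult_right_mono) auto
    finally show "esize e \<le> 5 + esize (s x) + length (vs x) * (5 + esize (as x))" .
  qed
  also have "\<dots> \<le> ?B x"
    using mult_right_mono[OF length_bf[of j "vs x" "as x" "s x"],
        of "Suc (5 + esize (s x) + length (vs x) * (5 + esize (as x)))"] by simp
  finally show "esize ?T \<le> ?B x" .
qed (intro polytime_intros polytime_bf_step assms[THEN polytime_comp])+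

lemma polytime_shortest_path:
  assumes "polytime vs" and "polytime as" and "polytime s" and "polytime t"
  shows "polytime (\<lambda>x. shortest_path (vs x) (as x) (s x) (t x))"
  unfolding shortest_path_def
  by (intro polytime_intros polytime_bellman_ford polytime_starts assms[THEN polytime_comp])

subsection \<open>The fractional solution\<close>

text \<open>Both directions of an edge have its current length. Edges at the capacity are omitted,
  so that every path found is allowed by \<open>usable\<close>.\<close>

definition weighted_arcs ::
  "nat \<Rightarrow> (nat \<times> nat) list \<Rightarrow> ('d \<times> nat list) list \<Rightarrow> ((nat \<times> nat) \<times> nat) list" where
  "weighted_arcs cap es sel = concat (map (\<lambda>a. if load sel (norm_edge a) < cap
     then [(a, 2 ^ load sel (norm_edge a)), ((snd a, fst a), 2 ^ load sel (norm_edge a))] else []) es)"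

text \<open>The number \<open>K\<close> of copies of every terminal pair only has to be at least logarithmic in the
  number of edges; \<open>K = |E| + 1\<close> avoids computing a logarithm.\<close>

definition copies :: "(nat \<times> nat) list \<Rightarrow> nat" where
  "copies es = length ((0, 0) # es)"

text \<open>The label consists of the index of the pair and the number of the copy. Since
  \<open>usable\<close> compares labels, every copy is routed at most once.\<close>

definition demands ::
  "(nat \<times> nat) list \<Rightarrow> (nat \<times> nat) list \<Rightarrow> ((nat \<times> nat) \<times> (nat \<times> nat)) list" where
  "demands es M = concat (map (\<lambda>c. map (\<lambda>d. ((fst d, c), snd d)) (zip [0..<length M] M)) [0..<copies es])"

definition routed_demands ::
  "nat list \<Rightarrow> (nat \<times> nat) list \<Rightarrow> (nat \<times> nat) list \<Rightarrow> ((nat \<times> nat) \<times> nat list) list \<Rightarrow>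
     ((nat \<times> nat) \<times> nat list) list" where
  "routed_demands vs es M sel = filter (\<lambda>c. snd c \<noteq> []) (map (\<lambda>d. (fst d,
     shortest_path vs (weighted_arcs (3 * copies es) es sel) (fst (snd d)) (snd (snd d)))) (demands es M))"

definition fractional ::
  "nat list \<Rightarrow> (nat \<times> nat) list \<Rightarrow> (nat \<times> nat) list \<Rightarrow> ((nat \<times> nat) \<times> nat list) list" where
  "fractional vs es M = greedy 2 (map norm_edge es) (3 * copies es) (routed_demands vs es M)
     (length (demands es M))"

section \<open>Running time of the fractional phase\<close>

lemma polytime_weighted_arcs:
  assumes "polytime cap" and "polytime es" and "polytime sel"
  shows "polytime (\<lambda>x. weighted_arcs (cap x) (es x) (sel x))"
  unfolding weighted_arcs_def
  by (intro polytime_intros polytime_norm_edge polytime_load assms[THEN polytime_comp]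
      polytime_power[where l = "\<lambda>z. sel (fst z)"] load_le_length)

lemma polytime_copies: "polytime es \<Longrightarrow> polytime (\<lambda>x. copies (es x))"
  unfolding copies_def by (intro polytime_intros)

lemma polytime_demands:
  assumes "polytime es" and "polytime M"
  shows "polytime (\<lambda>x. demands (es x) (M x))"
  unfolding demands_def copies_def
  by (intro polytime_intros assms[THEN polytime_comp])

lemma polytime_routed_demands:
  assumes "polytime vs" and "polytime es" and "polytime M" and "polytime sel"
  shows "polytime (\<lambda>x. routed_demands (vs x) (es x) (M x) (sel x))"
  unfolding routed_demands_def
  by (intro polytime_intros polytime_shortest_path polytime_weighted_arcs polytime_copies polytime_demands
      assms[THEN polytime_comp])

lemma set_weighted_arcs:
  "(a, w) \<in> set (weighted_arcs cap es sel) \<longleftrightarrow>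
     (a \<in> set es \<or> (snd a, fst a) \<in> set es) \<and> load sel (norm_edge a) < cap \<and> w = 2 ^ load sel (norm_edge a)"
proof -
  have sw: "norm_edge (snd a, fst a) = norm_edge a" for a
    by (cases a) (auto simp: norm_edge_def)
  show ?thesis
  proof
    assume "(a, w) \<in> set (weighted_arcs cap es sel)"
    then obtain a' where "a' \<in> set es" "load sel (norm_edge a') < cap" "w = 2 ^ load sel (norm_edge a')"
      "a = a' \<or> a = (snd a', fst a')"
      unfolding weighted_arcs_def by (auto split: if_splits)
    then show "(a \<in> set es \<or> (snd a, fst a) \<in> set es) \<and> load sel (norm_edge a) < cap \<and>
        w = 2 ^ load sel (norm_edge a)"
      using sw[of a'] by auto
  next
    assume *: "(a \<in> set es \<or> (snd a, fst a) \<in> set es) \<and> load sel (norm_edge a) < cap \<and>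
        w = 2 ^ load sel (norm_edge a)"
    then have "a \<in> set es \<or> (snd a, fst a) \<in> set es" by simp
    then show "(a, w) \<in> set (weighted_arcs cap es sel)"
    proof
      assume "a \<in> set es"
      then show ?thesis unfolding weighted_arcs_def using * by (auto intro!: bexI[of _ a])
    next
      assume "(snd a, fst a) \<in> set es"
      then show ?thesis
        unfolding weighted_arcs_def using * sw[of a] by (auto intro!: bexI[of _ "(snd a, fst a)"])
    qed
  qed
qed

lemma esize_shortest_path:
  assumes "esize s \<le> b" and "\<And>a. a \<in> set as \<Longrightarrow> esize (snd (fst a)) \<le> b"
  shows "esize (shortest_path vs as s t) \<le> Suc (Suc (length vs) * Suc b)"
proof -
  have "esize v \<le> b" if "v \<in> set (shortest_path vs as s t)" for v
    using shortest_path_invariant(2)[of vs as s t] that assms by fastforce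
  from esize_list_le[OF this]
  have "esize (shortest_path vs as s t) \<le> Suc (length (shortest_path vs as s t) * Suc b)" .
  also have "\<dots> \<le> Suc (Suc (length vs) * Suc b)"
    using mult_right_mono[OF shortest_path_invariant(1)[of vs as s t], of "Suc b"] by simp
  finally show ?thesis .
qed

lemma polytime_fractional:
  assumes "polytime vs" and "polytime es" and "polytime M"
  shows "polytime (\<lambda>x. fractional (vs x) (es x) (M x))"
proof -
  have dem: "polytime (\<lambda>x. demands (es x) (M x))" by (rule polytime_demands[OF assms(2,3)])
  let ?b = "\<lambda>x. esize (demands (es x) (M x)) + esize (es x)"
  \<comment> \<open>The bound must not mention the selection. The weights do grow with it, but the
    paths found only contain vertices of the instance.\<close>
  let ?g = "\<lambda>x. 2 + esize (demands (es x) (M x)) + (1 + length (vs x)) * (1 + ?b x)"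
  show ?thesis
    unfolding fractional_def
  proof (rule polytime_greedy[where g = ?g])
    show "polybound ?g"
      by (intro polybound_intros polytime_esize polybound_length dem assms)
    show "polytime (\<lambda>z. routed_demands (vs (fst z)) (es (fst z)) (M (fst z)) (snd z))"
      by (intro polytime_routed_demands polytime_intros assms[THEN polytime_comp])
    fix x sel c assume "c \<in> set (routed_demands (vs x) (es x) (M x) sel)"
    then obtain d where d: "d \<in> set (demands (es x) (M x))" "c = (fst d,
       shortest_path (vs x) (weighted_arcs (3 * copies (es x)) (es x) sel) (fst (snd d)) (snd (snd d)))"
      by (auto simp: routed_demands_def)
    have ed: "esize d < esize (demands (es x) (M x))" by (rule esize_member[OF d(1)])
    have "esize (snd c) \<le> Suc (Suc (length (vs x)) * Suc (?b x))"
      unfolding d(2) snd_conv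
    proof (rule esize_shortest_path)
      show "esize (fst (snd d)) \<le> ?b x" using ed by simp
      fix a assume "a \<in> set (weighted_arcs (3 * copies (es x)) (es x) sel)"
      then have "fst a \<in> set (es x) \<or> (snd (fst a), fst (fst a)) \<in> set (es x)"
        using set_weighted_arcs[of "fst a" "snd a" "3 * copies (es x)" "es x" sel] by simp
      then show "esize (snd (fst a)) \<le> ?b x"
        using esize_member[of "fst a" "es x"] esize_member[of "(snd (fst a), fst (fst a))" "es x"]
        by auto
    qed
    then show "esize c \<le> ?g x" using ed d(2) by simp
  qed (intro polytime_intros polytime_norm_edge polytime_copies dem assms)+
qed

subsection \<open>Sparsifying the flow of one commodity\<close>

text \<open>The length is \<open>k * c / K\<close> rounded up and cut off at \<open>k\<close>, where
  \<open>k = length M\<close> and \<open>K = copies es\<close>: a load of \<open>c\<close> copies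
  expressed in units of \<open>1 / k\<close>. It is a list because it serves as a round
  count.\<close>

definition scaled :: "(nat \<times> nat) list \<Rightarrow> (nat \<times> nat) list \<Rightarrow> nat \<Rightarrow> nat list" where
  "scaled es M c = filter (\<lambda>j. j * copies es < length M * c) [0..<length M]"

text \<open>A directed multigraph whose capacities are multiplicities: an arc that occurs
  \<open>c\<close> times in \<open>al\<close> is taken \<open>length (scaled es M c)\<close> times.
  \<open>dedup\<close> prevents it from being treated once per occurrence.\<close>

definition network ::
  "(nat \<times> nat) list \<Rightarrow> (nat \<times> nat) list \<Rightarrow> (nat \<times> nat) list \<Rightarrow> (nat \<times> nat) list" where
  "network es M al = concat (map (\<lambda>j. filter (\<lambda>a. j * copies es < length M * length (filter (\<lambda>a'. a' = a) al))
     (dedup (\<lambda>a. a) al)) [0..<length M])"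

definition arc_path :: "'a list \<Rightarrow> 'a \<Rightarrow> 'a \<Rightarrow> ('a \<times> 'a) list \<Rightarrow> 'a list" where
  "arc_path vs s t D = shortest_path vs (map (\<lambda>a. (a, 1)) D) s t"

text \<open>The residual network after pushing one unit along a shortest path: its arcs are removed
  and their reversals added.\<close>

definition augment :: "'a list \<Rightarrow> 'a \<Rightarrow> 'a \<Rightarrow> ('a \<times> 'a) list \<Rightarrow> ('a \<times> 'a) list" where
  "augment vs s t D =
     list_diff D (arcs (arc_path vs s t D)) @ map (\<lambda>a. (snd a, fst a)) (arcs (arc_path vs s t D))"

definition peel ::
  "'a list \<Rightarrow> 'a \<Rightarrow> 'a \<Rightarrow> ('a \<times> 'a) list \<times> 'a list list \<Rightarrow> ('a \<times> 'a) list \<times> 'a list list" where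
  "peel vs s t u = (list_diff (fst u) (arcs (arc_path vs s t (fst u))), arc_path vs s t (fst u) # snd u)"

text \<open>After \<open>n\<close> augmentations, the arcs missing from the residual network form
  the net flow; it is then decomposed into \<open>n\<close> paths by peeling.\<close>

definition max_flow :: "'a list \<Rightarrow> 'a \<Rightarrow> 'a \<Rightarrow> ('a \<times> 'a) list \<Rightarrow> nat \<Rightarrow> 'a list list" where
  "max_flow vs s t D n = snd ((peel vs s t ^^ n) (list_diff D ((augment vs s t ^^ n) D), []))"

definition sparse_paths ::
  "nat list \<Rightarrow> (nat \<times> nat) list \<Rightarrow> (nat \<times> nat) list \<Rightarrow> nat list list \<Rightarrow> nat \<times> nat \<Rightarrow> nat list list" where
  "sparse_paths vs es M ps st = max_flow vs (fst st) (snd st)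
     (network es M (concat (map arcs ps))) (length (scaled es M (length ps)))"

definition candidates ::
  "nat list \<Rightarrow> (nat \<times> nat) list \<Rightarrow> (nat \<times> nat) list \<Rightarrow> ((nat \<times> nat) \<times> nat list) list \<Rightarrow>
     (nat \<times> nat list) list" where
  "candidates vs es M sel = concat (map (\<lambda>d. map (\<lambda>p. (fst d, p)) (sparse_paths vs es M
     (map snd (filter (\<lambda>c. fst (fst c) = fst d) sel)) (snd d))) (zip [0..<length M] M))"

section \<open>Running time of the sparsification\<close>

lemma polytime_scaled:
  assumes "polytime es" and "polytime M" and "polytime c"
  shows "polytime (\<lambda>x. scaled (es x) (M x) (c x))"
  unfolding scaled_def by (intro polytime_intros polytime_copies assms[THEN polytime_comp])

lemma polytime_network:
  assumes "polytime es" and "polytime M" and "polytime al"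
  shows "polytime (\<lambda>x. network (es x) (M x) (al x))"
  unfolding network_def by (intro polytime_intros polytime_copies assms[THEN polytime_comp])

lemma polytime_arc_path:
  assumes "polytime vs" and "polytime s" and "polytime t" and "polytime D"
  shows "polytime (\<lambda>x. arc_path (vs x) (s x) (t x) (D x))"
  unfolding arc_path_def by (intro polytime_intros polytime_shortest_path assms[THEN polytime_comp])

lemma polytime_augment:
  assumes "polytime vs" and "polytime s" and "polytime t" and "polytime D"
  shows "polytime (\<lambda>x. augment (vs x) (s x) (t x) (D x))"
  unfolding augment_def by (intro polytime_intros polytime_arcs polytime_arc_path assms[THEN polytime_comp])

lemma polytime_peel:
  assumes "polytime vs" and "polytime s" and "polytime t" and "polytime u"
  shows "polytime (\<lambda>x. peel (vs x) (s x) (t x) (u x))"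
  unfolding peel_def by (intro polytime_intros polytime_arcs polytime_arc_path assms[THEN polytime_comp])

lemma mset_list_diff: "mset (list_diff xs ys) = mset xs - mset ys"
  unfolding list_diff_def by (induction ys arbitrary: xs) auto

lemma set_list_diff: "set (list_diff xs ys) \<subseteq> set xs"
  by (metis mset_list_diff set_mset_mset diff_subset_eq_self set_mset_mono)

lemma esize_list_diff: "esize (list_diff xs ys) \<le> esize xs"
  unfolding list_diff_def
  by (induction ys arbitrary: xs) (auto intro: order_trans[OF _ esize_remove1])

lemma length_list_diff: "length (list_diff xs ys) \<le> length xs"
  by (metis mset_list_diff size_mset diff_subset_eq_self size_mset_mono)

lemma set_arcs: "a \<in> set (arcs p) \<Longrightarrow> fst a \<in> set p \<and> snd a \<in> set p"
  unfolding arcs_def by (cases a, cases p) (auto dest: set_zip_leftD set_zip_rightD)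

lemma length_arcs: "length (arcs p) \<le> length p"
  by (simp add: arcs_def)

lemma arc_path_invariant:
  shows "length (arc_path vs s t D) \<le> Suc (length vs)"
    and "set (arc_path vs s t D) \<subseteq> insert s (snd ` set D)"
  using shortest_path_invariant[of vs "map (\<lambda>a. (a, 1)) D" s t]
  by (simp_all add: arc_path_def image_image)

lemma esize_augment:
  assumes "esize s \<le> b" and "\<And>a. a \<in> set D \<Longrightarrow> esize (fst a) \<le> b \<and> esize (snd a) \<le> b"
  shows "(\<forall>a\<in>set ((augment vs s t ^^ j) D). esize (fst a) \<le> b \<and> esize (snd a) \<le> b) \<and>
     length ((augment vs s t ^^ j) D) \<le> length D + j * Suc (length vs)"
proof (induction j)
  case (Suc j)
  let ?D = "(augment vs s t ^^ j) D"
  let ?p = "arc_path vs s t ?D"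
  have p: "esize v \<le> b" if "v \<in> set ?p" for v
    using arc_path_invariant(2)[of vs s t ?D] that assms(1) Suc by fastforce
  have "esize (fst a) \<le> b \<and> esize (snd a) \<le> b" if "a \<in> set (augment vs s t ?D)" for a
    using that Suc subsetD[OF set_list_diff, of a ?D "arcs ?p"] p set_arcs[of _ ?p]
    unfolding augment_def by fastforce
  moreover have "length (augment vs s t ?D) \<le> length ?D + Suc (length vs)"
    using length_list_diff[of ?D "arcs ?p"] length_arcs[of ?p] arc_path_invariant(1)[of vs s t ?D]
    unfolding augment_def by simp
  ultimately show ?case using Suc by simp
qed (use assms in simp)

lemma esize_peel:
  assumes "esize s \<le> b" and "\<And>a. a \<in> set F \<Longrightarrow> esize (snd a) \<le> b"
  shows "set (fst ((peel vs s t ^^ j) (F, []))) \<subseteq> set F \<and> esize (fst ((peel vs s t ^^ j) (F, []))) \<le> esize F \<and>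
     esize (snd ((peel vs s t ^^ j) (F, []))) \<le> Suc (j * Suc (Suc (Suc (length vs) * Suc b)))"
proof (induction j)
  case (Suc j)
  let ?u = "(peel vs s t ^^ j) (F, [])"
  let ?p = "arc_path vs s t (fst ?u)"
  have "esize ?p \<le> Suc (Suc (length vs) * Suc b)"
    unfolding arc_path_def by (rule esize_shortest_path) (use assms Suc in auto)
  moreover have "set (list_diff (fst ?u) (arcs ?p)) \<subseteq> set F"
    using set_list_diff Suc by fastforce
  moreover have "esize (list_diff (fst ?u) (arcs ?p)) \<le> esize F"
    using esize_list_diff Suc order_trans by blast
  ultimately show ?case using Suc by (simp add: peel_def[of vs s t ?u])
qed simp

lemma polytime_max_flow:
  assumes "polytime vs" and "polytime s" and "polytime t" and "polytime D" and "polytime l"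
  shows "polytime (\<lambda>x. max_flow (vs x) (s x) (t x) (D x) (length (l x)))"
proof -
  let ?b = "\<lambda>x. esize (s x) + esize (D x)"
  let ?B = "\<lambda>x. 1 + (length (D x) + length (l x) * (1 + length (vs x))) * (2 + 2 * ?b x)"
  have 1: "polytime (\<lambda>x. (augment (vs x) (s x) (t x) ^^ length (l x)) (D x))"
  proof (rule polytime_funpow[where B = ?B])
    show "polybound ?B" by (intro polybound_intros polybound_length polytime_esize assms)
    fix x j assume j: "j \<le> length (l x)"
    have a: "esize (fst a) \<le> ?b x \<and> esize (snd a) \<le> ?b x" if "a \<in> set (D x)" for a
      using esize_member[OF that] by simp
    let ?D = "(augment (vs x) (s x) (t x) ^^ j) (D x)"
    have "(\<forall>a\<in>set ?D. esize (fst a) \<le> ?b x \<and> esize (snd a) \<le> ?b x) \<and>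
        length ?D \<le> length (D x) + j * Suc (length (vs x))"
      by (rule esize_augment) (use a in auto)
    then have *: "length ?D \<le> length (D x) + j * Suc (length (vs x))"
      "\<And>a. a \<in> set ?D \<Longrightarrow> esize a \<le> 1 + 2 * ?b x" by fastforce+
    have "length ?D \<le> length (D x) + length (l x) * (1 + length (vs x))"
      using *(1) mult_right_mono[OF j, of "1 + length (vs x)"] by simp
    from mult_right_mono[OF this, of "2 + 2 * ?b x"] esize_list_le[of ?D "1 + 2 * ?b x", OF *(2)]
    show "esize ?D \<le> ?B x" by simp
  qed (intro polytime_augment polytime_intros assms[THEN polytime_comp])+
  let ?F = "\<lambda>x. list_diff (D x) ((augment (vs x) (s x) (t x) ^^ length (l x)) (D x))"
  have 2: "polytime ?F" by (intro polytime_intros 1 assms)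
  let ?C = "\<lambda>x. 2 + esize (D x) + length (l x) * (3 + (1 + length (vs x)) * (1 + ?b x))"
  have "polytime (\<lambda>x. (peel (vs x) (s x) (t x) ^^ length (l x)) (?F x, []))"
  proof (rule polytime_funpow[where B = ?C])
    show "polybound ?C" by (intro polybound_intros polybound_length polytime_esize assms)
    fix x j assume j: "j \<le> length (l x)"
    let ?u = "(peel (vs x) (s x) (t x) ^^ j) (?F x, [])"
    have "set (fst ?u) \<subseteq> set (?F x) \<and> esize (fst ?u) \<le> esize (?F x) \<and>
        esize (snd ?u) \<le> Suc (j * Suc (Suc (Suc (length (vs x)) * Suc (?b x))))"
    proof (rule esize_peel)
      fix a assume "a \<in> set (?F x)"
      then have "a \<in> set (D x)" using set_list_diff by fast
      from esize_member[OF this] show "esize (snd a) \<le> ?b x" by simp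
    qed simp
    moreover have "esize (?F x) \<le> esize (D x)" by (rule esize_list_diff)
    ultimately have *: "esize (fst ?u) \<le> esize (D x)"
      "esize (snd ?u) \<le> Suc (j * (2 + (1 + length (vs x)) * (1 + ?b x)))" by simp_all
    have "j * (2 + (1 + length (vs x)) * (1 + ?b x)) \<le>
        length (l x) * (3 + (1 + length (vs x)) * (1 + ?b x))"
      using j by (intro mult_mono) auto
    with * show "esize ?u \<le> ?C x" by (simp only: enc_prod_def val_size.simps)
  qed (intro polytime_peel polytime_intros assms[THEN polytime_comp] 2)+
  then show ?thesis unfolding max_flow_def by (rule polytime_snd)
qed

lemma polytime_sparse_paths:
  assumes "polytime vs" and "polytime es" and "polytime M" and "polytime ps" and "polytime st"
  shows "polytime (\<lambda>x. sparse_paths (vs x) (es x) (M x) (ps x) (st x))"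
  unfolding sparse_paths_def
  by (intro polytime_max_flow polytime_network polytime_scaled polytime_arcs polytime_intros
      assms[THEN polytime_comp])

lemma polytime_candidates:
  assumes "polytime vs" and "polytime es" and "polytime M" and "polytime sel"
  shows "polytime (\<lambda>x. candidates (vs x) (es x) (M x) (sel x))"
  unfolding candidates_def
  by (intro polytime_sparse_paths polytime_intros assms[THEN polytime_comp])

subsection \<open>Rounding\<close>

definition meets :: "nat list \<Rightarrow> nat list \<Rightarrow> bool" where
  "meets p q \<longleftrightarrow> (\<exists>e\<in>set (pedges p). e \<in> set (pedges q))"

text \<open>The dummy edge \<open>(0, 0)\<close>, which lies on no path, covers the case of a path without edges.\<close>

definition pivotal :: "(nat \<times> nat list) list \<Rightarrow> nat \<times> nat list \<Rightarrow> bool" where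
  "pivotal R c \<longleftrightarrow> (\<exists>e\<in>set ((0, 0) # pedges (snd c)). \<exists>f\<in>set ((0, 0) # pedges (snd c)).
     \<forall>c'\<in>set R. meets (snd c') (snd c) \<longrightarrow> e \<in> set (pedges (snd c')) \<or> f \<in> set (pedges (snd c')))"

definition disjoint_step ::
  "(nat \<times> nat list) list \<times> (nat \<times> nat list) list \<Rightarrow> (nat \<times> nat list) list \<times> (nat \<times> nat list) list" where
  "disjoint_step u = (case filter (pivotal (fst u)) (fst u) of
       [] \<Rightarrow> u
     | c # cs \<Rightarrow> (filter (\<lambda>c'. fst c' \<noteq> fst c \<and> \<not> meets (snd c') (snd c)) (fst u), c # snd u))"

text \<open>\<open>length cs\<close> rounds are enough, since each effective round discards at least
  the chosen candidate.\<close>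

definition disjoint_selection ::
  "(nat \<times> nat list) list \<Rightarrow> (nat \<times> nat list) list \<times> (nat \<times> nat list) list" where
  "disjoint_selection cs = (disjoint_step ^^ length cs) (cs, [])"

definition signature :: "('d \<times> nat list) list \<Rightarrow> nat \<times> nat \<Rightarrow> bool list" where
  "signature cs e = map (\<lambda>c. e \<in> set (pedges (snd c))) cs"

definition representatives :: "('d \<times> nat list) list \<Rightarrow> (nat \<times> nat) list" where
  "representatives cs = dedup (signature cs) (concat (map (\<lambda>c. pedges (snd c)) cs))"

text \<open>The length of this list is the number of binary digits of \<open>length xs\<close>: a
  logarithm in unary.\<close>

definition loglist :: "'a list \<Rightarrow> nat list" where
  "loglist xs = filter (\<lambda>j. 2 ^ j \<le> length xs) [0..<length xs]"

text \<open>The summand 3 keeps the base at 3 or more, so that its natural logarithm is at least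
  1.\<close>

definition base :: "'a list \<Rightarrow> nat" where
  "base xs = length (0 # 0 # 0 # loglist xs)"

text \<open>The range from 0 to \<open>9 * base xs\<close>. Concatenating nine lists makes this
  number available as a length, hence as a bound on exponents.\<close>

definition cap_range :: "'a list \<Rightarrow> nat list" where
  "cap_range xs = [0..<length (0 # concat (map (\<lambda>j. 0 # 0 # 0 # loglist xs) [0,0,0,0,0,0,0,0,0 :: nat]))]"

text \<open>The least \<open>c\<close> with \<open>2 ^ (9 * base xs) \<le> base xs ^ c\<close>,
  about \<open>9 b / log2 b\<close> for \<open>b = base xs\<close>: a load at which a single edge
  exceeds the bound on the potential.\<close>

definition capacity :: "'a list \<Rightarrow> nat" where
  "capacity xs = length (filter (\<lambda>c. base xs ^ c < 2 ^ (9 * base xs)) (cap_range xs))"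

text \<open>The decision depends on whether the disjoint selection has used up all candidates. The
  feedback vertex set number itself is never computed; it enters the analysis only.\<close>

definition round_candidates :: "(nat \<times> nat list) list \<Rightarrow> (nat \<times> nat list) list" where
  "round_candidates cs = (if fst (disjoint_selection cs) = [] then snd (disjoint_selection cs)
     else greedy (base (representatives cs)) (representatives cs) (capacity (representatives cs))
       (\<lambda>sel. cs) (length cs))"

definition maxedp_algorithm ::
  "nat list \<times> (nat \<times> nat) list \<times> (nat \<times> nat) list \<Rightarrow> nat list option list" where
  "maxedp_algorithm x = map (\<lambda>i. case filter (\<lambda>c. fst c = i)
       (round_candidates (candidates (fst x) (fst (snd x)) (snd (snd x))
          (fractional (fst x) (fst (snd x)) (snd (snd x))))) of
       [] \<Rightarrow> None | c # cs \<Rightarrow> Some (snd c))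
     [0..<length (snd (snd x))]"

section \<open>Running time of the rounding and of the whole algorithm\<close>

lemma polytime_meets:
  assumes "polytime p" and "polytime q"
  shows "polytime (\<lambda>x. meets (p x) (q x))"
  unfolding meets_def by (intro polytime_intros polytime_pedges assms[THEN polytime_comp])

lemma polytime_pivotal:
  assumes "polytime R" and "polytime c"
  shows "polytime (\<lambda>x. pivotal (R x) (c x))"
  unfolding pivotal_def
  by (intro polytime_intros polytime_meets polytime_pedges assms[THEN polytime_comp])

lemma polytime_disjoint_step:
  assumes "polytime u"
  shows "polytime (\<lambda>x. disjoint_step (u x))"
  unfolding disjoint_step_def
  by (intro polytime_intros polytime_meets polytime_pivotal assms[THEN polytime_comp])

lemma disjoint_step_cases:
  obtains "disjoint_step u = u" "\<And>c. c \<in> set (fst u) \<Longrightarrow> \<not> pivotal (fst u) c"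
  | c where "c \<in> set (fst u)" "pivotal (fst u) c"
      "disjoint_step u = (filter (\<lambda>c'. fst c' \<noteq> fst c \<and> \<not> meets (snd c') (snd c)) (fst u), c # snd u)"
proof (cases "filter (pivotal (fst u)) (fst u)")
  case Nil
  then show ?thesis using that(1) by (auto simp: disjoint_step_def filter_empty_conv)
next
  case (Cons c cs)
  then have "c \<in> set (filter (pivotal (fst u)) (fst u))" by simp
  then have "c \<in> set (fst u)" "pivotal (fst u) c" by auto
  moreover have "disjoint_step u =
      (filter (\<lambda>c'. fst c' \<noteq> fst c \<and> \<not> meets (snd c') (snd c)) (fst u), c # snd u)"
    by (simp add: disjoint_step_def Cons)
  ultimately show ?thesis by (rule that(2))
qed

lemma esize_filter: "esize (filter P xs) \<le> esize xs"
  by (induction xs) auto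

lemma polytime_disjoint_selection:
  assumes "polytime cs"
  shows "polytime (\<lambda>x. disjoint_selection (cs x))"
  unfolding disjoint_selection_def
proof (rule polytime_funpow)
  let ?B = "\<lambda>x. 2 + esize (cs x) + length (cs x) * (1 + esize (cs x))"
  show "polybound ?B" by (intro polybound_intros polytime_esize polybound_length assms)
  fix x j assume j: "j \<le> length (cs x)"
  have "set (fst ((disjoint_step ^^ j) (cs x, []))) \<subseteq> set (cs x) \<and>
     esize (fst ((disjoint_step ^^ j) (cs x, []))) \<le> esize (cs x) \<and>
     esize (snd ((disjoint_step ^^ j) (cs x, []))) \<le> 1 + j * (1 + esize (cs x))" for j
  proof (induction j)
    case (Suc j)
    let ?u = "(disjoint_step ^^ j) (cs x, [])"
    show ?case
    proof (cases rule: disjoint_step_cases[of ?u])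
      case 1
      then show ?thesis using Suc by simp
    next
      case (2 c)
      then have "esize c < esize (cs x)" using Suc esize_member[of c "cs x"] by auto
      then show ?thesis
        using Suc 2(3) order_trans[OF esize_filter, of "fst ?u" "esize (cs x)"] by auto
    qed
  qed simp
  note * = this[of j]
  have "j * (1 + esize (cs x)) \<le> length (cs x) * (1 + esize (cs x))"
    using j by (rule mult_right_mono) simp
  with * show "esize ((disjoint_step ^^ j) (cs x, [])) \<le> ?B x"
    by (simp only: enc_prod_def val_size.simps) linarith
qed (intro polytime_disjoint_step polytime_intros assms)+

lemma polytime_signature:
  assumes "polytime cs" and "polytime e"
  shows "polytime (\<lambda>x. signature (cs x) (e x))"
  unfolding signature_def by (intro polytime_intros polytime_pedges assms[THEN polytime_comp])

lemma polytime_representatives: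
  assumes "polytime cs"
  shows "polytime (\<lambda>x. representatives (cs x))"
  unfolding representatives_def
  by (intro polytime_intros polytime_signature polytime_pedges assms[THEN polytime_comp])

lemma polytime_loglist:
  assumes "polytime xs"
  shows "polytime (\<lambda>x. loglist (xs x))"
proof -
  \<comment> \<open>\<open>polytime_power\<close> wants the exponent bounded for all arguments, not
    only for members of the range. The conditional supplies this and leaves the filtered list
    unchanged.\<close>
  have eq: "filter (\<lambda>j. 2 ^ j \<le> length l) [0..<length l] =
      filter (\<lambda>j. 2 ^ (if j < length l then j else 0) \<le> length l) [0..<length l]" for l :: "'b list"
    by (rule filter_cong) auto
  show ?thesis
    unfolding loglist_def eq
    by (intro polytime_intros polytime_power[where l = "\<lambda>z. xs (fst z)"] assms[THEN polytime_comp]) auto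
qed

lemma polytime_base: "polytime xs \<Longrightarrow> polytime (\<lambda>x. base (xs x))"
  unfolding base_def by (intro polytime_intros polytime_loglist)

lemma length_cap_range: "length (cap_range xs) = Suc (9 * base xs)"
  by (simp add: cap_range_def base_def)

lemma polytime_cap_range:
  assumes "polytime xs"
  shows "polytime (\<lambda>x. cap_range (xs x))"
  unfolding cap_range_def by (intro polytime_intros polytime_loglist assms[THEN polytime_comp])

lemma polytime_capacity:
  assumes "polytime xs"
  shows "polytime (\<lambda>x. capacity (xs x))"
proof -
  have eq: "filter (\<lambda>c. base l ^ c < 2 ^ (9 * base l)) (cap_range l) =
      filter (\<lambda>c. base l ^ (if c < length (cap_range l) then c else 0) < 2 ^ (9 * base l)) (cap_range l)"
    for l :: "'b list"
    by (rule filter_cong) (auto simp: cap_range_def)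
  show ?thesis
    unfolding capacity_def eq
    by (intro polytime_intros polytime_power[where l = "\<lambda>z. cap_range (xs (fst z))"] polytime_base
        polytime_cap_range assms[THEN polytime_comp]) (auto simp: length_cap_range)
qed

lemma polytime_round_candidates:
  assumes "polytime cs"
  shows "polytime (\<lambda>x. round_candidates (cs x))"
proof -
  have "polytime (\<lambda>x. greedy (base (representatives (cs x))) (representatives (cs x))
     (capacity (representatives (cs x))) ((\<lambda>x sel. cs x) x) (length (cs x)))"
  proof (rule polytime_greedy[where g = "\<lambda>x. esize (cs x)"])
    fix x sel c assume "c \<in> set (cs x)"
    from esize_member[OF this] show "esize c \<le> esize (cs x)" by simp
  qed (intro polytime_base polytime_capacity polytime_representatives polytime_esize polytime_intros
      assms[THEN polytime_comp] assms)+
  then show ?thesis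
    unfolding round_candidates_def
    by (intro polytime_intros polytime_disjoint_selection assms)
qed

lemma polytime_maxedp_algorithm: "polytime maxedp_algorithm"
proof -
  have "polytime (\<lambda>x. maxedp_algorithm x)"
    unfolding maxedp_algorithm_def
    by (intro polytime_intros polytime_round_candidates polytime_candidates polytime_fractional)
  then show ?thesis .
qed

section \<open>Correctness of the path subroutines\<close>

subsection \<open>Shortest paths\<close>

lemma arcs_simps [simp]: "arcs [] = []" "arcs [x] = []" "arcs (x # y # p) = (x, y) # arcs (y # p)"
  by (simp_all add: arcs_def)

lemma arcs_snoc: "p \<noteq> [] \<Longrightarrow> arcs (p @ [v]) = arcs p @ [(last p, v)]"
proof (induction p)
  case (Cons x p)
  then show ?case by (cases p) auto
qed simp

lemma distinct_arcs: "distinct p \<Longrightarrow> distinct (arcs p)"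
  by (simp add: arcs_def distinct_zipI1)

text \<open>Walks from \<open>s\<close> with their costs, listed backwards like the table entries
  that they justify.\<close>

inductive rwalk :: "(('a \<times> 'a) \<times> nat) list \<Rightarrow> 'a \<Rightarrow> 'a list \<Rightarrow> nat \<Rightarrow> bool" for as s where
  rwalk_Nil: "rwalk as s [s] 0"
| rwalk_Cons: "rwalk as s p c \<Longrightarrow> ((hd p, v), w) \<in> set as \<Longrightarrow> rwalk as s (v # p) (c + w)"

lemma rwalk_nonempty: "rwalk as s p c \<Longrightarrow> p \<noteq> []"
  by (induction rule: rwalk.induct) auto

lemma rwalk_set: "rwalk as s p c \<Longrightarrow> set p \<subseteq> insert s ((snd \<circ> fst) ` set as)"
  by (induction rule: rwalk.induct) force+

text \<open>Stop the walk at \<open>v\<close> and cut out its loops; weights are natural numbers, so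
  neither operation raises the cost.\<close>

lemma rwalk_suffix:
  "rwalk as s p c \<Longrightarrow> v \<in> set p \<Longrightarrow> \<exists>p' c'. rwalk as s p' c' \<and> distinct p' \<and> hd p' = v \<and> c' \<le> c"
proof (induction arbitrary: v rule: rwalk.induct)
  case rwalk_Nil
  then show ?case using rwalk.rwalk_Nil[of as s] by fastforce
next
  case (rwalk_Cons p c u w)
  show ?case
  proof (cases "v \<in> set p")
    case True
    with rwalk_Cons.IH show ?thesis using le_add1 order_trans by blast
  next
    case False
    then have v: "v = u" "u \<notin> set p" using rwalk_Cons.prems by auto
    from rwalk_nonempty[OF rwalk_Cons.hyps(1)] have "hd p \<in> set p" by simp
    from rwalk_Cons.IH[OF this] obtain p' c' where p': "rwalk as s p' c'" "distinct p'" "hd p' = hd p" "c' \<le> c"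
      by blast
    show ?thesis
    proof (cases "u \<in> set p'")
      case False
      have "rwalk as s (u # p') (c' + w)"
        by (rule rwalk.rwalk_Cons[OF p'(1)]) (simp add: p' rwalk_Cons.hyps)
      then show ?thesis using False p' v by (intro exI[of _ "u # p'"] exI[of _ "c' + w"]) auto
    next
      case True
      \<comment> \<open>The simple walk already passes through \<open>u\<close>; its part up to
        \<open>u\<close> is a suffix of the reversed list.\<close>
      have "\<exists>p'' c''. rwalk as s p'' c'' \<and> distinct p'' \<and> hd p'' = u \<and> c'' \<le> c'"
        using p'(1,2) True
      proof (induction rule: rwalk.induct)
        case rwalk_Nil
        then show ?case using rwalk.rwalk_Nil[of as s] by fastforce
      next
        case (rwalk_Cons q d x y)
        show ?case
        proof (cases "u = x")
          case True
          then show ?thesis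
            using rwalk.rwalk_Cons[OF rwalk_Cons.hyps] rwalk_Cons.prems(1)
            by (intro exI[of _ "x # q"] exI[of _ "d + y"]) auto
        next
          case False
          then show ?thesis using rwalk_Cons by (auto intro: trans_le_add1)
        qed
      qed
      then obtain p'' c'' where "rwalk as s p'' c''" "distinct p''" "hd p'' = u" "c'' \<le> c'" by blast
      then show ?thesis using v p'(4) by (intro exI[of _ p''] exI[of _ c'']) simp
    qed
  qed
qed

text \<open>A loop has positive cost, so removing it is a strict gain. The strictness is what later
  shows that table entries are simple paths.\<close>

lemma rwalk_distinct:
  assumes pos: "\<forall>x\<in>set as. snd x > 0"
  shows "rwalk as s p c \<Longrightarrow>
    \<exists>p' c'. rwalk as s p' c' \<and> distinct p' \<and> hd p' = hd p \<and> c' \<le> c \<and> (\<not> distinct p \<longrightarrow> c' < c)"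
proof (induction rule: rwalk.induct)
  case rwalk_Nil
  then show ?case using rwalk.rwalk_Nil[of as s] by fastforce
next
  case (rwalk_Cons p c v w)
  have w: "w > 0" using pos rwalk_Cons.hyps(2) by auto
  show ?case
  proof (cases "v \<in> set p")
    case True
    from rwalk_suffix[OF rwalk_Cons.hyps(1) this] obtain p' c'
      where "rwalk as s p' c'" "distinct p'" "hd p' = v" "c' \<le> c" by blast
    then show ?thesis using w by (intro exI[of _ p'] exI[of _ c']) auto
  next
    case False
    from rwalk_Cons.IH obtain p' c' where p': "rwalk as s p' c'" "distinct p'" "hd p' = hd p"
      "c' \<le> c" "\<not> distinct p \<longrightarrow> c' < c" by blast
    have r: "rwalk as s (v # p') (c' + w)"
      by (rule rwalk.rwalk_Cons[OF p'(1)]) (simp add: p' rwalk_Cons.hyps)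
    show ?thesis
    proof (cases "v \<in> set p'")
      case True
      from rwalk_suffix[OF p'(1) this] obtain p'' c''
        where "rwalk as s p'' c''" "distinct p''" "hd p'' = v" "c'' \<le> c'" by blast
      then show ?thesis using w p' by (intro exI[of _ p''] exI[of _ c'']) auto
    next
      case False
      then show ?thesis using r p' \<open>v \<notin> set p\<close> by (intro exI[of _ "v # p'"] exI[of _ "c' + w"]) auto
    qed
  qed
qed

lemma rwalk_arcs:
  assumes "\<forall>x\<in>set as. snd x = f (fst x)"
  shows "rwalk as s p c \<Longrightarrow> p \<noteq> [] \<and> last p = s \<and> (\<forall>a\<in>set (arcs (rev p)). (a, f a) \<in> set as) \<and>
    c = sum_list (map f (arcs (rev p)))"
proof (induction rule: rwalk.induct)
  case (rwalk_Cons p c v w)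
  then have "arcs (rev (v # p)) = arcs (rev p) @ [(hd p, v)]" by (simp add: arcs_snoc last_rev)
  moreover have "w = f (hd p, v)" using assms rwalk_Cons.hyps(2) by auto
  ultimately show ?case using rwalk_Cons by auto
qed simp

lemma arcs_rwalk:
  "q \<noteq> [] \<Longrightarrow> \<forall>a\<in>set (arcs q). (a, f a) \<in> set as \<Longrightarrow> rwalk as (hd q) (rev q) (sum_list (map f (arcs q)))"
proof (induction q rule: rev_induct)
  case (snoc v q)
  show ?case
  proof (cases "q = []")
    case True
    then show ?thesis by (simp add: rwalk_Nil)
  next
    case False
    have a: "arcs (q @ [v]) = arcs q @ [(last q, v)]" by (rule arcs_snoc[OF False])
    have "rwalk as (hd q) (v # rev q) (sum_list (map f (arcs q)) + f (last q, v))"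
      by (rule rwalk_Cons) (use snoc False a in \<open>auto simp: hd_rev\<close>)
    then show ?thesis using False by (simp add: a)
  qed
qed simp

lemma bf_sound: "e \<in> set ((bf_step vs as ^^ j) [(0, [s])]) \<Longrightarrow> rwalk as s (snd e) (fst e)"
proof (induction j arbitrary: e)
  case 0
  then show ?case by (simp add: rwalk_Nil)
next
  case (Suc j)
  let ?T = "(bf_step vs as ^^ j) [(0, [s])]"
  have "e \<in> set ?T \<union> set (relax as ?T)" using Suc.prems set_bf_step[of vs as ?T] by auto
  then show ?case
  proof
    assume "e \<in> set (relax as ?T)"
    then obtain c w u v p where e: "e = (c + w, v # p)" "((u, v), w) \<in> set as" "(c, p) \<in> set ?T" "starts u p"
      unfolding set_relax by blast
    from Suc.IH[OF e(3)] have "rwalk as s p c" by simp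
    from rwalk_Cons[OF this, of v w] show ?thesis using e by (simp add: starts_iff)
  qed (rule Suc.IH)
qed

lemma bf_step_best:
  assumes "x \<in> set T \<union> set (relax as T)" and "starts v (snd x)" and "v \<in> set vs"
  shows "\<exists>e\<in>set (bf_step vs as T). starts v (snd e) \<and> fst e \<le> fst x"
proof -
  let ?l = "filter (\<lambda>e. starts v (snd e)) (T @ relax as T)"
  have x: "x \<in> set ?l" using assms by auto
  then have "?l \<noteq> []" by (metis empty_iff empty_set)
  then obtain e es where e: "argmin fst ?l = e # es"
    using argmin_Nil_iff[of fst ?l] by (cases "argmin fst ?l") auto
  have "fst e \<le> fst x" using argmin_ConsD(3)[OF e x] .
  moreover have "starts v (snd e)" using argmin_ConsD(2)[OF e] by auto
  moreover have "e \<in> set (bf_step vs as T)"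
    unfolding bf_step_def set_concat set_map
    by (rule UN_I[OF imageI[OF assms(3)]]) (simp only: e list.set_intros)
  ultimately show ?thesis by blast
qed

text \<open>\<open>Suc j\<close> vertices mean \<open>j\<close> arcs, one for every round. The entry
  found may be a different walk to the same end.\<close>

lemma bf_complete:
  assumes s: "s \<in> set vs" and as: "(snd \<circ> fst) ` set as \<subseteq> set vs"
  shows "rwalk as s p c \<Longrightarrow> length p \<le> Suc j \<Longrightarrow>
    \<exists>e\<in>set ((bf_step vs as ^^ j) [(0, [s])]). starts (hd p) (snd e) \<and> fst e \<le> c"
proof (induction j arbitrary: p c)
  case 0
  from 0(1) show ?case
  proof cases
    case rwalk_Nil
    then show ?thesis by (simp add: starts_def)
  next
    case (rwalk_Cons p' c' v w)
    with rwalk_nonempty[OF rwalk_Cons(3)] 0(2) show ?thesis by (cases p') auto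
  qed
next
  case (Suc j)
  let ?T = "(bf_step vs as ^^ j) [(0, [s])]"
  have "\<exists>x\<in>set ?T \<union> set (relax as ?T). starts (hd p) (snd x) \<and> fst x \<le> c"
    using Suc.prems(1)
  proof cases
    case rwalk_Nil
    with Suc.IH[OF Suc.prems(1)] show ?thesis by auto
  next
    case (rwalk_Cons p' c' v w)
    from Suc.IH[OF rwalk_Cons(3)] Suc.prems(2) rwalk_Cons(1) obtain e
      where e: "e \<in> set ?T" "starts (hd p') (snd e)" "fst e \<le> c'" by auto
    have "(fst e + w, v # snd e) \<in> set (relax as ?T)"
      unfolding set_relax
      by (intro CollectI exI[of _ "fst e"] exI[of _ w] exI[of _ "hd p'"] exI[of _ v] exI[of _ "snd e"])
        (use e rwalk_Cons(4) in simp)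
    then show ?thesis using e rwalk_Cons by (intro bexI[of _ "(fst e + w, v # snd e)"]) (auto simp: starts_def)
  qed
  then obtain x where x: "x \<in> set ?T \<union> set (relax as ?T)" "starts (hd p) (snd x)" "fst x \<le> c" by blast
  have "hd p \<in> insert s ((snd \<circ> fst) ` set as)"
    using rwalk_nonempty[OF Suc.prems(1)] by (intro subsetD[OF rwalk_set[OF Suc.prems(1)]]) simp
  then have "hd p \<in> set vs" using s as by auto
  from bf_step_best[OF x(1,2) this] obtain e
    where "e \<in> set (bf_step vs as ?T)" "starts (hd p) (snd e)" "fst e \<le> fst x" by blast
  then show ?case using x(3) by (intro bexI[of _ e]) auto
qed

lemma bf_unique:
  assumes "x \<in> set ((bf_step vs as ^^ j) [(0, [s])])" and "y \<in> set ((bf_step vs as ^^ j) [(0, [s])])"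
    and "starts v (snd x)" and "starts v (snd y)"
  shows "x = y"
proof (cases j)
  case 0
  then show ?thesis using assms by simp
next
  case (Suc i)
  let ?T = "(bf_step vs as ^^ i) [(0, [s])]"
  let ?l = "\<lambda>u. argmin fst (filter (\<lambda>e. starts u (snd e)) (?T @ relax as ?T))"
  have "z \<in> set (?l v)" if z: "z \<in> set (bf_step vs as ?T)" "starts v (snd z)" for z
  proof -
    from z(1) obtain u where u: "z \<in> set (?l u)" by (auto simp: bf_step_def)
    from subsetD[OF argmin_subset u] have "starts u (snd z)" by auto
    with z(2) have "u = v" by (simp add: starts_iff)
    with u show ?thesis by simp
  qed
  with assms Suc have "x \<in> set (?l v)" "y \<in> set (?l v)" by auto
  moreover have "length (?l v) \<le> 1" by (rule length_argmin)
  ultimately show ?thesis by (cases "?l v") auto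
qed

theorem shortest_path_correct:
  fixes s t :: 'a
  assumes s: "s \<in> set vs" and as: "\<forall>x\<in>set as. snd x = f (fst x) \<and> snd x > 0 \<and> snd (fst x) \<in> set vs"
  defines "p \<equiv> shortest_path vs as s t"
  shows "p \<noteq> [] \<Longrightarrow> distinct p \<and> hd p = s \<and> last p = t \<and> (\<forall>a\<in>set (arcs p). (a, f a) \<in> set as)"
    and "q \<noteq> [] \<Longrightarrow> hd q = s \<Longrightarrow> last q = t \<Longrightarrow> \<forall>a\<in>set (arcs q). (a, f a) \<in> set as \<Longrightarrow>
      p \<noteq> [] \<and> sum_list (map f (arcs p)) \<le> sum_list (map f (arcs q))"
proof -
  let ?T = "bellman_ford vs as s"
  have as1: "\<forall>x\<in>set as. snd x = f (fst x)" and as2: "\<forall>x\<in>set as. snd x > 0"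
    and as3: "(snd \<circ> fst) ` set as \<subseteq> set vs" using as by auto
  have compl: "\<exists>e\<in>set ?T. starts (hd q) (snd e) \<and> fst e \<le> c \<and> (\<not> distinct q \<longrightarrow> fst e < c)"
    if q: "rwalk as s q c" for q c
  proof -
    have "\<exists>q' c'. rwalk as s q' c' \<and> distinct q' \<and> hd q' = hd q \<and> c' \<le> c \<and> (\<not> distinct q \<longrightarrow> c' < c)"
      by (rule rwalk_distinct[OF as2 q])
    then obtain q' c' where q': "rwalk as s q' c'" "distinct q'" "hd q' = hd q" "c' \<le> c"
      "\<not> distinct q \<longrightarrow> c' < c" by blast
    have "insert s ((snd \<circ> fst) ` set as) \<subseteq> set vs" using s as3 by simp
    with rwalk_set[OF q'(1)] have "set q' \<subseteq> set vs" by (rule order_trans)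
    \<comment> \<open>A simple walk has at most \<open>length vs\<close> vertices, so
      \<open>length vs\<close> rounds suffice.\<close>
    from card_mono[OF finite_set this] have "length q' \<le> Suc (length vs)"
      using q'(2) card_length[of vs] by (simp add: distinct_card)
    from bf_complete[OF s as3 q'(1) this] obtain e where
      "e \<in> set ?T" "starts (hd q') (snd e)" "fst e \<le> c'"
      unfolding bellman_ford_def by blast
    with q'(3,4,5) show ?thesis by (intro bexI[of _ e]) auto
  qed
  have entry: "distinct (snd e) \<and> p = rev (snd e) \<and> rwalk as s (snd e) (fst e) \<and> p \<noteq> []"
    if e: "e \<in> set ?T" "starts t (snd e)" for e
  proof -
    have r: "rwalk as s (snd e) (fst e)" using e(1) bf_sound unfolding bellman_ford_def by fast
    from compl[OF this] obtain e' where e': "e' \<in> set ?T" "starts (hd (snd e)) (snd e')"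
      "\<not> distinct (snd e) \<longrightarrow> fst e' < fst e" by blast
    \<comment> \<open>There is one entry per end vertex, so the competitor of \<open>e\<close> is
      \<open>e\<close> itself; if \<open>e\<close> were not simple, it would be cheaper than
      itself.\<close>
    have "e' = e"
      using e e' unfolding bellman_ford_def by (intro bf_unique[of e' _ _ _ _ e t]) (auto simp: starts_iff)
    with e'(3) have d: "distinct (snd e)" by auto
    have "e \<in> set (filter (\<lambda>e. starts t (snd e)) ?T)" using e by simp
    then obtain e1 es where l: "filter (\<lambda>e. starts t (snd e)) ?T = e1 # es"
      by (cases "filter (\<lambda>e. starts t (snd e)) ?T") auto
    then have "e1 \<in> set (filter (\<lambda>e. starts t (snd e)) ?T)" by simp
    then have "e1 = e" using e unfolding bellman_ford_def by (intro bf_unique[of e1 _ _ _ _ e t]) auto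
    then have "p = rev (snd e)" by (simp add: p_def shortest_path_def l)
    with d r show ?thesis using rwalk_nonempty[OF r] by simp
  qed
  show "distinct p \<and> hd p = s \<and> last p = t \<and> (\<forall>a\<in>set (arcs p). (a, f a) \<in> set as)" if "p \<noteq> []"
  proof -
    from that obtain e es where l: "filter (\<lambda>e. starts t (snd e)) ?T = e # es"
      unfolding p_def shortest_path_def by (cases "filter (\<lambda>e. starts t (snd e)) ?T") auto
    then have "e \<in> set (filter (\<lambda>e. starts t (snd e)) ?T)" by simp
    then have e: "e \<in> set ?T" "starts t (snd e)" by auto
    note * = entry[OF e]
    show ?thesis
      using * rwalk_arcs[of as f s "snd e" "fst e", OF as1] e(2) by (auto simp: starts_iff last_rev hd_rev)
  qed
  show "p \<noteq> [] \<and> sum_list (map f (arcs p)) \<le> sum_list (map f (arcs q))"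
    if q: "q \<noteq> []" "hd q = s" "last q = t" "\<forall>a\<in>set (arcs q). (a, f a) \<in> set as"
  proof -
    have "rwalk as s (rev q) (sum_list (map f (arcs q)))" using arcs_rwalk[OF q(1,4)] q(2) by simp
    from compl[OF this] obtain e where e: "e \<in> set ?T" "starts t (snd e)"
      "fst e \<le> sum_list (map f (arcs q))"
      using q(1,3) by (auto simp: hd_rev)
    note * = entry[OF e(1,2)]
    show ?thesis using * e(3) rwalk_arcs[of as f s "snd e" "fst e", OF as1] by auto
  qed
qed

subsection \<open>Integral maximum flows\<close>

text \<open>Flows are treated as multisets of arcs and controlled by cuts alone; neither a flow
  function nor conservation at single vertices appears.\<close>

definition cut_out :: "('a \<times> 'a) multiset \<Rightarrow> 'a set \<Rightarrow> nat" where
  "cut_out D U = size (filter_mset (\<lambda>a. fst a \<in> U \<and> snd a \<notin> U) D)"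

definition cut_in :: "('a \<times> 'a) multiset \<Rightarrow> 'a set \<Rightarrow> nat" where
  "cut_in D U = size (filter_mset (\<lambda>a. fst a \<notin> U \<and> snd a \<in> U) D)"

lemma cut_union [simp]: "cut_out (A + B) U = cut_out A U + cut_out B U" "cut_in (A + B) U = cut_in A U + cut_in B U"
  by (simp_all add: cut_out_def cut_in_def)

lemma cut_swap: "cut_out (image_mset prod.swap A) U = cut_in A U"
  unfolding cut_out_def cut_in_def by (induction A) auto

text \<open>Crossings out of and into \<open>U\<close> alternate along a path, so their difference
  is decided by its two ends. The sum form avoids subtraction of natural numbers.\<close>

lemma cut_path:
  "p \<noteq> [] \<Longrightarrow> cut_out (mset (arcs p)) U + of_bool (last p \<in> U) = cut_in (mset (arcs p)) U + of_bool (hd p \<in> U)"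
proof (induction p)
  case (Cons x p)
  then show ?case by (cases p) (auto simp: cut_out_def cut_in_def)
qed simp

lemma distinct_mset_subset: "distinct xs \<Longrightarrow> set xs \<subseteq> set ys \<Longrightarrow> mset xs \<subseteq># mset ys"
proof (rule mset_subset_eqI)
  fix a assume "distinct xs" "set xs \<subseteq> set ys"
  then show "count (mset xs) a \<le> count (mset ys) a"
    by (cases "a \<in> set xs") (auto simp: distinct_count_atmost_1 Suc_le_eq count_eq_zero_iff)
qed

lemma arc_path_correct:
  fixes s t :: 'a
  assumes s: "s \<in> set vs" and D: "set D \<subseteq> set vs \<times> set vs"
  defines "p \<equiv> arc_path vs s t D"
  shows "p \<noteq> [] \<Longrightarrow> distinct p \<and> hd p = s \<and> last p = t \<and> mset (arcs p) \<subseteq># mset D"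
    and "(\<And>U. s \<in> U \<Longrightarrow> t \<notin> U \<Longrightarrow> cut_out (mset D) U > 0) \<Longrightarrow> p \<noteq> []"
proof -
  let ?as = "map (\<lambda>a. (a, 1 :: nat)) D"
  have as: "\<forall>x\<in>set ?as. snd x = 1 \<and> snd x > 0 \<and> snd (fst x) \<in> set vs" using D by auto
  note sp = shortest_path_correct[where s = s and vs = vs and as = ?as and f = "\<lambda>_. 1" and t = t, OF s as, folded arc_path_def, folded p_def]
  show "distinct p \<and> hd p = s \<and> last p = t \<and> mset (arcs p) \<subseteq># mset D" if "p \<noteq> []"
  proof -
    have "set (arcs p) \<subseteq> set D" "distinct p" "hd p = s" "last p = t" using sp(1)[OF that] by auto
    moreover from this have "mset (arcs p) \<subseteq># mset D"
      by (intro distinct_mset_subset distinct_arcs)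
    ultimately show ?thesis by simp
  qed
  show "p \<noteq> []" if cut: "\<And>U. s \<in> U \<Longrightarrow> t \<notin> U \<Longrightarrow> cut_out (mset D) U > 0"
  proof -
    \<comment> \<open>The set of reachable vertices has no leaving arc, so if every separating cut
      has one, then \<open>t\<close> is reachable.\<close>
    define U where "U = {v. \<exists>q. q \<noteq> [] \<and> hd q = s \<and> last q = v \<and> set (arcs q) \<subseteq> set D}"
    have "s \<in> U" unfolding U_def by (intro CollectI exI[of _ "[s]"]) simp
    have "t \<in> U"
    proof (rule ccontr)
      assume "t \<notin> U"
      from cut[OF \<open>s \<in> U\<close> this] have "filter_mset (\<lambda>a. fst a \<in> U \<and> snd a \<notin> U) (mset D) \<noteq> {#}"
        unfolding cut_out_def by (intro notI) simp
      then obtain a where "a \<in># filter_mset (\<lambda>a. fst a \<in> U \<and> snd a \<notin> U) (mset D)"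
        by (rule multiset_nonemptyE)
      then have a: "a \<in> set D" "fst a \<in> U" "snd a \<notin> U" by auto
      then obtain q where q: "q \<noteq> []" "hd q = s" "last q = fst a" "set (arcs q) \<subseteq> set D"
        unfolding U_def by blast
      have "snd a \<in> U"
        unfolding U_def
      proof (intro CollectI exI[of _ "q @ [snd a]"] conjI)
        show "set (arcs (q @ [snd a])) \<subseteq> set D" using q(3,4) a(1) by (simp add: arcs_snoc[OF q(1)])
      qed (use q(1,2) in simp_all)
      with a show False by simp
    qed
    then obtain q where "q \<noteq> []" "hd q = s" "last q = t" "set (arcs q) \<subseteq> set D" unfolding U_def by blast
    then show ?thesis using sp(2)[of q] by force
  qed
qed

text \<open>The removed arcs are added on the left because multiset subtraction is truncated; in
  this form counts and cuts can be applied to both sides.\<close>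

lemma mset_augment:
  assumes "mset (arcs (arc_path vs s t D)) \<subseteq># mset D"
  shows "mset (augment vs s t D) + mset (arcs (arc_path vs s t D)) =
    mset D + image_mset prod.swap (mset (arcs (arc_path vs s t D)))"
proof -
  have "(\<lambda>a :: 'a \<times> 'a. (snd a, fst a)) = prod.swap" by (simp add: fun_eq_iff)
  moreover have "(A - P + B) + P = A + B" if "P \<subseteq># A" for A B P :: "('a \<times> 'a) multiset"
    using that by (metis add.assoc add.commute subset_mset.diff_add)
  ultimately show ?thesis using assms by (simp only: augment_def mset_list_diff mset_append mset_map)
qed

lemma count_swap: "count (image_mset prod.swap A) a = count A (prod.swap a)"
  by (induction A) (auto simp: prod.swap_def)

text \<open>Each augmentation lowers every separating cut by exactly 1, so cuts of at least
  \<open>n\<close> permit \<open>n\<close> augmentations. The joint number of copies of an arc and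
  its reversal never changes; this will identify the arcs gained by the residual network with the
  reversals of those lost.\<close>

lemma augment_invariant:
  assumes s: "s \<in> set vs" and D: "set D \<subseteq> set vs \<times> set vs"
    and cut: "\<forall>U. s \<in> U \<longrightarrow> t \<notin> U \<longrightarrow> n \<le> cut_out (mset D) U" and "j \<le> n"
  defines "E \<equiv> (augment vs s t ^^ j) D"
  shows "set E \<subseteq> set vs \<times> set vs"
    and "\<And>a. count (mset E) a + count (mset E) (prod.swap a) = count (mset D) a + count (mset D) (prod.swap a)"
    and "\<And>U. s \<in> U \<Longrightarrow> t \<notin> U \<Longrightarrow> cut_out (mset E) U + j = cut_out (mset D) U"
proof -
  have "set E \<subseteq> set vs \<times> set vs \<and>
    (\<forall>a. count (mset E) a + count (mset E) (prod.swap a) = count (mset D) a + count (mset D) (prod.swap a)) \<and>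
    (\<forall>U. s \<in> U \<longrightarrow> t \<notin> U \<longrightarrow> cut_out (mset E) U + j = cut_out (mset D) U)"
    using \<open>j \<le> n\<close> unfolding E_def
  proof (induction j)
    case 0
    then show ?case using D by simp
  next
    case (Suc j)
    let ?E = "(augment vs s t ^^ j) D" and ?p = "arc_path vs s t ((augment vs s t ^^ j) D)"
    have IH: "set ?E \<subseteq> set vs \<times> set vs"
      "\<And>a. count (mset ?E) a + count (mset ?E) (prod.swap a) = count (mset D) a + count (mset D) (prod.swap a)"
      "\<And>U. s \<in> U \<Longrightarrow> t \<notin> U \<Longrightarrow> cut_out (mset ?E) U + j = cut_out (mset D) U"
      using Suc by auto
    have "?p \<noteq> []"
    proof (rule arc_path_correct(2)[OF s IH(1)])
      fix U assume "s \<in> U" "t \<notin> U"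
      then show "cut_out (mset ?E) U > 0" using IH(3)[of U] cut[rule_format, of U] Suc.prems by simp
    qed
    from arc_path_correct(1)[OF s IH(1) this]
    have p: "distinct ?p" "hd ?p = s" "last ?p = t" "mset (arcs ?p) \<subseteq># mset ?E" by auto
    note m = mset_augment[OF p(4)]
    have "set (augment vs s t ?E) \<subseteq> set vs \<times> set vs"
    proof
      fix a assume "a \<in> set (augment vs s t ?E)"
      then have "a \<in># mset (augment vs s t ?E) + mset (arcs ?p)" by simp
      then have "a \<in> set ?E \<or> prod.swap a \<in> set (arcs ?p)" unfolding m by auto
      moreover have "set (arcs ?p) \<subseteq> set ?E" using p(4) set_mset_mono by fastforce
      ultimately show "a \<in> set vs \<times> set vs" using IH(1) by (cases a) auto
    qed
    moreover have "count (mset (augment vs s t ?E)) a + count (mset (augment vs s t ?E)) (prod.swap a) =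
        count (mset D) a + count (mset D) (prod.swap a)" for a
      using arg_cong[OF m, of "\<lambda>A. count A a"] arg_cong[OF m, of "\<lambda>A. count A (prod.swap a)"] IH(2)[of a]
      by (simp add: count_swap)
    moreover have "cut_out (mset (augment vs s t ?E)) U + Suc j = cut_out (mset D) U" if U: "s \<in> U" "t \<notin> U" for U
      using arg_cong[OF m, of "\<lambda>A. cut_out A U"] cut_path[OF \<open>?p \<noteq> []\<close>, of U] IH(3)[OF U] U
      by (simp add: cut_swap p)
    ultimately show ?case by simp
  qed
  then show "set E \<subseteq> set vs \<times> set vs"
    and "\<And>a. count (mset E) a + count (mset E) (prod.swap a) = count (mset D) a + count (mset D) (prod.swap a)"
    and "\<And>U. s \<in> U \<Longrightarrow> t \<notin> U \<Longrightarrow> cut_out (mset E) U + j = cut_out (mset D) U" by auto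
qed

text \<open>The condition on cuts stands for conservation of a flow of value \<open>n\<close>. A
  peeled path lowers the net number of leaving arcs by 1, so there is always another one until
  \<open>n\<close> have been taken; remaining cycles stay in the first component.\<close>

lemma peel_invariant:
  assumes s: "s \<in> set vs" and F: "set F \<subseteq> set vs \<times> set vs"
    and cut: "\<forall>U. s \<in> U \<longrightarrow> t \<notin> U \<longrightarrow> cut_out (mset F) U = cut_in (mset F) U + n" and "j \<le> n"
  defines "u \<equiv> (peel vs s t ^^ j) (F, [])"
  shows "length (snd u) = j \<and> (\<forall>p\<in>set (snd u). p \<noteq> [] \<and> distinct p \<and> hd p = s \<and> last p = t) \<and>
    mset (fst u) + (\<Sum>p\<leftarrow>snd u. mset (arcs p)) = mset F"
proof -
  have "(length (snd u) = j \<and> (\<forall>p\<in>set (snd u). p \<noteq> [] \<and> distinct p \<and> hd p = s \<and> last p = t) \<and>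
    mset (fst u) + (\<Sum>p\<leftarrow>snd u. mset (arcs p)) = mset F) \<and>
    (\<forall>U. s \<in> U \<longrightarrow> t \<notin> U \<longrightarrow> cut_out (mset (fst u)) U + j = cut_in (mset (fst u)) U + n)"
    using \<open>j \<le> n\<close> unfolding u_def
  proof (induction j)
    case 0
    then show ?case using cut by simp
  next
    case (Suc j)
    let ?u = "(peel vs s t ^^ j) (F, [])"
    let ?p = "arc_path vs s t (fst ?u)"
    have IH: "length (snd ?u) = j" "\<And>p. p \<in> set (snd ?u) \<Longrightarrow> p \<noteq> [] \<and> distinct p \<and> hd p = s \<and> last p = t"
      "mset (fst ?u) + (\<Sum>p\<leftarrow>snd ?u. mset (arcs p)) = mset F"
      "\<And>U. s \<in> U \<Longrightarrow> t \<notin> U \<Longrightarrow> cut_out (mset (fst ?u)) U + j = cut_in (mset (fst ?u)) U + n"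
      using Suc by auto
    have "mset (fst ?u) \<subseteq># mset F" unfolding IH(3)[symmetric] by simp
    from set_mset_mono[OF this] have set_u: "set (fst ?u) \<subseteq> set vs \<times> set vs" using F by simp
    have "?p \<noteq> []"
    proof (rule arc_path_correct(2)[OF s set_u])
      fix U assume "s \<in> U" "t \<notin> U"
      then show "cut_out (mset (fst ?u)) U > 0" using IH(4)[of U] Suc.prems by simp
    qed
    from arc_path_correct(1)[OF s set_u this]
    have p: "distinct ?p" "hd ?p = s" "last ?p = t" "mset (arcs ?p) \<subseteq># mset (fst ?u)" by auto
    have m: "mset (list_diff (fst ?u) (arcs ?p)) + mset (arcs ?p) = mset (fst ?u)"
      using p(4) by (simp add: mset_list_diff)
    have "cut_out (mset (list_diff (fst ?u) (arcs ?p))) U + Suc j =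
        cut_in (mset (list_diff (fst ?u) (arcs ?p))) U + n" if U: "s \<in> U" "t \<notin> U" for U
      using arg_cong[OF m, of "\<lambda>A. cut_out A U"] arg_cong[OF m, of "\<lambda>A. cut_in A U"]
        cut_path[OF \<open>?p \<noteq> []\<close>, of U] IH(4)[OF U] U
      by (simp add: p)
    moreover have "mset (list_diff (fst ?u) (arcs ?p)) + (mset (arcs ?p) + (\<Sum>p\<leftarrow>snd ?u. mset (arcs p))) = mset F"
      unfolding add.assoc[symmetric] m by (rule IH(3))
    moreover have "(peel vs s t ^^ Suc j) (F, []) = (list_diff (fst ?u) (arcs ?p), ?p # snd ?u)"
      by (simp add: peel_def[of vs s t ?u])
    moreover have "\<forall>p\<in>set (?p # snd ?u). p \<noteq> [] \<and> distinct p \<and> hd p = s \<and> last p = t"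
      using IH(2) p \<open>?p \<noteq> []\<close> by simp
    ultimately show ?case using IH(1) by simp
  qed
  then show ?thesis by blast
qed

text \<open>Cuts are bounded by the requested value \<open>n\<close>, so maximality does not have to
  be discussed. For \<open>s = t\<close> nothing separates, the condition is vacuous, and all paths
  are \<open>[s]\<close>.\<close>

theorem max_flow_correct:
  assumes s: "s \<in> set vs" and D: "set D \<subseteq> set vs \<times> set vs"
    and cut: "\<forall>U. s \<in> U \<longrightarrow> t \<notin> U \<longrightarrow> n \<le> cut_out (mset D) U"
  shows "length (max_flow vs s t D n) = n"
    and "p \<in> set (max_flow vs s t D n) \<Longrightarrow> p \<noteq> [] \<and> distinct p \<and> hd p = s \<and> last p = t"
    and "(\<Sum>p\<leftarrow>max_flow vs s t D n. mset (arcs p)) \<subseteq># mset D"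
proof -
  define E where "E = (augment vs s t ^^ n) D"
  note E = augment_invariant[OF s D cut order_refl, folded E_def]
  define F where "F = list_diff D E"
  have mF: "mset F = mset D - mset E" by (simp add: F_def mset_list_diff)
  \<comment> \<open>The difference of the two networks cancels opposite units of flow. By the
    preserved joint counts, what the residual network has gained is the reversal of the net flow
    \<open>F\<close>.\<close>
  have swap: "mset E - mset D = image_mset prod.swap (mset F)"
  proof (rule multiset_eqI)
    fix a
    show "count (mset E - mset D) a = count (image_mset prod.swap (mset F)) a"
      using E(2)[of a] by (simp add: count_swap mF)
  qed
  have cutF: "cut_out (mset F) U = cut_in (mset F) U + n" if U: "s \<in> U" "t \<notin> U" for U
  proof -
    \<comment> \<open>Both sides take the larger of the two multiplicities of each arc.\<close>
    have "mset D + (mset E - mset D) = mset E + mset F"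
      by (rule multiset_eqI) (simp add: mF)
    from arg_cong[OF this, of "\<lambda>A. cut_out A U"] E(3)[OF U]
    show ?thesis by (simp add: swap cut_swap)
  qed
  have "set F \<subseteq> set vs \<times> set vs" using D set_list_diff[of D E] by (auto simp: F_def)
  then have *: "length (max_flow vs s t D n) = n \<and>
    (\<forall>p\<in>set (max_flow vs s t D n). p \<noteq> [] \<and> distinct p \<and> hd p = s \<and> last p = t) \<and>
    mset (fst ((peel vs s t ^^ n) (F, []))) + (\<Sum>p\<leftarrow>max_flow vs s t D n. mset (arcs p)) = mset F"
    unfolding max_flow_def E_def[symmetric] F_def[symmetric] 
    by (rule peel_invariant[OF s _ _ order_refl]) (use cutF in auto)
  then show "length (max_flow vs s t D n) = n"
    and "p \<in> set (max_flow vs s t D n) \<Longrightarrow> p \<noteq> [] \<and> distinct p \<and> hd p = s \<and> last p = t" by auto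
  from * have mF': "mset F = mset (fst ((peel vs s t ^^ n) (F, []))) + (\<Sum>p\<leftarrow>max_flow vs s t D n. mset (arcs p))"
    by simp
  have "(\<Sum>p\<leftarrow>max_flow vs s t D n. mset (arcs p)) \<subseteq># mset F"
    unfolding mF' by simp
  also have "mset F \<subseteq># mset D" by (simp add: mF)
  finally show "(\<Sum>p\<leftarrow>max_flow vs s t D n. mset (arcs p)) \<subseteq># mset D" .
qed

section \<open>The greedy algorithm with exponential edge weights\<close>

definition potential :: "nat \<Rightarrow> (nat \<times> nat) list \<Rightarrow> ('d \<times> nat list) list \<Rightarrow> nat" where
  "potential b reps sel = sum_list (map (\<lambda>e. b ^ load sel e) reps)"

lemma load_Cons: "load (c # sel) e = load sel e + of_bool (e \<in> set (pedges (snd c)))"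
  by (simp add: load_def)

text \<open>A new path multiplies the term of each of its edges by \<open>b\<close>; thus the
  cheapest candidate is the one that raises the potential least.\<close>

lemma potential_Cons:
  assumes "b > 0"
  shows "potential b reps (c # sel) = potential b reps sel + (b - 1) * path_cost b reps sel (snd c)"
proof (induction reps)
  case (Cons e reps)
  have "b ^ load (c # sel) e = b ^ load sel e + (b - 1) * (if e \<in> set (pedges (snd c)) then b ^ load sel e else 0)"
    using assms by (simp add: load_Cons algebra_simps)
  then show ?case using Cons by (simp add: potential_def path_cost_def algebra_simps)
qed (simp add: potential_def path_cost_def)

text \<open>Double counting: summed edge by edge, the total cost of \<open>Q\<close> is governed by
  the congestion of \<open>Q\<close>.\<close>

lemma sum_path_cost:
  "sum_list (map (\<lambda>c. path_cost b reps sel (snd c)) Q) =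
   sum_list (map (\<lambda>e. b ^ load sel e * length (filter (\<lambda>c. e \<in> set (pedges (snd c))) Q)) reps)"
proof (induction Q)
  case (Cons c Q)
  have "path_cost b reps sel (snd c) +
      sum_list (map (\<lambda>e. b ^ load sel e * length (filter (\<lambda>c. e \<in> set (pedges (snd c))) Q)) reps) =
      sum_list (map (\<lambda>e. b ^ load sel e * length (filter (\<lambda>c. e \<in> set (pedges (snd c))) (c # Q))) reps)"
    unfolding path_cost_def sum_list_addf[symmetric] by (intro arg_cong[of _ _ sum_list] map_cong) auto
  then show ?case using Cons by simp
qed simp

lemma greedy_Suc: "greedy b reps cap gen (Suc j) =
    greedy_step b reps cap (gen (greedy b reps cap gen j)) (greedy b reps cap gen j)"
  by (simp add: greedy_def)

lemma greedy_0: "greedy b reps cap gen 0 = []"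
  by (simp add: greedy_def)

lemma greedy_invariant:
  "distinct (map fst (greedy b reps cap gen n)) \<and> (\<forall>e. load (greedy b reps cap gen n) e \<le> cap) \<and>
   (\<forall>c\<in>set (greedy b reps cap gen n). \<exists>sel. c \<in> set (gen sel))"
proof (induction n)
  case 0
  then show ?case by (simp add: greedy_0 load_def)
next
  case (Suc n)
  let ?s = "greedy b reps cap gen n"
  show ?case
  proof (cases rule: greedy_step_cases[of b reps cap "gen ?s" ?s])
    case 1
    then show ?thesis using Suc by (simp add: greedy_Suc)
  next
    case (2 c)
    have "fst c \<notin> fst ` set ?s" using 2(3) unfolding usable_def by force
    moreover have "load (c # ?s) e \<le> cap" for e
    proof (cases "e \<in> set (pedges (snd c))")
      case True
      then have "load ?s e < cap" using 2(3) unfolding usable_def by blast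
      then show ?thesis by (simp add: load_Cons)
    next
      case False
      moreover have "load ?s e \<le> cap" using Suc by blast
      ultimately show ?thesis by (simp add: load_Cons)
    qed
    moreover have "\<exists>sel. c \<in> set (gen sel)" using 2(2) by blast
    ultimately show ?thesis using Suc 2(1) by (simp add: greedy_Suc)
  qed
qed

lemma length_filter_selected:
  assumes "\<forall>d. length (filter (\<lambda>c. fst c = d) Q) \<le> \<kappa>"
  shows "length (filter (\<lambda>c. \<exists>c'\<in>set sel. fst c' = fst c) Q) \<le> length sel * \<kappa>"
proof (induction sel)
  case (Cons s sel)
  have "length (filter (\<lambda>c. P c \<or> R c) Q) \<le> length (filter P Q) + length (filter R Q)" for P R
    by (induction Q) auto
  from this[of "\<lambda>c. fst s = fst c" "\<lambda>c. \<exists>c'\<in>set sel. fst c' = fst c"]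
  have "length (filter (\<lambda>c. fst s = fst c \<or> (\<exists>c'\<in>set sel. fst c' = fst c)) Q) \<le> \<kappa> + length sel * \<kappa>"
    using Cons assms[rule_format, of "fst s"] by (simp add: eq_commute[of "fst s"])
  then show ?case by simp
qed simp

text \<open>\<open>Q\<close> is a reference solution in which every demand has at most \<open>\<kappa>\<close> paths and every relevant edge is
  on at most \<open>\<lambda>\<close> of them. As long as at most half of it is blocked, an average remaining path of \<open>Q\<close>
  raises the potential by a factor of at most \<open>1 + 2 (b - 1) \<lambda> / |Q|\<close>.\<close>

lemma greedy_competitive:
  fixes Q :: "('d \<times> nat list) list"
  assumes b: "b \<ge> 2" and \<kappa>: "\<kappa> > 0" "\<forall>d. length (filter (\<lambda>c. fst c = d) Q) \<le> \<kappa>"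
    and lam: "\<forall>e\<in>set reps. length (filter (\<lambda>c. e \<in> set (pedges (snd c))) Q) \<le> lam"
    and rep: "\<forall>j. \<forall>c\<in>set Q. \<forall>e\<in>set (pedges (snd c)). \<exists>e'\<in>set reps.
      load (greedy b reps cap gen j) e' = load (greedy b reps cap gen j) e"
    and gen: "\<forall>j. \<forall>c\<in>set Q. usable cap (greedy b reps cap gen j) c \<longrightarrow>
      (\<exists>c'\<in>set (gen (greedy b reps cap gen j)). usable cap (greedy b reps cap gen j) c' \<and>
         path_cost b reps (greedy b reps cap gen j) (snd c') \<le> path_cost b reps (greedy b reps cap gen j) (snd c))"
    and cap: "real (length reps) * exp (real (b - 1) * real lam / real \<kappa>) < real b ^ cap"
    and n: "length Q \<le> n"
  shows "length Q \<le> 2 * \<kappa> * length (greedy b reps cap gen n)"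
proof (rule ccontr)
  define S where "S j = greedy b reps cap gen j" for j
  define T where "T = length Q"
  define \<rho> where "\<rho> = 2 * real (b - 1) * real lam / real T"
  define N where "N = real (length reps)"
  assume "\<not> length Q \<le> 2 * \<kappa> * length (greedy b reps cap gen n)"
  then have neg: "2 * \<kappa> * length (S n) < T" by (simp add: S_def T_def)
  then have T: "T > 0" by linarith
  have "length (S j) \<le> length (S (Suc j))" for j
    by (cases rule: greedy_step_cases[of b reps cap "gen (S j)" "S j"]) (auto simp: S_def greedy_Suc)
  then have mono: "length (S i) \<le> length (S j)" if "i \<le> j" for i j
    using that by (rule lift_Suc_mono_le[of "\<lambda>j. length (S j)"])
  have \<rho>: "\<rho> \<ge> 0" unfolding \<rho>_def by simp
  \<comment> \<open>The contradiction to come: if the result were too short, the selection could not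
    stall, and each of the \<open>n\<close> rounds would add a path.\<close>
  have claim: "length (S j) = j \<and> real (potential b reps (S j)) \<le> N * (1 + \<rho>) ^ j" if "j \<le> n" for j
    using that
  proof (induction j)
    case 0
    have "potential b reps ([] :: ('d \<times> nat list) list) = length reps" by (induction reps) (auto simp: potential_def load_def)
    then show ?case by (simp add: S_def greedy_0 N_def)
  next
    case (Suc j)
    let ?pot = "potential b reps (S j)"
    have len: "length (S j) = j" and pot: "real ?pot \<le> N * (1 + \<rho>) ^ j" using Suc by auto
    have "2 * \<kappa> * length (S j) \<le> 2 * \<kappa> * length (S n)"
      using mono[of j n] Suc.prems by (intro mult_left_mono) auto
    then have small: "2 * \<kappa> * j < T" using neg unfolding len by (rule order_le_less_trans)
    have "(1 + \<rho>) ^ j \<le> exp \<rho> ^ j" using \<rho> by (intro power_mono exp_ge_add_one_self) auto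
    also have "\<dots> = exp (\<rho> * real j)" by (metis exp_of_nat_mult mult.commute)
    \<comment> \<open>The bound \<open>2 * \<kappa> * j < T\<close> removes \<open>T\<close> from
      the exponent \<open>\<rho> * j\<close>.\<close>
    also have "\<dots> \<le> exp (real (b - 1) * real lam / real \<kappa>)"
    proof -
      have "real (2 * \<kappa> * j) \<le> real T" using small by (simp only: of_nat_le_iff)
      then have "2 * real j / real T \<le> 1 / real \<kappa>" using T \<kappa>(1) by (simp add: field_simps)
      from mult_left_mono[OF this, of "real (b - 1) * real lam"]
      have "\<rho> * real j \<le> real (b - 1) * real lam / real \<kappa>" by (simp add: \<rho>_def field_simps)
      then show ?thesis by simp
    qed
    finally have "N * (1 + \<rho>) ^ j \<le> N * exp (real (b - 1) * real lam / real \<kappa>)"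
      by (intro mult_left_mono) (auto simp: N_def)
    then have "real ?pot < real b ^ cap" using pot cap unfolding N_def by linarith
    then have pot_less: "?pot < b ^ cap" by (simp only: of_nat_power[symmetric] of_nat_less_iff)
    \<comment> \<open>An edge of load \<open>cap\<close> would contribute \<open>b ^ cap\<close> to
      the potential all by itself.\<close>
    have loads: "load (S j) e < cap" if "e \<in> set reps" for e
    proof -
      have "b ^ load (S j) e \<le> ?pot"
        unfolding potential_def by (rule member_le_sum_list) (use that in auto)
      with pot_less have "b ^ load (S j) e < b ^ cap" by linarith
      then show ?thesis using b power_less_imp_less_exp[of b "load (S j) e" cap] by simp
    qed
    \<comment> \<open>The paths of \<open>Q\<close> with an open demand. The \<open>j\<close>
      selected demands block at most \<open>\<kappa>\<close> paths each, which leaves at least half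
      of \<open>Q\<close>.\<close>
    define Q' where "Q' = filter (\<lambda>c. \<not> (\<exists>c'\<in>set (S j). fst c' = fst c)) Q"
    have "length (filter (\<lambda>c. \<exists>c'\<in>set (S j). fst c' = fst c) Q) + length Q' = T"
      unfolding Q'_def T_def by (rule sum_length_filter_compl)
    with length_filter_selected[OF \<kappa>(2), of "S j", unfolded len] have "T \<le> j * \<kappa> + length Q'"
      by linarith
    moreover have "2 * (j * \<kappa>) < T" using small by (simp only: mult.assoc mult.commute[of \<kappa> j])
    ultimately have Q'2: "T \<le> 2 * length Q'" by linarith
    have us: "usable cap (S j) c" if c: "c \<in> set Q'" for c
    proof -
      have "c \<in> set Q" "\<forall>c'\<in>set (S j). fst c' \<noteq> fst c" using c by (auto simp: Q'_def)
      moreover have "load (S j) e < cap" if "e \<in> set (pedges (snd c))" for e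
      proof -
        from rep[THEN spec, of j, THEN bspec, OF \<open>c \<in> set Q\<close>, THEN bspec, OF that, folded S_def]
        obtain e' where "e' \<in> set reps" "load (S j) e' = load (S j) e" ..
        with loads[of e'] show ?thesis by simp
      qed
      ultimately show ?thesis by (simp add: usable_def)
    qed
    let ?cost = "\<lambda>c. path_cost b reps (S j) (snd c)"
    have "sum_list (map ?cost Q') \<le> lam * ?pot"
    proof -
      have "sum_list (map ?cost Q') \<le>
          sum_list (map (\<lambda>e. b ^ load (S j) e * lam) reps)"
        unfolding sum_path_cost
      proof (rule sum_list_mono)
        fix e assume "e \<in> set reps"
        have "length (filter (\<lambda>c. e \<in> set (pedges (snd c))) Q') \<le>
            length (filter (\<lambda>c. e \<in> set (pedges (snd c))) Q)"
          unfolding Q'_def by (induction Q) auto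
        also have "\<dots> \<le> lam" by (rule lam[THEN bspec, OF \<open>e \<in> set reps\<close>])
        finally show "b ^ load (S j) e * length (filter (\<lambda>c. e \<in> set (pedges (snd c))) Q') \<le> b ^ load (S j) e * lam"
          by (rule mult_left_mono) simp
      qed
      then show ?thesis by (simp add: sum_list_mult_const potential_def) (simp add: mult.commute)
    qed
    moreover have "Q' \<noteq> []" using Q'2 T by auto
    then obtain c cs where am: "argmin ?cost Q' = c # cs"
      using argmin_Nil_iff[of ?cost Q'] by (cases "argmin ?cost Q'") auto
    have c: "c \<in> set Q'" "\<forall>c'\<in>set Q'. ?cost c \<le> ?cost c'"
      using argmin_ConsD(2)[OF am] argmin_ConsD(3)[OF am] by auto
    have "length Q' * ?cost c \<le> sum_list (map ?cost Q')"
      using sum_list_mono[of Q' "\<lambda>_. ?cost c" ?cost] c(2) by (simp add: sum_list_triv)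
    ultimately have cost_c: "length Q' * ?cost c \<le> lam * ?pot" by linarith
    have "c \<in> set Q" using c(1) by (simp add: Q'_def)
    from gen[THEN spec, of j, THEN bspec, OF this, folded S_def, THEN mp, OF us[OF c(1)]] obtain c' where
      c': "c' \<in> set (gen (S j))" "usable cap (S j) c'" "?cost c' \<le> ?cost c" by (elim bexE conjE)
    show ?case
    proof (cases rule: greedy_step_cases[of b reps cap "gen (S j)" "S j"])
      case 1
      then have False using c'(1,2) by (auto simp: filter_empty_conv)
      then show ?thesis ..
    next
      case (2 x)
      have Sx: "S (Suc j) = x # S j" using 2(1) by (simp add: S_def greedy_Suc)
      have xc: "?cost x \<le> ?cost c" using 2(4)[OF c'(1,2)] c'(3) by linarith
      have "T * ?cost x \<le> (2 * length Q') * ?cost c" by (rule mult_mono[OF Q'2 xc]) auto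
      also have "\<dots> \<le> 2 * (lam * ?pot)" using cost_c by simp
      finally have "real (T * ?cost x) \<le> real (2 * (lam * ?pot))" by (simp only: of_nat_le_iff)
      then have "real (?cost x) \<le> 2 * real lam * real ?pot / real T"
        using T by (simp add: field_simps)
      from mult_left_mono[OF this, of "real (b - 1)"]
      have "real (b - 1) * real (?cost x) \<le> \<rho> * real ?pot" by (simp add: \<rho>_def field_simps)
      moreover have "real (potential b reps (S (Suc j))) = real ?pot + real (b - 1) * real (?cost x)"
        unfolding Sx using b by (subst potential_Cons) auto
      ultimately have "real (potential b reps (S (Suc j))) \<le> (1 + \<rho>) * real ?pot"
        by (simp add: algebra_simps)
      also have "\<dots> \<le> (1 + \<rho>) * (N * (1 + \<rho>) ^ j)" using pot \<rho> by (intro mult_left_mono) auto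
      finally show ?thesis using Sx len by (simp add: algebra_simps)
    qed
  qed
  \<comment> \<open>All \<open>n \<ge> T\<close> rounds have selected a path, although fewer than
    \<open>T / (2 * \<kappa>)\<close> paths were assumed to be selected.\<close>
  from claim[of n] have "length (S n) = n" by simp
  with neg have "2 * \<kappa> * n < T" by simp
  moreover have "T \<le> n" using n by (simp add: T_def)
  moreover have "n \<le> 2 * \<kappa> * n" using \<kappa>(1) by simp
  ultimately show False by linarith
qed

subsection \<open>The fractional solution\<close>

definition simple_list_graph :: "nat list \<Rightarrow> (nat \<times> nat) list \<Rightarrow> bool" where
  "simple_list_graph vs es \<longleftrightarrow> distinct (map norm_edge es) \<and> set es \<subseteq> set vs \<times> set vs"

definition walk_in :: "(nat \<times> nat) list \<Rightarrow> nat \<times> nat \<Rightarrow> nat list \<Rightarrow> bool" where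
  "walk_in es st p \<longleftrightarrow> p \<noteq> [] \<and> distinct p \<and> (hd p, last p) = st \<and>
     (\<forall>a\<in>set (arcs p). a \<in> set es \<or> prod.swap a \<in> set es)"

lemma norm_edge_eq_iff: "norm_edge a = norm_edge a' \<longleftrightarrow> a = a' \<or> a = prod.swap a'"
  by (cases a; cases a') (auto simp: norm_edge_def)

lemma norm_edge_swap: "norm_edge (prod.swap a) = norm_edge a"
  by (simp add: norm_edge_eq_iff)

text \<open>Each vertex occurs once, so an edge is traversed in one direction only. Hence a path has
  no repeated edges, and loads can be counted direction by direction.\<close>

lemma arcs_asym: "distinct p \<Longrightarrow> a \<in> set (arcs p) \<Longrightarrow> prod.swap a \<notin> set (arcs p)"
proof (induction p)
  case (Cons x p)
  show ?case
  proof (cases p)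
    case (Cons y q)
    have "fst b \<noteq> x \<and> snd b \<noteq> x" if "b \<in> set (arcs (y # q))" for b
      using set_arcs[OF that] \<open>distinct (x # p)\<close> Cons by auto
    then show ?thesis
      using Cons.IH Cons.prems \<open>p = y # q\<close> by (cases a) (auto simp: prod.swap_def, blast+)
  qed (use Cons.prems in simp)
qed simp

lemma distinct_pedges: "distinct p \<Longrightarrow> distinct (pedges p)"
  unfolding pedges_def distinct_map
  by (auto simp: distinct_arcs inj_on_def norm_edge_eq_iff dest: arcs_asym)

lemma walk_in_pedges: "walk_in es st p \<Longrightarrow> set (pedges p) \<subseteq> set (map norm_edge es)"
proof
  fix e assume "walk_in es st p" "e \<in> set (pedges p)"
  then obtain a where "e = norm_edge a" "a \<in> set es \<or> prod.swap a \<in> set es"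
    unfolding walk_in_def pedges_def by auto
  then show "e \<in> set (map norm_edge es)" using norm_edge_swap[of a] by (metis image_eqI set_map)
qed

text \<open>The link between the cost minimised by the greedy selection and the length minimised by
  \<open>shortest_path\<close>.\<close>

lemma path_cost_arcs:
  assumes "distinct reps" and "distinct p" and "set (pedges p) \<subseteq> set reps"
  shows "path_cost b reps sel p = sum_list (map (\<lambda>a. b ^ load sel (norm_edge a)) (arcs p))"
proof -
  have "path_cost b reps sel p = (\<Sum>e\<in>set reps. if e \<in> set (pedges p) then b ^ load sel e else 0)"
    unfolding path_cost_def by (rule sum_list_distinct_conv_sum_set[OF assms(1)])
  also have "\<dots> = (\<Sum>e\<in>set (pedges p). b ^ load sel e)"
    using assms(3) by (simp add: sum.inter_restrict[symmetric] Int_absorb1)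
  also have "\<dots> = sum_list (map (\<lambda>e. b ^ load sel e) (pedges p))"
    by (rule sum_list_distinct_conv_sum_set[symmetric]) (rule distinct_pedges[OF assms(2)])
  finally show ?thesis by (simp add: pedges_def comp_def)
qed

lemma demands_iff: "x \<in> set (demands es M) \<longleftrightarrow> (\<exists>i<length M. \<exists>c<copies es. x = ((i, c), M ! i))"
proof
  assume "x \<in> set (demands es M)"
  then obtain c d where c: "c < copies es" "d \<in> set (zip [0..<length M] M)" "x = ((fst d, c), snd d)"
    unfolding demands_def by auto
  from c(2) obtain i where "i < length M" "d = (i, M ! i)" by (auto simp: set_zip)
  with c show "\<exists>i<length M. \<exists>c<copies es. x = ((i, c), M ! i)" by auto
next
  assume "\<exists>i<length M. \<exists>c<copies es. x = ((i, c), M ! i)"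
  then obtain i c where i: "i < length M" "c < copies es" "x = ((i, c), M ! i)" by blast
  have "(i, M ! i) \<in> set (zip [0..<length M] M)" using i(1) by (auto simp: set_zip intro: exI[of _ i])
  then have "x \<in> set (map (\<lambda>d. ((fst d, c), snd d)) (zip [0..<length M] M))" using i(3) by force
  then show "x \<in> set (demands es M)" using i(2) unfolding demands_def by auto
qed

lemma length_demands: "length (demands es M) = copies es * length M"
  by (simp add: demands_def length_concat comp_def sum_list_triv)

section \<open>The fractional solution compared with an edge-disjoint routing\<close>

context
  fixes vs es M
  assumes graph: "simple_list_graph vs es" and terminals: "set M \<subseteq> set vs \<times> set vs"
begin

text \<open>This supplies the condition of \<open>greedy_competitive\<close> on the generator: a
  usable path of the reference solution may be replaced by the computed path of the same
  demand.\<close>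

lemma shortest_demand_path:
  fixes sel :: "('d \<times> nat list) list" and cap :: nat
  assumes "i < length M"
  defines "p \<equiv> shortest_path vs (weighted_arcs cap es sel) (fst (M ! i)) (snd (M ! i))"
  shows "p \<noteq> [] \<Longrightarrow> walk_in es (M ! i) p \<and> (\<forall>e\<in>set (pedges p). load sel e < cap)"
    and "walk_in es (M ! i) q \<Longrightarrow> \<forall>e\<in>set (pedges q). load sel e < cap \<Longrightarrow>
      p \<noteq> [] \<and> path_cost 2 (map norm_edge es) sel p \<le> path_cost 2 (map norm_edge es) sel q"
proof -
  let ?as = "weighted_arcs cap es sel" and ?f = "\<lambda>a. (2 :: nat) ^ load sel (norm_edge a)"
  have iff: "(a, ?f a) \<in> set ?as \<longleftrightarrow> (a \<in> set es \<or> prod.swap a \<in> set es) \<and> load sel (norm_edge a) < cap" for a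
    using set_weighted_arcs[of a "?f a" cap es sel] by (simp add: prod.swap_def)
  have s: "fst (M ! i) \<in> set vs" using subsetD[OF terminals nth_mem[OF assms(1)]] by (simp add: mem_Times_iff)
  have as: "\<forall>x\<in>set ?as. snd x = ?f (fst x) \<and> snd x > 0 \<and> snd (fst x) \<in> set vs"
  proof
    fix x assume "x \<in> set ?as"
    then have "fst x \<in> set es \<or> (snd (fst x), fst (fst x)) \<in> set es" "snd x = ?f (fst x)"
      using set_weighted_arcs[of "fst x" "snd x" cap es sel] by auto
    moreover from this(1) have "snd (fst x) \<in> set vs" using graph unfolding simple_list_graph_def by auto
    ultimately show "snd x = ?f (fst x) \<and> snd x > 0 \<and> snd (fst x) \<in> set vs" by simp
  qed
  note sp = shortest_path_correct[where s = "fst (M ! i)" and vs = vs and as = ?as and f = ?f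
      and t = "snd (M ! i)", OF s as, folded p_def]
  show 1: "walk_in es (M ! i) p \<and> (\<forall>e\<in>set (pedges p). load sel e < cap)" if "p \<noteq> []"
    using sp(1)[OF that] that unfolding walk_in_def pedges_def by (simp add: iff)
  show "p \<noteq> [] \<and> path_cost 2 (map norm_edge es) sel p \<le> path_cost 2 (map norm_edge es) sel q"
    if q: "walk_in es (M ! i) q" "\<forall>e\<in>set (pedges q). load sel e < cap"
  proof -
    have q': "q \<noteq> []" "hd q = fst (M ! i)" "last q = snd (M ! i)" "distinct q"
      using q(1) unfolding walk_in_def by (auto simp: prod_eq_iff)
    have "\<forall>a\<in>set (arcs q). (a, ?f a) \<in> set ?as"
      using q unfolding walk_in_def pedges_def by (simp add: iff)
    from sp(2)[OF q'(1-3) this] have p: "p \<noteq> []"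
      "sum_list (map ?f (arcs p)) \<le> sum_list (map ?f (arcs q))" by auto
    have d: "distinct (map norm_edge es)" using graph by (simp add: simple_list_graph_def)
    have w: "walk_in es (M ! i) p" using 1[OF p(1)] by simp
    then have "distinct p" by (simp add: walk_in_def)
    from path_cost_arcs[OF d this walk_in_pedges[OF w], of 2 sel]
      path_cost_arcs[OF d q'(4) walk_in_pedges[OF q(1)], of 2 sel] p
    show ?thesis by simp
  qed
qed

lemma fractional_sound:
  shows "distinct (map fst (fractional vs es M))"
    and "load (fractional vs es M) e \<le> 3 * copies es"
    and "c \<in> set (fractional vs es M) \<Longrightarrow>
      fst (fst c) < length M \<and> snd (fst c) < copies es \<and> walk_in es (M ! fst (fst c)) (snd c)"
proof -
  note inv = greedy_invariant[of 2 "map norm_edge es" "3 * copies es" "routed_demands vs es M"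
      "length (demands es M)", folded fractional_def]
  show "distinct (map fst (fractional vs es M))" "load (fractional vs es M) e \<le> 3 * copies es"
    using inv by blast+
  assume "c \<in> set (fractional vs es M)"
  then obtain sel where "c \<in> set (routed_demands vs es M sel)" using inv by blast
  then obtain d where d: "d \<in> set (demands es M)" "snd c \<noteq> []" "c = (fst d,
     shortest_path vs (weighted_arcs (3 * copies es) es sel) (fst (snd d)) (snd (snd d)))"
    unfolding routed_demands_def by auto
  from d(1) obtain i j where i: "i < length M" "j < copies es" "d = ((i, j), M ! i)"
    unfolding demands_iff by blast
  have "snd c = shortest_path vs (weighted_arcs (3 * copies es) es sel) (fst (M ! i)) (snd (M ! i))"
    using d(3) i(3) by simp
  from shortest_demand_path(1)[OF i(1), of "3 * copies es" sel, folded this] d(2)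
  have "walk_in es (M ! i) (snd c)" by blast
  then show "fst (fst c) < length M \<and> snd (fst c) < copies es \<and> walk_in es (M ! fst (fst c)) (snd c)"
    using d(3) i by simp
qed

lemma fractional_competitive:
  assumes I: "finite I" "I \<subseteq> {..<length M}" and q: "\<forall>i\<in>I. walk_in es (M ! i) (q i)"
    and disj: "\<forall>i\<in>I. \<forall>j\<in>I. i \<noteq> j \<longrightarrow> set (pedges (q i)) \<inter> set (pedges (q j)) = {}"
  shows "copies es * card I \<le> 2 * length (fractional vs es M)"
proof -
  \<comment> \<open>The reference solution repeats the disjoint routing \<open>copies es\<close>
    times. It has one path per label, so \<open>\<kappa> = 1\<close>, and at most
    \<open>copies es\<close> paths on an edge.\<close>
  define P where "P = List.product (sorted_list_of_set I) [0..<copies es]"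
  define Q where "Q = map (\<lambda>d. (d, q (fst d))) P"
  have setP: "set P = I \<times> {..<copies es}" using I(1) by (auto simp: P_def)
  have distP: "distinct P" using I(1) by (simp add: P_def distinct_product)
  have lenQ: "length Q = copies es * card I" using I(1) by (simp add: Q_def P_def)
  have filterQ: "length (filter R Q) = card {d \<in> set P. R (d, q (fst d))}" for R
    using distP by (simp add: Q_def filter_map comp_def distinct_card[symmetric])
  have "length Q \<le> 2 * 1 * length (fractional vs es M)"
    unfolding fractional_def
  proof (rule greedy_competitive[where lam = "copies es"])
    show "\<forall>d. length (filter (\<lambda>c. fst c = d) Q) \<le> 1"
    proof
      fix d
      have "card {d' \<in> set P. fst (d', q (fst d')) = d} \<le> card {d}" by (rule card_mono) auto
      then show "length (filter (\<lambda>c. fst c = d) Q) \<le> 1" by (simp add: filterQ)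
    qed
    show "\<forall>e\<in>set (map norm_edge es). length (filter (\<lambda>c. e \<in> set (pedges (snd c))) Q) \<le> copies es"
    proof
      fix e
      have "\<exists>i0. {d \<in> set P. e \<in> set (pedges (q (fst d)))} \<subseteq> {i0} \<times> {..<copies es}"
      proof (cases "\<exists>i\<in>I. e \<in> set (pedges (q i))")
        case True
        then obtain i0 where "i0 \<in> I" "e \<in> set (pedges (q i0))" by blast
        then have "i = i0" if "i \<in> I" "e \<in> set (pedges (q i))" for i
          using disj that by blast
        then show ?thesis unfolding setP by (intro exI[of _ i0]) auto
      next
        case False
        then show ?thesis unfolding setP by auto
      qed
      then obtain i0 where "{d \<in> set P. e \<in> set (pedges (q (fst d)))} \<subseteq> {i0} \<times> {..<copies es}" by blast
      from card_mono[OF _ this] show "length (filter (\<lambda>c. e \<in> set (pedges (snd c))) Q) \<le> copies es"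
        by (simp add: filterQ)
    qed
    let ?S = "greedy 2 (map norm_edge es) (3 * copies es) (routed_demands vs es M)"
    show "\<forall>j. \<forall>c\<in>set Q. \<forall>e\<in>set (pedges (snd c)). \<exists>e'\<in>set (map norm_edge es). load (?S j) e' = load (?S j) e"
    proof (intro allI ballI)
      fix j c e assume "c \<in> set Q" "e \<in> set (pedges (snd c))"
      then obtain i where i: "i \<in> I" "snd c = q i" by (auto simp: Q_def setP)
      from subsetD[OF walk_in_pedges[OF q[THEN bspec, OF i(1)]]] \<open>e \<in> set (pedges (snd c))\<close>
      have "e \<in> set (map norm_edge es)" unfolding i(2) by blast
      then show "\<exists>e'\<in>set (map norm_edge es). load (?S j) e' = load (?S j) e" by blast
    qed
    show "\<forall>j. \<forall>c\<in>set Q. usable (3 * copies es) (?S j) c \<longrightarrow>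
      (\<exists>c'\<in>set (routed_demands vs es M (?S j)). usable (3 * copies es) (?S j) c' \<and>
        path_cost 2 (map norm_edge es) (?S j) (snd c') \<le> path_cost 2 (map norm_edge es) (?S j) (snd c))"
    proof (intro allI ballI impI)
      fix j c assume c: "c \<in> set Q" and us: "usable (3 * copies es) (?S j) c"
      from c obtain i r where i: "i \<in> I" "r < copies es" "c = ((i, r), q i)" by (auto simp: Q_def setP)
      have iM: "i < length M" using i(1) I(2) by auto
      let ?p = "shortest_path vs (weighted_arcs (3 * copies es) es (?S j)) (fst (M ! i)) (snd (M ! i))"
      have "\<forall>e\<in>set (pedges (q i)). load (?S j) e < 3 * copies es" using us i(3) by (simp add: usable_def)
      from shortest_demand_path(2)[OF iM q[THEN bspec, OF i(1)] this]
      have p: "?p \<noteq> []" "path_cost 2 (map norm_edge es) (?S j) ?p \<le> path_cost 2 (map norm_edge es) (?S j) (q i)"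
        by simp_all
      have "\<forall>e\<in>set (pedges ?p). load (?S j) e < 3 * copies es"
        using shortest_demand_path(1)[OF iM p(1)] by simp
      then have us': "usable (3 * copies es) (?S j) ((i, r), ?p)" using us i(3) by (simp add: usable_def)
      have "((i, r), M ! i) \<in> set (demands es M)" using iM i(2) by (auto simp: demands_iff)
      then have "((i, r), ?p) \<in> set (routed_demands vs es M (?S j))"
        using p(1) unfolding routed_demands_def set_filter set_map
        by (intro CollectI conjI image_eqI[of _ _ "((i, r), M ! i)"]) simp_all
      with us' p(2) i(3) show "\<exists>c'\<in>set (routed_demands vs es M (?S j)). usable (3 * copies es) (?S j) c' \<and>
          path_cost 2 (map norm_edge es) (?S j) (snd c') \<le> path_cost 2 (map norm_edge es) (?S j) (snd c)"
        by (intro bexI[of _ "((i, r), ?p)"]) simp_all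
    qed
    \<comment> \<open>Origin of the capacity \<open>3 * copies es\<close>: the number of edges is
      below \<open>2 ^ copies es\<close>, and the exponential is below
      \<open>4 ^ copies es\<close>.\<close>
    have "real (length es) * exp (real (copies es)) < 2 ^ copies es * 4 ^ copies es"
    proof (rule mult_strict_mono')
      have "length es < 2 ^ length es" by (rule less_exp)
      also have "\<dots> \<le> 2 ^ copies es" by (simp add: copies_def)
      finally have "length es < 2 ^ copies es" .
      then show "real (length es) < 2 ^ copies es" 
        by (simp add: of_nat_less_numeral_power_cancel_iff)
      have "exp (real (copies es)) = exp 1 ^ copies es" by (metis exp_of_nat_mult mult.right_neutral)
      also have "\<dots> < 4 ^ copies es"
        by (rule power_strict_mono) (use exp_le in \<open>auto simp: copies_def\<close>)
      finally show "exp (real (copies es)) < 4 ^ copies es" .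
    qed auto
    also have "\<dots> = 2 ^ (3 * copies es)" by (simp add: power_mult flip: power_mult_distrib)
    finally show "real (length (map norm_edge es)) * exp (real (2 - 1) * real (copies es) / real 1) <
        real 2 ^ (3 * copies es)" by simp
    have "card I \<le> length M" using card_mono[OF _ I(2)] by simp
    then show "length Q \<le> length (demands es M)" by (simp add: lenQ length_demands)
  qed auto
  then show ?thesis by (simp add: lenQ)
qed

end

subsection \<open>Properties of the candidate paths\<close>

lemma dedup_snoc: "dedup key (xs @ [y]) =
    (if \<exists>z\<in>set (dedup key xs). key z = key y then dedup key xs else y # dedup key xs)"
  by (simp add: dedup_def)

lemma dedup_props:
  "set (dedup key xs) \<subseteq> set xs \<and> key ` set (dedup key xs) = key ` set xs \<and> distinct (map key (dedup key xs))"
proof (induction xs rule: rev_induct)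
  case Nil
  then show ?case by (simp add: dedup_def)
next
  case (snoc y xs)
  show ?case
  proof (cases "\<exists>z\<in>set (dedup key xs). key z = key y")
    case True
    then have "key y \<in> key ` set (dedup key xs)" by (elim bexE) (erule subst, rule imageI)
    then show ?thesis using snoc True by (auto simp: dedup_snoc)
  next
    case False
    then have "key y \<notin> key ` set (dedup key xs)" by force
    then show ?thesis using snoc False by (auto simp: dedup_snoc)
  qed
qed

lemma count_distinct: "distinct xs \<Longrightarrow> count (mset xs) a = of_bool (a \<in> set xs)"
  by (simp add: distinct_count_atmost_1)

lemma copies_pos: "copies es > 0"
  by (simp add: copies_def)

lemma length_filter_upt: "length (filter P [0..<n]) = card {j. j < n \<and> P j}"
  by (subst length_filter_conv_card) (rule arg_cong[of _ _ card], auto)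

lemma length_scaled:
  "length (scaled es M c) = min (length M) ((length M * c + copies es - 1) div copies es)"
proof -
  have "j * K < x \<longleftrightarrow> j < (x + K - 1) div K" if "K > 0" for j K x :: nat
  proof -
    have "j < (x + K - 1) div K \<longleftrightarrow> Suc j * K \<le> x + K - 1"
      using less_eq_div_iff_mult_less_eq[OF that, of "Suc j" "x + K - 1"] by (simp add: Suc_le_eq)
    also have "\<dots> \<longleftrightarrow> j * K < x" using that by auto
    finally show ?thesis by simp
  qed
  from this[OF copies_pos]
  have "{j. j < length M \<and> j * copies es < length M * c} =
      {..<min (length M) ((length M * c + copies es - 1) div copies es)}" by auto
  then show ?thesis unfolding scaled_def length_filter_upt by simp
qed

text \<open>Rounding up is subadditive. This is why capacities are rounded up: no cut falls below
  the rounded value of the flow.\<close>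

lemma ceil_div_subadd:
  fixes x y K :: nat
  assumes "K > 0"
  shows "(x + y + K - 1) div K \<le> (x + K - 1) div K + (y + K - 1) div K"
proof -
  have c: "z \<le> (z + K - 1) div K * K" for z
  proof -
    have "z + K - 1 = (z + K - 1) div K * K + (z + K - 1) mod K" by simp
    moreover have "(z + K - 1) mod K < K" using assms by simp
    ultimately show ?thesis using assms by linarith
  qed
  let ?a = "(x + K - 1) div K" and ?b = "(y + K - 1) div K"
  have "x + y \<le> (?a + ?b) * K" using c[of x] c[of y] by (simp add: add_mult_distrib)
  then have "x + y + K - 1 < Suc (?a + ?b) * K" using assms by simp
  then have "(x + y + K - 1) div K < Suc (?a + ?b)" using assms by (simp add: div_less_iff_less_mult)
  then show ?thesis by simp
qed

lemma scaled_subadd: "length (scaled es M (c + d)) \<le> length (scaled es M c) + length (scaled es M d)"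
  using ceil_div_subadd[OF copies_pos, of "length M * c" "length M * d" es]
  by (simp add: length_scaled distrib_left)

lemma scaled_0: "length (scaled es M 0) = 0"
  using copies_pos[of es] by (simp add: length_scaled)

lemma scaled_sum:
  "finite A \<Longrightarrow> length (scaled es M (\<Sum>a\<in>A. f a)) \<le> (\<Sum>a\<in>A. length (scaled es M (f a)))"
proof (induction A rule: finite_induct)
  case empty
  then show ?case by (simp add: scaled_0)
next
  case (insert a A)
  then show ?case using scaled_subadd[of es M "f a" "\<Sum>a\<in>A. f a"] by simp
qed

lemma scaled_mono: "c \<le> d \<Longrightarrow> length (scaled es M c) \<le> length (scaled es M d)"
  unfolding length_scaled by (intro min.mono div_le_mono diff_le_mono add_le_mono mult_le_mono) auto

lemma scaled_le: "length (scaled es M c) \<le> length M"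
  by (simp add: length_scaled)

lemma scaled_upper: "copies es * length (scaled es M c) \<le> length M * c + copies es"
proof -
  have "copies es * length (scaled es M c) \<le> copies es * ((length M * c + copies es - 1) div copies es)"
    by (rule mult_le_mono2) (simp add: length_scaled)
  also have "\<dots> \<le> length M * c + copies es - 1" by (rule times_div_less_eq_dividend)
  finally show ?thesis by simp
qed

text \<open>With at most \<open>copies es\<close> paths for a pair, the scaled number is at most
  \<open>length M\<close>, and the cutoff built into \<open>scaled\<close> loses nothing.\<close>

lemma scaled_lower:
  assumes "c \<le> copies es"
  shows "length M * c \<le> copies es * length (scaled es M c)"
proof -
  have "length M * c \<le> copies es * ((length M * c + copies es - 1) div copies es)"
  proof -
    let ?z = "length M * c + copies es - 1"
    have "?z = copies es * (?z div copies es) + ?z mod copies es" by simp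
    moreover have "?z mod copies es < copies es" using copies_pos by simp
    ultimately show ?thesis using copies_pos[of es] by linarith
  qed
  moreover have "length M * c \<le> copies es * length M" using assms by (simp add: mult.commute)
  ultimately show ?thesis unfolding length_scaled by (simp add: min_def)
qed

lemma count_network:
  "count (mset (network es M al)) a = length (scaled es M (count (mset al) a))"
proof -
  have *: "count (mset (concat (map (\<lambda>j. filter (P j) X) js))) a = length (filter (\<lambda>j. P j a) js) * count (mset X) a"
    for P :: "nat \<Rightarrow> nat \<times> nat \<Rightarrow> bool" and X js
    by (induction js) auto
  have cnt: "length (filter (\<lambda>a'. a' = a) al) = count (mset al) a" for a
    by (induction al) auto
  have d: "distinct (dedup (\<lambda>a. a) al)" "set (dedup (\<lambda>a. a) al) = set al"
    using dedup_props[of "\<lambda>a. a" al] by auto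
  show ?thesis
  proof (cases "a \<in> set al")
    case True
    then have "count (mset (dedup (\<lambda>a. a) al)) a = 1" using count_distinct[OF d(1)] d(2) by simp
    then show ?thesis unfolding network_def * cnt scaled_def by simp
  next
    case False
    then have c0: "count (mset al) a = 0" by (simp add: count_eq_zero_iff)
    show ?thesis unfolding network_def * cnt scaled_def c0 by simp
  qed
qed

lemma size_sum_superset:
  assumes "finite A" and "set_mset N \<subseteq> A"
  shows "size N = (\<Sum>a\<in>A. count N a)"
  unfolding size_multiset_overloaded_eq
  by (rule sum.mono_neutral_left) (use assms in \<open>auto simp: count_eq_zero_iff\<close>)

text \<open>Every path of \<open>ps\<close> crosses the cut, and rounding up arc by arc gives at
  least as much as rounding up the total. So the network admits an integral flow of the rounded
  value.\<close>

lemma network_cut: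
  assumes ps: "\<forall>p\<in>set ps. p \<noteq> [] \<and> hd p = s \<and> last p = t" and U: "s \<in> U" "t \<notin> U"
  shows "length (scaled es M (length ps)) \<le> cut_out (mset (network es M (concat (map arcs ps)))) U"
proof -
  let ?al = "concat (map arcs ps)" and ?P = "\<lambda>a. fst a \<in> U \<and> snd a \<notin> U"
  let ?A = "{a \<in> set ?al. ?P a}"
  have "length ps \<le> cut_out (mset ?al) U"
    using ps
  proof (induction ps)
    case (Cons p ps)
    have "cut_out (mset (arcs p)) U \<ge> 1" using cut_path[of p U] Cons.prems U by simp
    then show ?case using Cons by simp
  qed simp
  then have "length (scaled es M (length ps)) \<le> length (scaled es M (cut_out (mset ?al) U))"
    by (rule scaled_mono)
  also have "cut_out (mset ?al) U = (\<Sum>a\<in>?A. count (filter_mset ?P (mset ?al)) a)"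
    unfolding cut_out_def by (rule size_sum_superset) auto
  also have "\<dots> = (\<Sum>a\<in>?A. count (mset ?al) a)" by (rule sum.cong) auto
  also have "length (scaled es M \<dots>) \<le> (\<Sum>a\<in>?A. length (scaled es M (count (mset ?al) a)))"
    by (rule scaled_sum) simp
  also have "\<dots> = (\<Sum>a\<in>?A. count (filter_mset ?P (mset (network es M ?al))) a)"
    by (rule sum.cong) (auto simp: count_network)
  also have "\<dots> = cut_out (mset (network es M ?al)) U"
    unfolding cut_out_def
  proof (rule size_sum_superset[symmetric])
    show "set_mset (filter_mset ?P (mset (network es M ?al))) \<subseteq> ?A"
    proof
      fix a assume "a \<in># filter_mset ?P (mset (network es M ?al))"
      then have "count (mset (network es M ?al)) a > 0" "?P a" by auto
      then have "count (mset ?al) a \<noteq> 0"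
        unfolding count_network by (metis less_irrefl scaled_0)
      then have "a \<in># mset ?al" by (simp add: count_eq_zero_iff)
      with \<open>?P a\<close> show "a \<in> ?A" by simp
    qed
  qed simp
  finally show ?thesis .
qed

lemma length_filter_sum_mset:
  "length (filter (\<lambda>p. a \<in> set (arcs p)) ps) \<le> count (\<Sum>p\<leftarrow>ps. mset (arcs p)) a"
proof (induction ps)
  case (Cons p ps)
  have "length (filter (\<lambda>p. a \<in> set (arcs p)) (p # ps)) =
      of_bool (a \<in> set (arcs p)) + length (filter (\<lambda>p. a \<in> set (arcs p)) ps)" by simp
  moreover have "of_bool (a \<in> set (arcs p)) \<le> count (mset (arcs p)) a" by (simp add: Suc_le_eq)
  ultimately show ?case using Cons by (simp only: list.map sum_list.Cons count_union)
qed simp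

lemma count_concat_arcs:
  "\<forall>p\<in>set ps. distinct p \<Longrightarrow>
     count (mset (concat (map arcs ps))) a = length (filter (\<lambda>p. a \<in> set (arcs p)) ps)"
proof (induction ps)
  case (Cons p ps)
  have "distinct (arcs p)" using Cons.prems by (simp add: distinct_arcs)
  then have "count (mset (arcs p)) a = of_bool (a \<in> set (arcs p))"
    by (rule count_distinct)
  then show ?case using Cons by simp
qed simp

text \<open>The two directions of an edge are rounded separately, each with an error of at most
  \<open>copies es\<close>; this is the summand \<open>2 * copies es\<close>.\<close>

lemma sparse_paths_correct:
  fixes es M ps st vs
  assumes es: "set es \<subseteq> set vs \<times> set vs" and st: "st \<in> set vs \<times> set vs"
    and ps: "\<forall>p\<in>set ps. walk_in es st p"
  defines "out \<equiv> sparse_paths vs es M ps st"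
  shows "length out = length (scaled es M (length ps))"
    and "p \<in> set out \<Longrightarrow> walk_in es st p"
    and "copies es * length (filter (\<lambda>p. e \<in> set (pedges p)) out) \<le>
      length M * length (filter (\<lambda>p. e \<in> set (pedges p)) ps) + 2 * copies es"
proof -
  let ?al = "concat (map arcs ps)"
  let ?D = "network es M ?al"
  have set_al: "a \<in> set es \<or> prod.swap a \<in> set es" if "a \<in> set ?al" for a
    using that ps by (auto simp: walk_in_def)
  have set_D: "set ?D \<subseteq> set ?al"
  proof
    fix a assume "a \<in> set ?D"
    then have "a \<in> set (dedup (\<lambda>a. a) ?al)" unfolding network_def by auto
    then show "a \<in> set ?al" using dedup_props[of "\<lambda>a. a" ?al] by auto
  qed
  have D: "set ?D \<subseteq> set vs \<times> set vs"
  proof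
    fix a assume "a \<in> set ?D"
    with set_D set_al have "a \<in> set es \<or> prod.swap a \<in> set es" by blast
    then show "a \<in> set vs \<times> set vs" using es by (cases a) auto
  qed
  have s: "fst st \<in> set vs" using st by auto
  have ps': "\<forall>p\<in>set ps. p \<noteq> [] \<and> hd p = fst st \<and> last p = snd st"
    using ps by (auto simp: walk_in_def prod_eq_iff)
  have cut: "\<forall>U. fst st \<in> U \<longrightarrow> snd st \<notin> U \<longrightarrow> length (scaled es M (length ps)) \<le> cut_out (mset ?D) U"
    using network_cut[OF ps'] by simp
  note mf = max_flow_correct[OF s D cut, folded sparse_paths_def, folded out_def]
  show "length out = length (scaled es M (length ps))" by (rule mf(1))
  have sub: "(\<Sum>p\<leftarrow>out. mset (arcs p)) \<subseteq># mset ?D" by (rule mf(3))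
  have arcs_out: "set (arcs p) \<subseteq> set ?D" if "p \<in> set out" for p
  proof
    fix a assume "a \<in> set (arcs p)"
    then have "filter (\<lambda>p. a \<in> set (arcs p)) out \<noteq> []" using that by (auto simp: filter_empty_conv)
    then have "0 < count (\<Sum>p\<leftarrow>out. mset (arcs p)) a"
      using length_filter_sum_mset[of a out] by (metis length_greater_0_conv less_le_trans)
    also have "\<dots> \<le> count (mset ?D) a" by (rule mset_subset_eq_count[OF sub])
    finally show "a \<in> set ?D" by simp
  qed
  show "walk_in es st p" if "p \<in> set out" for p
    using mf(2)[OF that] arcs_out[OF that] set_D set_al unfolding walk_in_def by (simp add: prod_eq_iff) blast
  show "copies es * length (filter (\<lambda>p. e \<in> set (pedges p)) out) \<le>
      length M * length (filter (\<lambda>p. e \<in> set (pedges p)) ps) + 2 * copies es"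
  proof (cases "\<exists>p\<in>set out. e \<in> set (pedges p)")
    case False
    then have "filter (\<lambda>p. e \<in> set (pedges p)) out = []" by (simp add: filter_empty_conv)
    then show ?thesis by simp
  next
    case True
    then obtain a where a: "e = norm_edge a" by (auto simp: pedges_def)
    have e_iff: "e \<in> set (pedges p) \<longleftrightarrow> a \<in> set (arcs p) \<or> prod.swap a \<in> set (arcs p)" for p
    proof
      assume "e \<in> set (pedges p)"
      then obtain a' where "a' \<in> set (arcs p)" "norm_edge a = norm_edge a'" by (auto simp: pedges_def a)
      then show "a \<in> set (arcs p) \<or> prod.swap a \<in> set (arcs p)" by (auto simp: norm_edge_eq_iff)
    next
      assume "a \<in> set (arcs p) \<or> prod.swap a \<in> set (arcs p)"
      then show "e \<in> set (pedges p)" unfolding pedges_def a set_map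
        by (metis image_eqI norm_edge_swap)
    qed
    let ?n = "\<lambda>a. length (filter (\<lambda>p. a \<in> set (arcs p)) out)"
    let ?m = "\<lambda>a. length (filter (\<lambda>p. a \<in> set (arcs p)) ps)"
    have dist: "\<forall>p\<in>set ps. distinct p" using ps by (simp add: walk_in_def)
    have n: "copies es * ?n a \<le> length M * ?m a + copies es" for a
    proof -
      have "?n a \<le> count (mset ?D) a"
        by (rule order_trans[OF length_filter_sum_mset mset_subset_eq_count[OF sub]])
      also have "\<dots> = length (scaled es M (?m a))"
        unfolding count_network count_concat_arcs[OF dist] ..
      finally have "copies es * ?n a \<le> copies es * length (scaled es M (?m a))" by (rule mult_le_mono2)
      also have "\<dots> \<le> length M * ?m a + copies es" by (rule scaled_upper)
      finally show ?thesis .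
    qed
    have "length (filter (\<lambda>p. e \<in> set (pedges p)) out) \<le> ?n a + ?n (prod.swap a)"
      unfolding e_iff by (induction out) auto
    from mult_le_mono2[OF this, of "copies es"]
    have "copies es * length (filter (\<lambda>p. e \<in> set (pedges p)) out) \<le>
        copies es * ?n a + copies es * ?n (prod.swap a)" by (simp add: distrib_left)
    also have "\<dots> \<le> length M * (?m a + ?m (prod.swap a)) + 2 * copies es"
      using n[of a] n[of "prod.swap a"] by (simp add: distrib_left)
    \<comment> \<open>No path uses both directions of the edge, so none is counted twice.\<close>
    also have "?m a + ?m (prod.swap a) \<le> length (filter (\<lambda>p. e \<in> set (pedges p)) ps)"
      using dist
    proof (induction ps)
      case (Cons p ps)
      have "\<not> (a \<in> set (arcs p) \<and> prod.swap a \<in> set (arcs p))"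
        using arcs_asym[of p a] Cons.prems by auto
      then show ?case using Cons e_iff[of p] by auto
    qed simp
    then have "length M * (?m a + ?m (prod.swap a)) + 2 * copies es \<le>
        length M * length (filter (\<lambda>p. e \<in> set (pedges p)) ps) + 2 * copies es" by simp
    finally show ?thesis .
  qed
qed

lemma length_filter_index:
  "\<forall>c\<in>set xs. f c < (k :: nat) \<Longrightarrow> (\<Sum>i<k. length (filter (\<lambda>c. f c = i \<and> P c) xs)) = length (filter P xs)"
proof (induction xs)
  case (Cons c xs)
  have "length (filter (\<lambda>c. f c = i \<and> P c) (c # xs)) =
      (if i = f c then of_bool (P c) else 0) + length (filter (\<lambda>c. f c = i \<and> P c) xs)" for i
    by auto
  then show ?case using Cons by (auto simp: sum.distrib)
qed simp

lemma candidates_alt: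
  "candidates vs es M sel = concat (map (\<lambda>i. map (Pair i) (sparse_paths vs es M
     (map snd (filter (\<lambda>c. fst (fst c) = i) sel)) (M ! i))) [0..<length M])"
proof -
  have "zip [0..<length M] M = map (\<lambda>i. (i, M ! i)) [0..<length M]"
    by (rule nth_equalityI) auto
  then show ?thesis unfolding candidates_def by (simp add: comp_def)
qed

lemma filter_candidates:
  "length (filter P (concat (map (\<lambda>i. map (Pair i) (g i)) [0..<k]))) = (\<Sum>i<k. length (filter (\<lambda>p. P (i, p)) (g i)))"
  by (induction k) (auto simp: filter_map comp_def)

section \<open>Number and congestion of the candidate paths\<close>

context
  fixes vs es M
  assumes graph: "simple_list_graph vs es" and terminals: "set M \<subseteq> set vs \<times> set vs"
begin

text \<open>The 5 is made up of 3 from the capacity of the fractional solution, which becomes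
  \<open>3 * length M\<close> after scaling, and of a rounding error of 2 for each of the
  \<open>length M\<close> pairs.\<close>

lemma candidates_correct:
  defines "cs \<equiv> candidates vs es M (fractional vs es M)"
  shows "c \<in> set cs \<Longrightarrow> fst c < length M \<and> walk_in es (M ! fst c) (snd c)"
    and "length (filter (\<lambda>c. fst c = i) cs) \<le> length M"
    and "length (filter (\<lambda>c. e \<in> set (pedges (snd c))) cs) \<le> 5 * length M"
    and "length M * length (fractional vs es M) \<le> copies es * length cs"
proof -
  let ?sel = "fractional vs es M" and ?k = "length M" and ?K = "copies es"
  define ps where "ps i = map snd (filter (\<lambda>c. fst (fst c) = i) ?sel)" for i
  define g where "g i = sparse_paths vs es M (ps i) (M ! i)" for i
  note sound = fractional_sound[OF graph terminals]
  have cs: "cs = concat (map (\<lambda>i. map (Pair i) (g i)) [0..<?k])"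
    unfolding cs_def candidates_alt g_def ps_def ..
  have es: "set es \<subseteq> set vs \<times> set vs" using graph by (simp add: simple_list_graph_def)
  have st: "M ! i \<in> set vs \<times> set vs" if "i < ?k" for i using subsetD[OF terminals nth_mem[OF that]] .
  have ps: "\<forall>p\<in>set (ps i). walk_in es (M ! i) p" for i
    using sound(3) unfolding ps_def by auto
  have sp: "length (g i) = length (scaled es M (length (ps i)))"
    "p \<in> set (g i) \<Longrightarrow> walk_in es (M ! i) p"
    "?K * length (filter (\<lambda>p. e \<in> set (pedges p)) (g i)) \<le>
      ?k * length (filter (\<lambda>p. e \<in> set (pedges p)) (ps i)) + 2 * ?K" if "i < ?k" for i p e
    unfolding g_def using sparse_paths_correct[OF es st[OF that] ps[of i], where M = M] by auto
  show "fst c < ?k \<and> walk_in es (M ! fst c) (snd c)" if "c \<in> set cs"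
  proof -
    from that obtain i p where "i < ?k" "p \<in> set (g i)" "c = (i, p)" unfolding cs by auto
    then show ?thesis using sp(2)[of i p] by simp
  qed
  have len_ps: "length (ps i) \<le> ?K" for i
  proof -
    let ?f = "filter (\<lambda>c. fst (fst c) = i) ?sel"
    have "distinct (map fst ?f)" using sound(1) by (rule distinct_map_filter)
    then have "length ?f = card (set (map fst ?f))" by (metis distinct_card length_map)
    also have "\<dots> \<le> card ({i} \<times> {..<?K})"
      by (rule card_mono) (use sound(3) in auto)
    finally show ?thesis by (simp add: ps_def)
  qed
  have "length (filter (\<lambda>c. fst c = i) cs) = (\<Sum>j<?k. if j = i then length (g j) else 0)"
    unfolding cs filter_candidates by (rule sum.cong) auto
  also have "\<dots> \<le> ?k"
    using sp(1)[of i] scaled_le[of es M "length (ps i)"] by (simp add: sum.delta)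
  finally show "length (filter (\<lambda>c. fst c = i) cs) \<le> ?k" .
  have "?K * length (filter (\<lambda>c. e \<in> set (pedges (snd c))) cs) =
      (\<Sum>i<?k. ?K * length (filter (\<lambda>p. e \<in> set (pedges p)) (g i)))"
    unfolding cs filter_candidates by (simp add: sum_distrib_left)
  also have "\<dots> \<le> (\<Sum>i<?k. ?k * length (filter (\<lambda>p. e \<in> set (pedges p)) (ps i)) + 2 * ?K)"
    by (rule sum_mono) (use sp(3) in simp)
  also have "\<dots> = ?k * (\<Sum>i<?k. length (filter (\<lambda>p. e \<in> set (pedges p)) (ps i))) + 2 * ?K * ?k"
    by (simp add: sum.distrib sum_distrib_left)
  also have "(\<Sum>i<?k. length (filter (\<lambda>p. e \<in> set (pedges p)) (ps i))) =
      (\<Sum>i<?k. length (filter (\<lambda>c. fst (fst c) = i \<and> e \<in> set (pedges (snd c))) ?sel))"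
    unfolding ps_def by (simp add: filter_map comp_def conj_commute)
  also have "\<dots> = load ?sel e"
    unfolding load_def by (rule length_filter_index) (use sound(3) in blast)
  also have "?k * load ?sel e + 2 * ?K * ?k \<le> ?k * (3 * ?K) + 2 * ?K * ?k"
    by (intro add_right_mono mult_le_mono2 sound(2))
  also have "\<dots> = ?K * (5 * ?k)" by (simp add: algebra_simps)
  finally show "length (filter (\<lambda>c. e \<in> set (pedges (snd c))) cs) \<le> 5 * ?k" using copies_pos[of es] by simp
  have "length ?sel = (\<Sum>i<?k. length (filter (\<lambda>c. fst (fst c) = i \<and> True) ?sel))"
    by (subst length_filter_index) (use sound(3) in auto)
  also have "\<dots> = (\<Sum>i<?k. length (ps i))" by (simp add: ps_def)
  finally have "?k * length ?sel = (\<Sum>i<?k. ?k * length (ps i))" by (simp add: sum_distrib_left)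
  also have "\<dots> \<le> (\<Sum>i<?k. ?K * length (g i))"
    by (rule sum_mono) (use sp(1) scaled_lower[OF len_ps] in simp)
  also have "\<dots> = ?K * length cs"
    using filter_candidates[of "\<lambda>_. True" g ?k] unfolding cs by (simp add: sum_distrib_left)
  finally show "?k * length ?sel \<le> ?K * length cs" .
qed

end

section \<open>Rounding\<close>

lemma length_filter_cover:
  "\<forall>x\<in>set xs. P x \<longrightarrow> A x \<or> B x \<or> C x \<Longrightarrow>
     length (filter P xs) \<le> length (filter A xs) + length (filter B xs) + length (filter C xs)"
  by (induction xs) auto

lemma length_filter_filter_le: "length (filter Q (filter P xs)) \<le> length (filter Q xs)"
  by (induction xs) auto

text \<open>A pivotal choice discards at most \<open>k\<close> candidates of its own pair and at
  most \<open>l\<close> on each of two edges that together hit all candidates meeting it. Writing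
  the remaining list as \<open>filter P cs\<close> transfers the bounds on \<open>cs\<close> to
  it.\<close>

lemma disjoint_selection_invariant:
  assumes per_index: "\<forall>i. length (filter (\<lambda>c. fst c = i) cs) \<le> k"
    and per_edge: "\<forall>e. length (filter (\<lambda>c. e \<in> set (pedges (snd c))) cs) \<le> l"
  defines "u \<equiv> \<lambda>j. (disjoint_step ^^ j) (cs, [])"
  shows "(\<exists>P. fst (u j) = filter P cs) \<and> set (snd (u j)) \<subseteq> set cs \<and> distinct (map fst (snd (u j))) \<and>
    (\<forall>e. load (snd (u j)) e \<le> 1) \<and>
    (\<forall>c\<in>set (fst (u j)). \<forall>c'\<in>set (snd (u j)). fst c \<noteq> fst c' \<and> \<not> meets (snd c) (snd c')) \<and>
    length cs \<le> length (fst (u j)) + (k + 2 * l) * length (snd (u j))"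
proof (induction j)
  case 0
  have "\<exists>P. cs = filter P cs" by (rule exI[of _ "\<lambda>_. True"]) simp
  then show ?case by (simp add: u_def load_def)
next
  case (Suc j)
  have uS: "u (Suc j) = disjoint_step (u j)" by (simp add: u_def)
  obtain P where P: "fst (u j) = filter P cs" using Suc by blast
  show ?case
  proof (cases rule: disjoint_step_cases[of "u j"])
    case 1
    then show ?thesis using Suc by (simp add: uS)
  next
    case (2 c)
    let ?keep = "\<lambda>c'. fst c' \<noteq> fst c \<and> \<not> meets (snd c') (snd c)"
    have u': "fst (u (Suc j)) = filter ?keep (fst (u j))" "snd (u (Suc j)) = c # snd (u j)"
      using 2(3) by (simp_all add: uS)
    have c: "c \<in> set cs" using 2(1) P by simp
    note IH = Suc[THEN conjunct2, THEN conjunct1] Suc[THEN conjunct2, THEN conjunct2, THEN conjunct1]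
      Suc[THEN conjunct2, THEN conjunct2, THEN conjunct2, THEN conjunct1]
      Suc[THEN conjunct2, THEN conjunct2, THEN conjunct2, THEN conjunct2, THEN conjunct1]
      Suc[THEN conjunct2, THEN conjunct2, THEN conjunct2, THEN conjunct2, THEN conjunct2]
    note sep = IH(4)[THEN bspec, OF 2(1)] and pivotal = 2(2)
    have 1: "\<exists>P'. fst (u (Suc j)) = filter P' cs"
      unfolding u' P filter_filter by (rule exI) (rule refl)
    have 2: "distinct (map fst (snd (u (Suc j))))" using sep IH(2) by (auto simp: u')
    have 3: "load (snd (u (Suc j))) e \<le> 1" for e
    proof (cases "e \<in> set (pedges (snd c))")
      case True
      have "e \<notin> set (pedges (snd c'))" if "c' \<in> set (snd (u j))" for c'
        using sep[THEN bspec, OF that] True by (simp add: meets_def)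
      then have "load (snd (u j)) e = 0" unfolding load_def by (simp add: filter_empty_conv)
      then show ?thesis by (simp add: load_Cons u')
    next
      case False
      then show ?thesis using IH(3)[THEN spec, of e] by (simp add: load_Cons u')
    qed
    have 4: "\<forall>c1\<in>set (fst (u (Suc j))). \<forall>c2\<in>set (snd (u (Suc j))).
        fst c1 \<noteq> fst c2 \<and> \<not> meets (snd c1) (snd c2)"
      using IH(4) by (simp add: u')
    have "length (fst (u j)) \<le> length (filter ?keep (fst (u j))) + (k + 2 * l)"
    proof -
      obtain e f where ef: "\<forall>c'\<in>set (fst (u j)). meets (snd c') (snd c) \<longrightarrow>
          e \<in> set (pedges (snd c')) \<or> f \<in> set (pedges (snd c'))"
        using pivotal unfolding pivotal_def by blast
      let ?R = "\<lambda>P. length (filter P (fst (u j)))"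
      have "length (fst (u j)) = ?R ?keep + ?R (\<lambda>c'. \<not> ?keep c')"
        by (rule sum_length_filter_compl[symmetric])
      also have "?R (\<lambda>c'. \<not> ?keep c') \<le> ?R (\<lambda>c'. fst c' = fst c) +
          ?R (\<lambda>c'. e \<in> set (pedges (snd c'))) + ?R (\<lambda>c'. f \<in> set (pedges (snd c')))"
        by (rule length_filter_cover) (use ef in simp)
      also have "\<dots> \<le> k + l + l"
        unfolding P
        by (intro add_mono order_trans[OF length_filter_filter_le] per_index[THEN spec] per_edge[THEN spec])
      finally show ?thesis by simp
    qed
    then have 5: "length cs \<le> length (fst (u (Suc j))) + (k + 2 * l) * length (snd (u (Suc j)))"
      using IH(5) by (simp add: u')
    have 6: "set (snd (u (Suc j))) \<subseteq> set cs" using IH(1) c by (simp add: u')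
    show ?thesis by (intro conjI 1 2 6 allI 3 4 5)
  qed
qed

lemma disjoint_selection_correct:
  assumes per_index: "\<forall>i. length (filter (\<lambda>c. fst c = i) cs) \<le> k"
    and per_edge: "\<forall>e. length (filter (\<lambda>c. e \<in> set (pedges (snd c))) cs) \<le> l"
  shows "set (snd (disjoint_selection cs)) \<subseteq> set cs" "distinct (map fst (snd (disjoint_selection cs)))"
    and "load (snd (disjoint_selection cs)) e \<le> 1"
    and "fst (disjoint_selection cs) = [] \<Longrightarrow> length cs \<le> (k + 2 * l) * length (snd (disjoint_selection cs))"
proof -
  note inv = disjoint_selection_invariant[OF assms, of "length cs", folded disjoint_selection_def,
      THEN conjunct2]
  show "set (snd (disjoint_selection cs)) \<subseteq> set cs" by (rule inv[THEN conjunct1])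
  show "distinct (map fst (snd (disjoint_selection cs)))" by (rule inv[THEN conjunct2, THEN conjunct1])
  show "load (snd (disjoint_selection cs)) e \<le> 1"
    by (rule inv[THEN conjunct2, THEN conjunct2, THEN conjunct1, THEN spec])
  show "fst (disjoint_selection cs) = [] \<Longrightarrow> length cs \<le> (k + 2 * l) * length (snd (disjoint_selection cs))"
    using inv[THEN conjunct2, THEN conjunct2, THEN conjunct2, THEN conjunct2] by simp
qed

lemma disjoint_selection_complete:
  assumes "\<forall>R. R \<noteq> [] \<longrightarrow> set R \<subseteq> set cs \<longrightarrow> (\<exists>c\<in>set R. pivotal R c)"
  shows "fst (disjoint_selection cs) = []"
proof -
  have "set (fst ((disjoint_step ^^ j) (cs, []))) \<subseteq> set cs \<and>
      length (fst ((disjoint_step ^^ j) (cs, []))) \<le> length cs - j" for j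
  proof (induction j)
    case (Suc j)
    let ?u = "(disjoint_step ^^ j) (cs, [])"
    show ?case
    proof (cases rule: disjoint_step_cases[of ?u])
      case 1
      have "fst ?u = []"
      proof (rule ccontr)
        assume "fst ?u \<noteq> []"
        then obtain c where "c \<in> set (fst ?u)" "pivotal (fst ?u) c"
          using assms[THEN spec, THEN mp, THEN mp, of "fst ?u"] Suc by auto
        with 1(2) show False by simp
      qed
      then show ?thesis using 1(1) by simp
    next
      case (2 c)
      have "length (filter (\<lambda>c'. fst c' \<noteq> fst c \<and> \<not> meets (snd c') (snd c)) (fst ?u)) < length (fst ?u)"
        by (rule length_filter_less[OF 2(1)]) simp
      then show ?thesis using Suc 2(3) by auto
    qed
  qed simp
  from this[of "length cs"] show ?thesis by (simp add: disjoint_selection_def)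
qed

text \<open>For a downward closed predicate, counting the hits finds the threshold; this is how
  \<open>loglist\<close> and \<open>capacity\<close> are evaluated.\<close>

lemma length_filter_antimono:
  assumes "\<forall>i j. i \<le> j \<longrightarrow> P j \<longrightarrow> P i"
  shows "(\<forall>j<length (filter P [0..<n]). P j) \<and>
    (length (filter P [0..<n]) < n \<longrightarrow> \<not> P (length (filter P [0..<n])))"
proof (induction n)
  case (Suc n)
  define m where "m = length (filter P [0..<n])"
  note IH = Suc[folded m_def]
  have le: "m \<le> n" using length_filter_le[of P "[0..<n]"] by (simp add: m_def)
  show ?case
  proof (cases "P n")
    case True
    then have all: "\<forall>j<Suc n. P j" using assms by (metis less_Suc_eq_le)
    then have "P m" using le by simp
    then have "m = n" using IH[THEN conjunct2] le by linarith
    moreover have "length (filter P [0..<Suc n]) = Suc m" using True by (simp add: m_def)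
    ultimately have "length (filter P [0..<Suc n]) = Suc n" by simp
    then show ?thesis using all by simp
  next
    case False
    then have len: "length (filter P [0..<Suc n]) = m" by (simp add: m_def)
    have "\<not> P m"
    proof (cases "m = n")
      case True
      then show ?thesis using False by simp
    next
      case False
      then show ?thesis using IH[THEN conjunct2] le by linarith
    qed
    then show ?thesis unfolding len using IH[THEN conjunct1] by blast
  qed
qed simp

lemma base_ge: "base xs \<ge> 3"
  by (simp add: base_def)

lemma length_less_base: "length xs < 2 ^ base xs"
proof -
  let ?n = "length xs" and ?L = "length (loglist xs)"
  have mono: "\<forall>i j. i \<le> j \<longrightarrow> 2 ^ j \<le> ?n \<longrightarrow> 2 ^ i \<le> ?n"
  proof (intro allI impI)
    fix i j :: nat assume "i \<le> j" "2 ^ j \<le> ?n"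
    then show "2 ^ i \<le> ?n" using power_increasing[of i j "2 :: nat"] by linarith
  qed
  have "?n < 2 ^ ?L"
  proof (rule ccontr)
    assume "\<not> ?n < 2 ^ ?L"
    then have le: "2 ^ ?L \<le> ?n" by simp
    moreover have "?L < 2 ^ ?L" by (rule less_exp)
    ultimately have "?L < ?n" by linarith
    then show False
      using length_filter_antimono[of "\<lambda>j. 2 ^ j \<le> ?n" ?n, OF mono, folded loglist_def] le by simp
  qed
  also have "\<dots> \<le> 2 ^ base xs" by (rule power_increasing) (simp_all add: base_def)
  finally show ?thesis .
qed

lemma capacity_props:
  "2 ^ (9 * base xs) \<le> base xs ^ capacity xs"
  "capacity xs > 0 \<Longrightarrow> base xs ^ (capacity xs - 1) < 2 ^ (9 * base xs)"
proof -
  let ?b = "base xs"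
  let ?P = "\<lambda>c. ?b ^ c < 2 ^ (9 * ?b)"
  have mono: "\<forall>i j. i \<le> j \<longrightarrow> ?P j \<longrightarrow> ?P i"
  proof (intro allI impI)
    fix i j :: nat assume "i \<le> j" "?P j"
    then show "?P i" using power_increasing[of i j ?b] base_ge[of xs] by linarith
  qed
  have range: "cap_range xs = [0..<Suc (9 * ?b)]"
    using length_cap_range[of xs] unfolding cap_range_def by simp
  note * = length_filter_antimono[of ?P "Suc (9 * ?b)", OF mono, folded range, folded capacity_def]
  have "2 ^ (9 * ?b) \<le> ?b ^ (9 * ?b)" by (rule power_mono) (use base_ge[of xs] in auto)
  then have "\<not> ?P (9 * ?b)" by (simp add: not_less)
  then have "\<not> 9 * ?b < capacity xs" using *[THEN conjunct1, THEN spec, of "9 * ?b"] by simp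
  then show "2 ^ (9 * ?b) \<le> ?b ^ capacity xs" using *[THEN conjunct2] by (simp add: not_less)
  show "capacity xs > 0 \<Longrightarrow> ?b ^ (capacity xs - 1) < 2 ^ (9 * ?b)"
    using *[THEN conjunct1, THEN spec, of "capacity xs - 1"] by simp
qed

text \<open>Origin of the 9, with \<open>b = base xs\<close>: \<open>length xs < 2 ^ b\<close>, and
  the exponential is at most \<open>3 ^ (5 * b) = 243 ^ b \<le> 256 ^ b = 2 ^ (8 * b)\<close>. The 5
  is the congestion of the candidates in units of \<open>length M\<close>.\<close>

lemma capacity_sufficient:
  "real (length xs) * exp (real (base xs - 1) * 5) < real (base xs) ^ capacity xs"
proof -
  let ?b = "base xs"
  have "exp (real (?b - 1) * 5) \<le> exp (real ?b * 5)" by simp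
  also have "\<dots> = exp 1 ^ (5 * ?b)"
    using exp_of_nat_mult[of "5 * ?b" "1 :: real"] by (simp add: mult.commute)
  also have "\<dots> \<le> 3 ^ (5 * ?b)" by (rule power_mono) (use exp_le in auto)
  also have "\<dots> = (3 ^ 5) ^ ?b" by (simp only: power_mult)
  also have "\<dots> \<le> (2 ^ 8) ^ ?b" by (rule power_mono) auto
  also have "\<dots> = 2 ^ (8 * ?b)" by (simp only: power_mult)
  finally have e: "exp (real (?b - 1) * 5) \<le> 2 ^ (8 * ?b)" .
  have "real (length xs) < 2 ^ ?b" using length_less_base[of xs] by simp
  then have "real (length xs) * exp (real (?b - 1) * 5) < 2 ^ ?b * exp (real (?b - 1) * 5)" by simp
  also have "\<dots> \<le> 2 ^ ?b * 2 ^ (8 * ?b)" using e by simp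
  also have "\<dots> = 2 ^ (9 * ?b)" by (simp add: power_add[symmetric])
  also have "\<dots> \<le> real ?b ^ capacity xs"
    using capacity_props(1)[of xs, folded of_nat_le_iff[where 'a = real]] by simp
  finally show ?thesis .
qed

lemma load_signature:
  assumes "set sel \<subseteq> set cs" and "signature cs e = signature cs e'"
  shows "load sel e = load sel e'"
proof -
  have "e \<in> set (pedges (snd c)) \<longleftrightarrow> e' \<in> set (pedges (snd c))" if "c \<in> set cs" for c
    using assms(2) that unfolding signature_def by simp
  then have "filter (\<lambda>c. e \<in> set (pedges (snd c))) sel = filter (\<lambda>c. e' \<in> set (pedges (snd c))) sel"
    using assms(1) by (intro filter_cong) auto
  then show ?thesis by (simp add: load_def)
qed

text \<open>The candidates are their own reference solution, with \<open>k\<close> paths per pair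
  and \<open>5 * k\<close> per edge. Only the quotient 5 enters the exponent, so the base need not
  depend on \<open>k\<close>.\<close>

lemma greedy_rounding:
  assumes k: "k > 0" and per_index: "\<forall>i. length (filter (\<lambda>c. fst c = i) cs) \<le> k"
    and per_edge: "\<forall>e. length (filter (\<lambda>c. e \<in> set (pedges (snd c))) cs) \<le> 5 * k"
  defines "sel \<equiv> greedy (base (representatives cs)) (representatives cs) (capacity (representatives cs))
       (\<lambda>_. cs) (length cs)"
  shows "length cs \<le> 2 * k * length sel"
  unfolding sel_def
proof (rule greedy_competitive[where lam = "5 * k"])
  let ?reps = "representatives cs"
  let ?S = "greedy (base ?reps) ?reps (capacity ?reps) (\<lambda>_. cs)"
  show "2 \<le> base ?reps" using base_ge[of ?reps] by simp
  have sub: "set (?S j) \<subseteq> set cs" for j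
    using greedy_invariant[of "base ?reps" ?reps "capacity ?reps" "\<lambda>_. cs" j] by auto
  show "\<forall>j. \<forall>c\<in>set cs. \<forall>e\<in>set (pedges (snd c)). \<exists>e'\<in>set ?reps. load (?S j) e' = load (?S j) e"
  proof (intro allI ballI)
    fix j c e assume "c \<in> set cs" "e \<in> set (pedges (snd c))"
    then have "e \<in> set (concat (map (\<lambda>c. pedges (snd c)) cs))" by auto
    then have "signature cs e \<in> signature cs ` set ?reps"
      unfolding representatives_def
      using dedup_props[of "signature cs" "concat (map (\<lambda>c. pedges (snd c)) cs)"] by auto
    then obtain e' where "e' \<in> set ?reps" "signature cs e = signature cs e'" by auto
    then show "\<exists>e'\<in>set ?reps. load (?S j) e' = load (?S j) e"
      using load_signature[OF sub, of e e' j] by (intro bexI[of _ e']) auto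
  qed
  show "real (length ?reps) * exp (real (base ?reps - 1) * real (5 * k) / real k) < real (base ?reps) ^ capacity ?reps"
    using capacity_sufficient[of ?reps] k by simp
qed (use k per_index per_edge in auto)

section \<open>Forests\<close>

lemma set_arcs_nth: "a \<in> set (arcs p) \<longleftrightarrow> (\<exists>i. Suc i < length p \<and> a = (p ! i, p ! Suc i))"
proof
  assume "a \<in> set (arcs p)"
  then obtain i where "a = (p ! i, tl p ! i)" "i < min (length p) (length (tl p))"
    unfolding arcs_def set_zip by (elim CollectE exE conjE)
  then show "\<exists>i. Suc i < length p \<and> a = (p ! i, p ! Suc i)" by (intro exI[of _ i]) (simp add: nth_tl)
next
  assume "\<exists>i. Suc i < length p \<and> a = (p ! i, p ! Suc i)"
  then obtain i where "Suc i < length p" "a = (p ! i, p ! Suc i)" by blast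
  then show "a \<in> set (arcs p)" unfolding arcs_def set_zip by (intro CollectI exI[of _ i]) (simp add: nth_tl)
qed

lemma path_edges_nth: "path_edges p = {{p ! i, p ! Suc i} | i. Suc i < length p}"
proof (intro set_eqI iffI)
  fix f assume "f \<in> path_edges p"
  then obtain a where a: "a \<in> set (arcs p)" "f = {fst a, snd a}"
    by (auto simp: path_edges_def arcs_def)
  from a(1) obtain i where "Suc i < length p" "a = (p ! i, p ! Suc i)" unfolding set_arcs_nth by (elim exE conjE)
  then show "f \<in> {{p ! i, p ! Suc i} | i. Suc i < length p}" using a(2) by (intro CollectI exI[of _ i]) simp
next
  fix f assume "f \<in> {{p ! i, p ! Suc i} | i. Suc i < length p}"
  then obtain i where i: "Suc i < length p" "f = {p ! i, p ! Suc i}" by (elim CollectE exE conjE)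
  then have "(p ! i, p ! Suc i) \<in> set (arcs p)" unfolding set_arcs_nth by (intro exI[of _ i]) simp
  then show "f \<in> path_edges p"
    unfolding path_edges_def arcs_def[symmetric] using i(2) by (intro image_eqI[of _ _ "(p ! i, p ! Suc i)"]) simp_all
qed

text \<open>The first vertex of a longest path is a leaf: a further neighbour would either extend
  the path or lie on it and close a cycle.\<close>

lemma forest_leaf:
  assumes fin: "finite E" and two: "\<forall>e\<in>E. card e = 2" and forest: "forest E" and ne: "E \<noteq> {}"
  shows "\<exists>x y. {x, y} \<in> E \<and> x \<noteq> y \<and> (\<forall>e\<in>E. x \<in> e \<longrightarrow> e = {x, y})"
proof -
  define good where "good p \<longleftrightarrow> distinct p \<and> path_edges p \<subseteq> E \<and> 2 \<le> length p" for p
  have finU: "finite (\<Union>E)"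
  proof (rule finite_Union[OF fin])
    fix e assume "e \<in> E"
    then have "card e = 2" using two by simp
    then show "finite e" by (intro card_ge_0_finite) simp
  qed
  from ne obtain e0 where e0: "e0 \<in> E" by blast
  then have "card e0 = 2" using two by simp
  then obtain u v where "e0 = {u, v}" "u \<noteq> v" unfolding card_2_iff by (elim exE conjE)
  then have uv: "{u, v} \<in> E" "u \<noteq> v" using e0 by simp_all
  have g0: "good [u, v]" using uv by (auto simp: good_def path_edges_def)
  have bound: "length p \<le> card (\<Union>E)" if "good p" for p
  proof -
    have "set p \<subseteq> \<Union>E"
    proof
      fix x assume "x \<in> set p"
      then obtain i where i: "i < length p" "x = p ! i" by (auto simp: in_set_conv_nth)
      show "x \<in> \<Union>E"
      proof (cases "Suc i < length p")
        case True
        then have "{p ! i, p ! Suc i} \<in> E" using that by (auto simp: good_def path_edges_nth)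
        then show ?thesis using i by auto
      next
        case False
        moreover have "2 \<le> length p" using that by (simp add: good_def)
        ultimately obtain j where "i = Suc j" using i by (cases i) auto
        then have "{p ! j, p ! i} \<in> E" using that i by (auto simp: good_def path_edges_nth)
        then show ?thesis using i by auto
      qed
    qed
    then have "card (set p) \<le> card (\<Union>E)" by (rule card_mono[OF finU])
    then show ?thesis using that by (simp add: good_def distinct_card)
  qed
  have "\<forall>q. good q \<longrightarrow> length q < Suc (card (\<Union>E))" using bound by (simp add: less_Suc_eq_le)
  from ex_has_greatest_nat[of good, OF g0 this] obtain p
    where p: "good p" "\<forall>q. good q \<longrightarrow> length q \<le> length p" by (elim exE conjE)
  have len: "2 \<le> length p" and dist: "distinct p" and pe: "path_edges p \<subseteq> E" using p(1) by (auto simp: good_def)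
  let ?x = "p ! 0" and ?y = "p ! 1"
  have "{p ! 0, p ! Suc 0} \<in> path_edges p" unfolding path_edges_nth using len by (intro CollectI exI[of _ 0]) auto
  then have xy: "{?x, ?y} \<in> E" using pe by auto
  have "0 < length p" "1 < length p" using len by linarith+
  from nth_eq_iff_index_eq[OF dist this] have "?x \<noteq> ?y" by simp
  moreover have "e = {?x, ?y}" if e: "e \<in> E" "?x \<in> e" for e
  proof -
    obtain z where z: "e = {?x, z}" "z \<noteq> ?x"
    proof -
      from two e(1) have "card e = 2" by simp
      then obtain a b where "e = {a, b}" "a \<noteq> b" unfolding card_2_iff by (elim exE conjE)
      then show thesis using that e(2) by (cases "?x = a") (auto simp: insert_commute)
    qed
    have "z \<in> set p"
    proof (rule ccontr)
      assume z': "z \<notin> set p"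
      have "path_edges (z # p) \<subseteq> insert {z, ?x} (path_edges p)"
      proof
        fix f assume "f \<in> path_edges (z # p)"
        then obtain i where "Suc i < length (z # p)" "f = {(z # p) ! i, (z # p) ! Suc i}"
          unfolding path_edges_nth by auto
        then show "f \<in> insert {z, ?x} (path_edges p)"
          unfolding path_edges_nth by (cases i) auto
      qed
      then have "good (z # p)" using z z' e(1) dist pe len by (auto simp: good_def insert_commute)
      then have "length (z # p) \<le> length p" by (rule p(2)[THEN spec, THEN mp])
      then show False by simp
    qed
    then obtain i where i: "i < length p" "z = p ! i" by (auto simp: in_set_conv_nth)
    have "i \<noteq> 0" using z i by (cases i) auto
    moreover have "\<not> 2 \<le> i"
    proof
      assume "2 \<le> i"
      let ?c = "take (Suc i) p"
      have lc: "length ?c = Suc i" using i by simp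
      have "path_edges ?c \<subseteq> path_edges p"
        unfolding path_edges_nth using i by auto
      moreover have "last ?c = z" using i lc by (simp add: last_conv_nth take_Suc_conv_app_nth)
      moreover have "hd ?c = ?x" using len by (cases p) auto
      ultimately have "is_cycle E ?c"
        unfolding is_cycle_def using \<open>2 \<le> i\<close> lc dist pe e(1) z by (auto simp: insert_commute)
      then show False using forest by (auto simp: forest_def)
    qed
    ultimately have "i = 1" by linarith
    then show ?thesis using z i by simp
  qed
  ultimately show ?thesis using xy by blast
qed

lemma forest_mono: "forest E \<Longrightarrow> E' \<subseteq> E \<Longrightarrow> forest E'"
  unfolding forest_def is_cycle_def by blast

text \<open>A rooted forest without explicit roots: \<open>par\<close> is total, its values count
  only where an edge is present, and the increasing rank \<open>rk\<close> certifies
  acyclicity.\<close>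

definition oriented :: "('a \<Rightarrow> 'a) \<Rightarrow> ('a \<Rightarrow> nat) \<Rightarrow> 'a set set \<Rightarrow> bool" where
  "oriented par rk E \<longleftrightarrow> (\<forall>e\<in>E. \<exists>b. e = {b, par b} \<and> rk b < rk (par b))"

text \<open>Induction by removing a leaf edge. The leaf is hung below its neighbour with rank 0, and
  all other ranks are raised by 1 to make room.\<close>

lemma forest_orientation:
  assumes "finite E" and "\<forall>e\<in>E. card e = 2" and "forest E"
  shows "\<exists>par rk. oriented par rk E"
  using assms
proof (induction "card E" arbitrary: E)
  case 0
  then show ?case by (simp add: oriented_def)
next
  case (Suc n)
  then have "E \<noteq> {}" by auto
  from forest_leaf[OF Suc.prems this] obtain x y
    where xy: "{x, y} \<in> E" "x \<noteq> y" "\<forall>e\<in>E. x \<in> e \<longrightarrow> e = {x, y}" by blast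
  let ?E = "E - {{x, y}}"
  have "\<exists>par rk. oriented par rk ?E"
  proof (rule Suc.hyps(1))
    show "n = card ?E" using Suc.hyps(2) xy(1) Suc.prems(1) by simp
    show "forest ?E" by (rule forest_mono[OF Suc.prems(3)]) auto
  qed (use Suc.prems in auto)
  then obtain par rk where o: "oriented par rk ?E" by blast
  let ?par = "par(x := y)" and ?rk = "\<lambda>v. if v = x then 0 else Suc (rk v)"
  have "oriented ?par ?rk E"
    unfolding oriented_def
  proof
    fix e assume "e \<in> E"
    show "\<exists>b. e = {b, ?par b} \<and> ?rk b < ?rk (?par b)"
    proof (cases "e = {x, y}")
      case True
      then show ?thesis using xy(2) by (intro exI[of _ x]) auto
    next
      case False
      then have "e \<in> ?E" using \<open>e \<in> E\<close> by simp
      then obtain b where b: "e = {b, par b}" "rk b < rk (par b)" using o unfolding oriented_def by blast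
      have "x \<notin> e" using False xy(3) \<open>e \<in> E\<close> by blast
      then show ?thesis using b by (intro exI[of _ b]) auto
    qed
  qed
  then show ?case by blast
qed

section \<open>Paths in an oriented forest\<close>

context
  fixes par :: "nat \<Rightarrow> nat" and rk :: "nat \<Rightarrow> nat" and F :: "nat set set"
  assumes orient: "oriented par rk F"
begin

text \<open>Since \<open>par\<close> is total, this tells whether the step from \<open>b\<close> to
  its parent is a real edge of the forest.\<close>

definition up :: "nat \<Rightarrow> bool" where
  "up b \<longleftrightarrow> {b, par b} \<in> F \<and> rk b < rk (par b)"

definition upedge :: "nat \<Rightarrow> nat \<times> nat" where
  "upedge b = norm_edge (b, par b)"

lemma oriented_arc:
  assumes "{x, y} \<in> F"
  shows "(y = par x \<and> up x) \<or> (x = par y \<and> up y)"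
proof -
  obtain b where b: "{x, y} = {b, par b}" "rk b < rk (par b)"
    using orient assms unfolding oriented_def by blast
  then have "(x = b \<and> y = par b) \<or> (x = par b \<and> y = b)" by (simp add: doubleton_eq_iff)
  then show ?thesis
  proof
    assume "x = b \<and> y = par b"
    then show ?thesis using assms b(2) by (simp add: up_def)
  next
    assume "x = par b \<and> y = b"
    then show ?thesis using assms b(2) by (simp add: up_def insert_commute)
  qed
qed

lemma up_asym: "up x \<Longrightarrow> up (par x) \<Longrightarrow> par (par x) \<noteq> x"
  unfolding up_def by auto

lemma upedge_inject:
  assumes "up b" and "up b'" and "upedge b = upedge b'"
  shows "b = b'"
proof (rule ccontr)
  assume ne: "b \<noteq> b'"
  from assms(3) have "(b, par b) = (b', par b') \<or> (b, par b) = (par b', b')"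
    unfolding upedge_def norm_edge_eq_iff by simp
  with ne have "b = par b'" "par b = b'" by auto
  then show False using assms(1,2) by (simp add: up_def)
qed

lemma upedge_arc:
  assumes "upedge b \<in> set (pedges p)"
  shows "\<exists>i. Suc i < length p \<and> ((p ! i = b \<and> p ! Suc i = par b) \<or> (p ! i = par b \<and> p ! Suc i = b))"
proof -
  from assms obtain a where a: "a \<in> set (arcs p)" "norm_edge (b, par b) = norm_edge a"
    by (auto simp: pedges_def upedge_def)
  from a(1) obtain i where i: "Suc i < length p" "a = (p ! i, p ! Suc i)" unfolding set_arcs_nth by blast
  from a(2) have "(b, par b) = a \<or> (b, par b) = prod.swap a" by (simp add: norm_edge_eq_iff)
  then show ?thesis using i by (intro exI[of _ i]) auto
qed

lemma pedges_nth: "Suc i < length p \<Longrightarrow> norm_edge (p ! i, p ! Suc i) \<in> set (pedges p)"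
  unfolding pedges_def set_map by (rule imageI) (auto simp: set_arcs_nth)

text \<open>A simple path in a forest cannot rise again after descending: having stepped down from
  \<open>par v\<close> to \<open>v\<close>, its only way up leads back to \<open>par v\<close>. The
  index \<open>m\<close> is that of the top vertex.\<close>

lemma up_down:
  assumes dist: "distinct p" and ne: "p \<noteq> []" and F: "\<forall>i. Suc i < length p \<longrightarrow> {p ! i, p ! Suc i} \<in> F"
  shows "\<exists>m<length p. (\<forall>i<m. p ! Suc i = par (p ! i) \<and> up (p ! i)) \<and>
    (\<forall>i\<ge>m. Suc i < length p \<longrightarrow> p ! i = par (p ! Suc i) \<and> up (p ! Suc i))"
proof -
  define P where "P i \<longleftrightarrow> \<not> (Suc i < length p \<and> p ! Suc i = par (p ! i) \<and> up (p ! i))" for i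
  define m where "m = (LEAST i. P i)"
  have Pl: "P (length p - 1)" using ne by (simp add: P_def)
  have "P m" unfolding m_def by (rule LeastI[of P, OF Pl])
  have m_le: "m \<le> length p - 1" unfolding m_def by (rule Least_le[of P, OF Pl])
  have before: "\<not> P i" if "i < m" for i using that unfolding m_def by (rule not_less_Least)
  have down: "p ! i = par (p ! Suc i) \<and> up (p ! Suc i)" if "m \<le> i" "Suc i < length p" for i
    using that
  proof (induction i rule: dec_induct)
    case base
    then show ?case using \<open>P m\<close> oriented_arc[OF F[rule_format, of m]] by (auto simp: P_def)
  next
    case (step i)
    then have IH: "p ! i = par (p ! Suc i)" by simp
    have "p ! Suc (Suc i) \<noteq> p ! i" using dist step.prems by (simp add: nth_eq_iff_index_eq)
    then have "\<not> p ! Suc (Suc i) = par (p ! Suc i)" using IH by simp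
    then show ?case using oriented_arc[OF F[rule_format, OF step.prems]] by simp
  qed
  show ?thesis
  proof (intro exI[of _ m] conjI allI impI)
    show "m < length p" using m_le ne by (cases p) auto
  qed (use before down in \<open>auto simp: P_def\<close>)
qed

text \<open>Climbing from any edge of the path stays on the path up to its top, and the last step
  uses one of the at most two path edges at the top. A missing one of these is replaced by
  \<open>(0, 0)\<close>.\<close>

lemma path_top:
  assumes dist: "distinct p" and ne: "p \<noteq> []" and F: "\<forall>i. Suc i < length p \<longrightarrow> {p ! i, p ! Suc i} \<in> F"
  shows "\<exists>top e f. e \<in> set ((0, 0) # pedges p) \<and> f \<in> set ((0, 0) # pedges p) \<and>
    (\<forall>b. up b \<longrightarrow> upedge b \<in> set (pedges p) \<longrightarrow> (\<exists>h. (par ^^ Suc h) b = top \<and>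
      (\<forall>j\<le>h. up ((par ^^ j) b) \<and> upedge ((par ^^ j) b) \<in> set (pedges p)) \<and>
      upedge ((par ^^ h) b) \<in> {e, f}))"
proof -
  from up_down[OF assms] obtain m where m: "m < length p"
    "\<And>i. i < m \<Longrightarrow> p ! Suc i = par (p ! i) \<and> up (p ! i)"
    "\<And>i. m \<le> i \<Longrightarrow> Suc i < length p \<Longrightarrow> p ! i = par (p ! Suc i) \<and> up (p ! Suc i)" by blast
  define e where "e = (if 0 < m then norm_edge (p ! (m - 1), p ! m) else (0, 0))"
  define f where "f = (if Suc m < length p then norm_edge (p ! m, p ! Suc m) else (0, 0))"
  have "e \<in> set ((0, 0) # pedges p)"
    using pedges_nth[of "m - 1" p] m(1) by (auto simp: e_def)
  moreover have "f \<in> set ((0, 0) # pedges p)"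
    using pedges_nth[of m p] by (auto simp: f_def)
  moreover have "\<exists>h. (par ^^ Suc h) b = p ! m \<and>
      (\<forall>j\<le>h. up ((par ^^ j) b) \<and> upedge ((par ^^ j) b) \<in> set (pedges p)) \<and>
      upedge ((par ^^ h) b) \<in> {e, f}" if b: "up b" "upedge b \<in> set (pedges p)" for b
  proof -
    from upedge_arc[OF b(2)] obtain i where i: "Suc i < length p"
      "(p ! i = b \<and> p ! Suc i = par b) \<or> (p ! i = par b \<and> p ! Suc i = b)" by blast
    from i(2) show ?thesis
    proof
      assume bi: "p ! i = b \<and> p ! Suc i = par b"
      have "i < m"
      proof (rule ccontr)
        assume "\<not> i < m"
        then have "p ! i = par (p ! Suc i) \<and> up (p ! Suc i)" using m(3) i(1) by simp
        then show False using bi up_asym[OF b(1)] by simp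
      qed
      have pw: "(par ^^ j) b = p ! (i + j)" if "i + j \<le> m" for j
        using that
      proof (induction j)
        case (Suc j)
        then show ?case using m(2)[of "i + j"] by simp
      qed (use bi in simp)
      define h where "h = m - i - 1"
      have "(par ^^ Suc h) b = p ! m" using pw[of "Suc h"] \<open>i < m\<close> by (simp add: h_def del: funpow.simps)
      moreover have "up ((par ^^ j) b) \<and> upedge ((par ^^ j) b) \<in> set (pedges p)" if "j \<le> h" for j
      proof -
        have ij: "i + j < m" using that \<open>i < m\<close> by (simp add: h_def)
        then show ?thesis
          using pw[of j] m(2)[OF ij] pedges_nth[of "i + j" p] m(1) by (simp add: upedge_def)
      qed
      moreover have "upedge ((par ^^ h) b) = e"
      proof -
        have "(par ^^ h) b = p ! (m - 1)" using pw[of h] \<open>i < m\<close> by (simp add: h_def)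
        then show ?thesis using m(2)[of "m - 1"] \<open>i < m\<close> by (simp add: upedge_def e_def)
      qed
      ultimately show ?thesis by blast
    next
      assume bi: "p ! i = par b \<and> p ! Suc i = b"
      have "m \<le> i"
      proof (rule ccontr)
        assume "\<not> m \<le> i"
        then have "p ! Suc i = par (p ! i) \<and> up (p ! i)" using m(2) by simp
        then show False using bi up_asym[OF b(1)] by simp
      qed
      have pw: "(par ^^ j) b = p ! (Suc i - j)" if "m \<le> Suc i - j" "j \<le> Suc i" for j
        using that
      proof (induction j)
        case (Suc j)
        have "p ! (i - j) = par (p ! Suc (i - j))" using m(3)[of "i - j"] Suc.prems i(1) by simp
        moreover have "Suc (i - j) = Suc i - j" using Suc.prems by simp
        moreover have "(par ^^ j) b = p ! (Suc i - j)" using Suc by simp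
        ultimately show ?case by simp
      qed (use bi in simp)
      define h where "h = i - m"
      have "(par ^^ Suc h) b = p ! m" using pw[of "Suc h"] \<open>m \<le> i\<close> by (simp add: h_def del: funpow.simps)
      moreover have "up ((par ^^ j) b) \<and> upedge ((par ^^ j) b) \<in> set (pedges p)" if "j \<le> h" for j
      proof -
        have ij: "m \<le> i - j" "Suc (i - j) < length p" "Suc (i - j) = Suc i - j" "j \<le> i"
          using that \<open>m \<le> i\<close> i(1) by (auto simp: h_def)
        have "(par ^^ j) b = p ! Suc (i - j)" using pw[of j] ij by simp
        moreover have "norm_edge (p ! Suc (i - j), p ! (i - j)) \<in> set (pedges p)"
          using pedges_nth[OF ij(2)] norm_edge_swap[of "(p ! (i - j), p ! Suc (i - j))"] by simp
        ultimately show ?thesis using m(3)[OF ij(1,2)] by (simp add: upedge_def)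
      qed
      moreover have "upedge ((par ^^ h) b) = f"
      proof -
        have "(par ^^ h) b = p ! Suc m" using pw[of h] \<open>m \<le> i\<close> by (simp add: h_def Suc_diff_le)
        moreover have "Suc m < length p" using i(1) \<open>m \<le> i\<close> by simp
        ultimately show ?thesis
          using m(3)[of m] norm_edge_swap[of "(p ! m, p ! Suc m)"] by (simp add: upedge_def f_def)
      qed
      ultimately show ?thesis by blast
    qed
  qed
  ultimately show ?thesis by blast
qed

lemma rank_chain:
  assumes "\<forall>j\<le>h. up ((par ^^ j) b)" and "i < j" and "j \<le> Suc h"
  shows "rk ((par ^^ i) b) < rk ((par ^^ j) b)"
  using assms(2,3)
proof (induction j)
  case (Suc j)
  have "rk ((par ^^ j) b) < rk ((par ^^ Suc j) b)"
    using assms(1)[THEN spec, of j] Suc.prems by (simp add: up_def)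
  moreover have "i = j \<or> rk ((par ^^ i) b) < rk ((par ^^ j) b)" using Suc by (cases "i = j") auto
  ultimately show ?case by auto
qed simp

lemma pedges_up:
  assumes "\<forall>i. Suc i < length p \<longrightarrow> {p ! i, p ! Suc i} \<in> F" and "e \<in> set (pedges p)"
  shows "\<exists>b. up b \<and> e = upedge b"
proof -
  from assms(2) obtain i where i: "Suc i < length p" "e = norm_edge (p ! i, p ! Suc i)"
    by (auto simp: pedges_def set_arcs_nth)
  from oriented_arc[of "p ! i" "p ! Suc i"] assms(1) i(1)
  have "(p ! Suc i = par (p ! i) \<and> up (p ! i)) \<or> (p ! i = par (p ! Suc i) \<and> up (p ! Suc i))" by blast
  then show ?thesis
  proof
    assume "p ! Suc i = par (p ! i) \<and> up (p ! i)"
    then show ?thesis using i(2) by (intro exI[of _ "p ! i"]) (simp add: upedge_def)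
  next
    assume "p ! i = par (p ! Suc i) \<and> up (p ! Suc i)"
    then show ?thesis
      using i(2) norm_edge_swap[of "(p ! i, p ! Suc i)"] by (intro exI[of _ "p ! Suc i"]) (simp add: upedge_def)
  qed
qed

text \<open>A path whose top vertex is lowest works: every path meeting it leaves through its top edges.\<close>

lemma pivotal_exists:
  assumes "R \<noteq> []"
    and R: "\<forall>c\<in>set R. distinct (snd c) \<and> snd c \<noteq> [] \<and>
      (\<forall>i. Suc i < length (snd c) \<longrightarrow> {snd c ! i, snd c ! Suc i} \<in> F)"
  shows "\<exists>c\<in>set R. pivotal R c"
proof -
  define Top where "Top p top e f \<longleftrightarrow> e \<in> set ((0, 0) # pedges p) \<and> f \<in> set ((0, 0) # pedges p) \<and>
    (\<forall>b. up b \<longrightarrow> upedge b \<in> set (pedges p) \<longrightarrow> (\<exists>h. (par ^^ Suc h) b = top \<and>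
      (\<forall>j\<le>h. up ((par ^^ j) b) \<and> upedge ((par ^^ j) b) \<in> set (pedges p)) \<and>
      upedge ((par ^^ h) b) \<in> {e, f}))" for p top e f
  have "\<exists>top e f. Top (snd c) top e f" if "c \<in> set R" for c
    unfolding Top_def using R that by (intro path_top) auto
  then obtain top e f where T: "\<And>c. c \<in> set R \<Longrightarrow> Top (snd c) (top c) (e c) (f c)"
    by metis
  obtain c cs where am: "argmin (\<lambda>c. rk (top c)) R = c # cs"
    using argmin_Nil_iff[of "\<lambda>c. rk (top c)" R] assms(1) by (cases "argmin (\<lambda>c. rk (top c)) R") auto
  have c: "c \<in> set R" and min: "\<And>c'. c' \<in> set R \<Longrightarrow> rk (top c) \<le> rk (top c')"
    using argmin_ConsD(2)[OF am] argmin_ConsD(3)[OF am] by auto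
  have "e c \<in> set (pedges (snd c')) \<or> f c \<in> set (pedges (snd c'))"
    if c': "c' \<in> set R" and meets: "meets (snd c') (snd c)" for c'
  proof -
    obtain d where d: "d \<in> set (pedges (snd c'))" "d \<in> set (pedges (snd c))"
      using meets unfolding meets_def by blast
    obtain b where b: "up b" "d = upedge b" using pedges_up[OF _ d(2)] R c by blast
    have "\<exists>h. (par ^^ Suc h) b = top c \<and>
      (\<forall>j\<le>h. up ((par ^^ j) b) \<and> upedge ((par ^^ j) b) \<in> set (pedges (snd c))) \<and>
      upedge ((par ^^ h) b) \<in> {e c, f c}"
      using T[OF c] b d(2) unfolding Top_def by simp
    then obtain h where h: "(par ^^ Suc h) b = top c" "\<forall>j\<le>h. up ((par ^^ j) b)"
      "upedge ((par ^^ h) b) \<in> {e c, f c}" by blast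
    have "\<exists>h. (par ^^ Suc h) b = top c' \<and>
      (\<forall>j\<le>h. up ((par ^^ j) b) \<and> upedge ((par ^^ j) b) \<in> set (pedges (snd c'))) \<and>
      upedge ((par ^^ h) b) \<in> {e c', f c'}"
      using T[OF c'] b d(1) unfolding Top_def by simp
    then obtain h' where h': "(par ^^ Suc h') b = top c'"
      "\<forall>j\<le>h'. upedge ((par ^^ j) b) \<in> set (pedges (snd c'))" by blast
    \<comment> \<open>Both tops lie above the common edge, and the top of \<open>c\<close> has the
      smaller rank. So the climb to it stays within the other path, which therefore contains a top
      edge of \<open>c\<close>.\<close>
    have "h \<le> h'"
    proof (rule ccontr)
      assume "\<not> h \<le> h'"
      then have "rk ((par ^^ Suc h') b) < rk ((par ^^ Suc h) b)"
        by (intro rank_chain[OF h(2)]) auto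
      then show False using min[OF c'] h(1) h'(1) by simp
    qed
    then have "upedge ((par ^^ h) b) \<in> set (pedges (snd c'))" using h'(2) by blast
    then show ?thesis using h(3) by auto
  qed
  moreover have "e c \<in> set ((0, 0) # pedges (snd c))" "f c \<in> set ((0, 0) # pedges (snd c))"
    using T[OF c] unfolding Top_def by simp_all
  ultimately have "pivotal R c" unfolding pivotal_def by blast
  then show ?thesis using c by blast
qed

end

subsection \<open>The number of signatures\<close>

text \<open>In an increasing family of finite sets, a member is identified by its size; hence there
  are no more different members than possible sizes.\<close>

lemma chain_card_eq:
  fixes D :: "nat \<Rightarrow> 'a set"
  assumes fin: "\<forall>j. finite (D j)" and mono: "\<forall>i j. i \<le> j \<longrightarrow> D i \<subseteq> D j" and eq: "card (D i) = card (D j)"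
  shows "D i = D j"
proof (cases "i \<le> j")
  case True
  then have "D i \<subseteq> D j" by (rule mono[THEN spec, THEN spec, THEN mp])
  then show ?thesis by (rule card_subset_eq[OF fin[THEN spec] _ eq])
next
  case False
  then have "j \<le> i" by simp
  then have "D j \<subseteq> D i" by (rule mono[THEN spec, THEN spec, THEN mp])
  then have "D j = D i" by (rule card_subset_eq[OF fin[THEN spec] _ eq[symmetric]])
  then show ?thesis by (rule sym)
qed

text \<open>Counting by codes: if equal codes \<open>g\<close> force equal values \<open>f\<close>,
  then \<open>f\<close> has at most as many values as there are codes.\<close>

lemma card_image_factor:
  assumes fin: "finite B" and sub: "\<forall>x\<in>A. g x \<in> B"
    and fac: "\<forall>x\<in>A. \<forall>y\<in>A. g x = g y \<longrightarrow> f x = f y"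
  shows "finite (f ` A) \<and> card (f ` A) \<le> card B"
proof -
  define h where "h b = f (SOME x. x \<in> A \<and> g x = b)" for b
  have "f x = h (g x)" if "x \<in> A" for x
  proof -
    define y where "y = (SOME y. y \<in> A \<and> g y = g x)"
    have "y \<in> A \<and> g y = g x"
      unfolding y_def by (rule someI[of "\<lambda>y. y \<in> A \<and> g y = g x" x]) (simp add: that)
    then have y: "y \<in> A" "g x = g y" by simp_all
    from fac[THEN bspec, OF that, THEN bspec, OF y(1), THEN mp, OF y(2)]
    show ?thesis unfolding h_def y_def .
  qed
  then have sub': "f ` A \<subseteq> h ` B" using sub by auto
  have fin': "finite (h ` B)" using fin by simp
  have "card (f ` A) \<le> card B"
    by (rule order_trans[OF card_mono[OF fin' sub'] card_image_le[OF fin]])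
  then show ?thesis using finite_subset[OF sub' fin'] by simp
qed

section \<open>Upward chains of the candidate paths outside the feedback vertex set\<close>

context
  fixes par rk :: "nat \<Rightarrow> nat" and F :: "nat set set" and X :: "nat set" and es :: "(nat \<times> nat) list"
  assumes orient: "oriented par rk F" and FX: "\<forall>e\<in>F. e \<inter> X = {}" and finX: "finite X"
    and esF: "\<forall>a\<in>set es. fst a \<notin> X \<longrightarrow> snd a \<notin> X \<longrightarrow> {fst a, snd a} \<in> F"
begin

definition gpath :: "nat list \<Rightarrow> bool" where
  "gpath p \<longleftrightarrow> distinct p \<and> (\<forall>a\<in>set (arcs p). a \<in> set es \<or> prod.swap a \<in> set es)"

definition X_indices :: "nat list \<Rightarrow> nat set" where
  "X_indices p = {i. i < length p \<and> p ! i \<in> X}"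

text \<open>The bottom vertices of the maximal upward runs of \<open>p\<close>: no edge of
  \<open>p\<close> rises to \<open>b\<close> from a child.\<close>

definition chain_starts :: "nat list \<Rightarrow> nat set" where
  "chain_starts p = {b. up par rk F b \<and> upedge par b \<in> set (pedges p) \<and>
     (\<forall>c. par c = b \<longrightarrow> up par rk F c \<longrightarrow> upedge par c \<notin> set (pedges p))}"

definition chain :: "nat list \<Rightarrow> nat \<Rightarrow> (nat \<times> nat) set" where
  "chain p a = {upedge par ((par ^^ j) a) | j.
     \<forall>i\<le>j. up par rk F ((par ^^ i) a) \<and> upedge par ((par ^^ i) a) \<in> set (pedges p)}"

text \<open>Positions on the climb from \<open>a\<close> whose edges lie on the chain
  \<open>z\<close>. Measuring all chains along one climb turns them into sets of numbers.\<close>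

definition chain_indices :: "nat \<Rightarrow> nat list \<times> nat \<Rightarrow> nat set" where
  "chain_indices a z = {j. (\<forall>i\<le>j. up par rk F ((par ^^ i) a)) \<and> upedge par ((par ^^ j) a) \<in> chain (fst z) (snd z)}"

lemma gpath_arc:
  assumes "gpath p" and "Suc i < length p" and "p ! i \<notin> X" and "p ! Suc i \<notin> X"
  shows "{p ! i, p ! Suc i} \<in> F"
proof -
  have "(p ! i, p ! Suc i) \<in> set (arcs p)" using assms(2) by (auto simp: set_arcs_nth)
  then have "(p ! i, p ! Suc i) \<in> set es \<or> (p ! Suc i, p ! i) \<in> set es"
    using assms(1) by (auto simp: gpath_def)
  then show ?thesis
  proof
    assume "(p ! i, p ! Suc i) \<in> set es"
    from esF[THEN bspec, OF this] show ?thesis using assms by simp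
  next
    assume "(p ! Suc i, p ! i) \<in> set es"
    from esF[THEN bspec, OF this] show ?thesis using assms by (simp add: insert_commute)
  qed
qed

lemma X_indices_card: "distinct p \<Longrightarrow> finite (X_indices p) \<and> card (X_indices p) \<le> card X"
proof
  assume "distinct p"
  then have "inj_on (nth p) (X_indices p)"
    by (intro inj_on_nth) (auto simp: X_indices_def)
  moreover have "nth p ` X_indices p \<subseteq> X" by (auto simp: X_indices_def)
  ultimately show "card (X_indices p) \<le> card X" using finX by (rule card_inj_on_le)
  show "finite (X_indices p)" by (simp add: X_indices_def)
qed

text \<open>A chain starts at an end of \<open>p\<close> or next to a vertex of \<open>X\<close>.
  Otherwise \<open>b\<close> has a second neighbour on \<open>p\<close> outside \<open>X\<close>: a
  child of \<open>b\<close> is excluded by the definition of a start, and the parent is already the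
  first neighbour.\<close>

lemma chain_starts_card:
  assumes "gpath p"
  shows "finite (chain_starts p) \<and> card (chain_starts p) \<le> 2 * card X + 2"
proof -
  have dist: "distinct p" using assms by (simp add: gpath_def)
  note IX = X_indices_card[OF dist]
  \<comment> \<open>For \<open>i = 0\<close> the truncated \<open>i - 1\<close> gives
    \<open>p ! 0\<close>, and an index past the end of \<open>p\<close> only enlarges the set; just
    its cardinality matters.\<close>
  let ?A = "{p ! 0, p ! (length p - 1)} \<union> ((\<lambda>i. p ! (i - 1)) ` X_indices p \<union> (\<lambda>i. p ! Suc i) ` X_indices p)"
  have "chain_starts p \<subseteq> ?A"
  proof
    fix b assume b: "b \<in> chain_starts p"
    note b' = b[unfolded chain_starts_def mem_Collect_eq]
    note ub = b'[THEN conjunct1] and eb = b'[THEN conjunct2, THEN conjunct1]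
      and nochild = b'[THEN conjunct2, THEN conjunct2, THEN spec, THEN mp, THEN mp]
    have "{b, par b} \<in> F" using ub by (simp add: up_def[OF orient])
    from FX[THEN bspec, OF this] have bX: "b \<notin> X" by auto
    from upedge_arc[OF orient eb] obtain i where i: "Suc i < length p"
      "(p ! i = b \<and> p ! Suc i = par b) \<or> (p ! i = par b \<and> p ! Suc i = b)" by (elim exE conjE)
    from i(2) show "b \<in> ?A"
    proof
      assume bi: "p ! i = b \<and> p ! Suc i = par b"
      show ?thesis
      proof (cases i)
        case 0
        then show ?thesis using bi by simp
      next
        case (Suc j)
        show ?thesis
        proof (cases "p ! j \<in> X")
          case True
          then have "j \<in> X_indices p" using i(1) Suc by (simp add: X_indices_def)
          moreover have "b = p ! Suc j" using bi Suc by simp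
          ultimately show ?thesis by (intro UnI2) (rule image_eqI)
        next
          case False
          then have "{p ! j, b} \<in> F" using gpath_arc[OF assms, of j] bi bX Suc i(1) by simp
          from oriented_arc[OF orient this] show ?thesis
          proof
            assume c: "b = par (p ! j) \<and> up par rk F (p ! j)"
            have "norm_edge (p ! j, p ! Suc j) \<in> set (pedges p)"
              using pedges_nth[OF orient, of j p] i(1) Suc by simp
            moreover have "p ! Suc j = par (p ! j)" using c bi Suc by simp
            ultimately have "upedge par (p ! j) \<in> set (pedges p)" by (simp add: upedge_def[OF orient])
            with nochild[OF c[THEN conjunct1, symmetric] c[THEN conjunct2]] show ?thesis ..
          next
            assume "p ! j = par b \<and> up par rk F b"
            then have "p ! j = p ! Suc i" using bi by simp
            moreover have "j < length p" using i(1) Suc by simp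
            ultimately have "j = Suc i" using nth_eq_iff_index_eq[OF dist _ i(1), of j] by simp
            then show ?thesis using Suc by simp
          qed
        qed
      qed
    next
      assume bi: "p ! i = par b \<and> p ! Suc i = b"
      show ?thesis
      proof (cases "Suc (Suc i) < length p")
        case False
        then have "length p - 1 = Suc i" using i(1) by linarith
        then show ?thesis using bi by simp
      next
        case True
        show ?thesis
        proof (cases "p ! Suc (Suc i) \<in> X")
          case X: True
          then have "Suc (Suc i) \<in> X_indices p" using True by (simp add: X_indices_def)
          moreover have "b = p ! (Suc (Suc i) - 1)" using bi by simp
          ultimately show ?thesis by (intro UnI2 UnI1) (rule image_eqI)
        next
          case False
          then have "{b, p ! Suc (Suc i)} \<in> F" using gpath_arc[OF assms True] bi bX by simp
          from oriented_arc[OF orient this] show ?thesis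
          proof
            assume "p ! Suc (Suc i) = par b \<and> up par rk F b"
            then have "p ! Suc (Suc i) = p ! i" using bi by simp
            moreover have "i < length p" using i(1) by simp
            ultimately have "Suc (Suc i) = i" using nth_eq_iff_index_eq[OF dist True, of i] by simp
            then show ?thesis by simp
          next
            assume c: "b = par (p ! Suc (Suc i)) \<and> up par rk F (p ! Suc (Suc i))"
            have "norm_edge (p ! Suc (Suc i), p ! Suc i) \<in> set (pedges p)"
              using pedges_nth[OF orient True] norm_edge_swap[of "(p ! Suc i, p ! Suc (Suc i))"] by simp
            moreover have "p ! Suc i = par (p ! Suc (Suc i))" using c bi by simp
            ultimately have "upedge par (p ! Suc (Suc i)) \<in> set (pedges p)" by (simp add: upedge_def[OF orient])
            with nochild[OF c[THEN conjunct1, symmetric] c[THEN conjunct2]] show ?thesis ..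
          qed
        qed
      qed
    qed
  qed
  note sub = this
  have finA: "finite ?A" by (intro finite_UnI finite_imageI IX[THEN conjunct1]) simp_all
  have cardA: "card ?A \<le> 2 + (card (X_indices p) + card (X_indices p))"
  proof -
    let ?P = "{p ! 0, p ! (length p - 1)}" and ?Q = "(\<lambda>i. p ! (i - 1)) ` X_indices p"
      and ?R = "(\<lambda>i. p ! Suc i) ` X_indices p"
    have "card ?P \<le> 2" using card_length[of "[p ! 0, p ! (length p - 1)]"] by simp
    moreover have "card ?Q \<le> card (X_indices p)" by (rule card_image_le[OF IX[THEN conjunct1]])
    moreover have "card ?R \<le> card (X_indices p)" by (rule card_image_le[OF IX[THEN conjunct1]])
    moreover have "card (?P \<union> (?Q \<union> ?R)) \<le> card ?P + card (?Q \<union> ?R)" by (rule card_Un_le)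
    moreover have "card (?Q \<union> ?R) \<le> card ?Q + card ?R" by (rule card_Un_le)
    ultimately show ?thesis by linarith
  qed
  have "card (chain_starts p) \<le> 2 + (card (X_indices p) + card (X_indices p))"
    by (rule order_trans[OF card_mono[OF finA sub] cardA])
  then have "card (chain_starts p) \<le> 2 * card X + 2" using IX[THEN conjunct2] by linarith
  then show ?thesis using finite_subset[OF sub finA] by simp
qed

text \<open>Going down from \<open>b\<close> through children along edges of \<open>p\<close> lowers
  the rank, so the descent ends, namely at a start.\<close>

lemma chain_cover:
  "up par rk F b \<Longrightarrow> upedge par b \<in> set (pedges p) \<Longrightarrow>
     \<exists>a\<in>chain_starts p. \<exists>j. b = (par ^^ j) a \<and>
       (\<forall>i\<le>j. up par rk F ((par ^^ i) a) \<and> upedge par ((par ^^ i) a) \<in> set (pedges p))"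
proof (induction "rk b" arbitrary: b rule: less_induct)
  case less
  show ?case
  proof (cases "\<exists>c. par c = b \<and> up par rk F c \<and> upedge par c \<in> set (pedges p)")
    case True
    then obtain c where c: "par c = b" "up par rk F c" "upedge par c \<in> set (pedges p)" by (elim exE conjE)
    have "rk c < rk b" using c(1,2) by (simp add: up_def[OF orient])
    from less.hyps[OF this c(2,3)] obtain a j where a: "a \<in> chain_starts p" "c = (par ^^ j) a"
      "\<forall>i\<le>j. up par rk F ((par ^^ i) a) \<and> upedge par ((par ^^ i) a) \<in> set (pedges p)" by (elim bexE exE conjE)
    have b: "b = (par ^^ Suc j) a" using c(1) a(2) by simp
    have "\<forall>i\<le>Suc j. up par rk F ((par ^^ i) a) \<and> upedge par ((par ^^ i) a) \<in> set (pedges p)"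
    proof (intro allI impI)
      fix i assume "i \<le> Suc j"
      show "up par rk F ((par ^^ i) a) \<and> upedge par ((par ^^ i) a) \<in> set (pedges p)"
      proof (cases "i = Suc j")
        case True
        then show ?thesis using less.prems b by simp
      next
        case False
        then show ?thesis using a(3) \<open>i \<le> Suc j\<close> by simp
      qed
    qed
    then show ?thesis using a(1) b by (intro bexI[of _ a] exI[of _ "Suc j"] conjI)
  next
    case False
    then have "b \<in> chain_starts p" using less.prems by (auto simp: chain_starts_def)
    then show ?thesis using less.prems by (intro bexI[of _ b] exI[of _ 0]) auto
  qed
qed

lemma mem_pedges_iff_chain:
  assumes "up par rk F b"
  shows "upedge par b \<in> set (pedges p) \<longleftrightarrow> (\<exists>a\<in>chain_starts p. upedge par b \<in> chain p a)"
proof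
  assume "upedge par b \<in> set (pedges p)"
  from chain_cover[OF assms this] obtain a j where "a \<in> chain_starts p" "b = (par ^^ j) a"
    "\<forall>i\<le>j. up par rk F ((par ^^ i) a) \<and> upedge par ((par ^^ i) a) \<in> set (pedges p)" by (elim bexE exE conjE)
  then show "\<exists>a\<in>chain_starts p. upedge par b \<in> chain p a"
    unfolding chain_def by (intro bexI[of _ a] CollectI exI[of _ j]) simp_all
next
  assume "\<exists>a\<in>chain_starts p. upedge par b \<in> chain p a"
  then show "upedge par b \<in> set (pedges p)" unfolding chain_def by auto
qed

text \<open>Climbs that share a vertex agree from there on. Since ranks increase strictly, the other
  chain cannot reach the second common vertex in fewer steps, and so it contains everything in
  between.\<close>

lemma chain_indices_convex:
  assumes j1: "j1 \<in> chain_indices a z" and j2: "j2 \<in> chain_indices a z" and j: "j1 \<le> j" "j \<le> j2"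
  shows "j \<in> chain_indices a z"
proof -
  define p where "p = fst z"
  define a' where "a' = snd z"
  have v: "\<forall>i\<le>j2. up par rk F ((par ^^ i) a)" using j2 by (simp add: chain_indices_def)
  have "\<exists>i. (par ^^ k) a = (par ^^ i) a' \<and>
      (\<forall>l\<le>i. up par rk F ((par ^^ l) a') \<and> upedge par ((par ^^ l) a') \<in> set (pedges p))"
    if k: "k \<in> chain_indices a z" for k
  proof -
    have u: "up par rk F ((par ^^ k) a)" "upedge par ((par ^^ k) a) \<in> chain p a'"
      using k by (simp_all add: chain_indices_def p_def a'_def)
    from u(2) obtain i where i: "upedge par ((par ^^ k) a) = upedge par ((par ^^ i) a')"
      "\<forall>l\<le>i. up par rk F ((par ^^ l) a') \<and> upedge par ((par ^^ l) a') \<in> set (pedges p)"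
      unfolding chain_def by (elim CollectE exE conjE)
    have "(par ^^ k) a = (par ^^ i) a'"
      using upedge_inject[OF orient u(1) _ i(1)] i(2) by simp
    with i(2) show ?thesis by (intro exI[of _ i] conjI)
  qed
  note ex = this
  from ex[OF j1] obtain i1 where i1: "(par ^^ j1) a = (par ^^ i1) a'"
    "\<forall>l\<le>i1. up par rk F ((par ^^ l) a') \<and> upedge par ((par ^^ l) a') \<in> set (pedges p)" by (elim exE conjE)
  from ex[OF j2] obtain i2 where i2: "(par ^^ j2) a = (par ^^ i2) a'"
    "\<forall>l\<le>i2. up par rk F ((par ^^ l) a') \<and> upedge par ((par ^^ l) a') \<in> set (pedges p)" by (elim exE conjE)
  have shift: "(par ^^ (j1 + d)) a = (par ^^ (i1 + d)) a'" for d
  proof (induction d)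
    case 0
    then show ?case using i1(1) by simp
  next
    case (Suc d)
    then show ?case by simp
  qed
  have rk_a: "rk ((par ^^ x) a) < rk ((par ^^ y) a)" if "x < y" "y \<le> j2" for x y
    using rank_chain[OF orient v that(1)] that(2) by simp
  have "i1 + (j2 - j1) \<le> i2"
  proof (rule ccontr)
    assume neg: "\<not> i1 + (j2 - j1) \<le> i2"
    show False
    proof (cases "i1 \<le> i2")
      case True
      then have "(par ^^ i2) a' = (par ^^ (j1 + (i2 - i1))) a" using shift[of "i2 - i1"] by simp
      moreover have "j1 + (i2 - i1) < j2" using neg True j by linarith
      ultimately show False using rk_a[of "j1 + (i2 - i1)" j2] i2(1) by simp
    next
      case False
      have "\<forall>l\<le>i1. up par rk F ((par ^^ l) a')" using i1(2) by simp
      from rank_chain[OF orient this, of i2 i1] False have "rk ((par ^^ i2) a') < rk ((par ^^ i1) a')" by simp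
      moreover have "rk ((par ^^ j1) a) \<le> rk ((par ^^ j2) a)"
        using rk_a[of j1 j2] j by (cases "j1 = j2") auto
      ultimately show False using i1(1) i2(1) by simp
    qed
  qed
  then have le: "i1 + (j - j1) \<le> i2" using j by linarith
  have "(par ^^ j) a = (par ^^ (i1 + (j - j1))) a'" using shift[of "j - j1"] j by simp
  then have "upedge par ((par ^^ j) a) \<in> chain p a'"
    unfolding chain_def using i2(2) le by (intro CollectI exI[of _ "i1 + (j - j1)"]) simp
  moreover have "\<forall>i\<le>j. up par rk F ((par ^^ i) a)" using v j by simp
  ultimately show ?thesis by (simp add: chain_indices_def p_def a'_def)
qed

text \<open>A forest edge on some candidate is coded by a chain through it, with at most
  \<open>L\<close> choices, and by the size of a set of at most \<open>2 * L\<close> events that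
  records which chains have begun or ended at its position. The code determines the
  signature.\<close>

lemma signature_count_forest:
  fixes cs :: "('d \<times> nat list) list"
  assumes cs: "\<forall>c\<in>set cs. gpath (snd c)"
  defines "A \<equiv> {e. \<exists>b. up par rk F b \<and> e = upedge par b \<and> (\<exists>c\<in>set cs. e \<in> set (pedges (snd c)))}"
    and "L \<equiv> length cs * (2 * card X + 2)"
  shows "finite (signature cs ` A) \<and> card (signature cs ` A) \<le> L * (2 * L + 1)"
proof -
  define Z where "Z = Sigma (snd ` set cs) chain_starts"
  have st: "finite (chain_starts p)" "card (chain_starts p) \<le> 2 * card X + 2" if "p \<in> snd ` set cs" for p
  proof -
    from that obtain c where "c \<in> set cs" "p = snd c" by (elim imageE)
    then have "gpath p" using cs by simp
    from chain_starts_card[OF this] show "finite (chain_starts p)" "card (chain_starts p) \<le> 2 * card X + 2"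
      by simp_all
  qed
  have Zfin: "finite Z" unfolding Z_def by (rule finite_SigmaI) (use st(1) in simp_all)
  have Zcard: "card Z \<le> L"
  proof -
    have "card Z = (\<Sum>p\<in>snd ` set cs. card (chain_starts p))"
      unfolding Z_def by (rule card_SigmaI) (use st(1) in auto)
    also have "\<dots> \<le> (\<Sum>p\<in>snd ` set cs. 2 * card X + 2)"
      by (rule sum_mono) (rule st(2))
    also have "\<dots> = card (snd ` set cs) * (2 * card X + 2)" by simp
    also have "\<dots> \<le> L"
      unfolding L_def using card_image_le[of "set cs" snd] card_length[of cs]
      by (intro mult_le_mono1) simp
    finally show ?thesis .
  qed
  \<comment> \<open>While sweeping the climb from \<open>a\<close>, \<open>Inl z\<close> appears
    once the chain \<open>z\<close> has begun and \<open>Inr z\<close> once no position of it is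
    left. Nothing ever disappears, so \<open>D a j\<close> grows with \<open>j\<close> and its size
    determines it; convexity recovers membership in \<open>z\<close>.\<close>
  define D where "D a j = {z \<in> Z. \<exists>i\<le>j. i \<in> chain_indices a z} <+> {z \<in> Z. \<forall>i\<ge>j. i \<notin> chain_indices a z}"
    for a j
  have Dfin: "\<forall>j. finite (D a j)" for a unfolding D_def using Zfin by simp
  have Dmono: "\<forall>i j. i \<le> j \<longrightarrow> D a i \<subseteq> D a j" for a
  proof (intro allI impI subsetI)
    fix i j x assume ij: "i \<le> j" and x: "x \<in> D a i"
    show "x \<in> D a j"
    proof (cases x)
      case (Inl z)
      then have "z \<in> Z" "\<exists>k\<le>i. k \<in> chain_indices a z" using x by (auto simp: D_def)
      then have "\<exists>k\<le>j. k \<in> chain_indices a z" using ij order_trans by blast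
      then have "z \<in> {z \<in> Z. \<exists>k\<le>j. k \<in> chain_indices a z}" using \<open>z \<in> Z\<close> by simp
      then show ?thesis unfolding Inl D_def by (rule InlI)
    next
      case (Inr z)
      then have "z \<in> Z" "\<forall>k\<ge>i. k \<notin> chain_indices a z" using x by (auto simp: D_def)
      then have "z \<in> {z \<in> Z. \<forall>k\<ge>j. k \<notin> chain_indices a z}" using ij by simp
      then show ?thesis unfolding Inr D_def by (rule InrI)
    qed
  qed
  have Dcard: "card (D a j) \<le> 2 * L" for a j
  proof -
    have "D a j \<subseteq> Z <+> Z" unfolding D_def by auto
    from card_mono[OF _ this] have "card (D a j) \<le> card Z + card Z"
      using Zfin by (simp add: card_Plus)
    then show ?thesis using Zcard by linarith
  qed
  have D_iff: "j \<in> chain_indices a z \<longleftrightarrow> Inl z \<in> D a j \<and> Inr z \<notin> D a j" if "z \<in> Z" for a j z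
  proof
    assume "j \<in> chain_indices a z"
    then show "Inl z \<in> D a j \<and> Inr z \<notin> D a j" using that unfolding D_def by auto
  next
    assume "Inl z \<in> D a j \<and> Inr z \<notin> D a j"
    then obtain i i' where i: "i \<le> j" "i \<in> chain_indices a z" "j \<le> i'" "i' \<in> chain_indices a z"
      using that unfolding D_def by auto
    show "j \<in> chain_indices a z" by (rule chain_indices_convex[OF i(2,4,1,3)])
  qed
  have "\<forall>e\<in>A. \<exists>x. fst x \<in> Z \<and> e = upedge par ((par ^^ snd x) (snd (fst x))) \<and>
      (\<forall>i\<le>snd x. up par rk F ((par ^^ i) (snd (fst x))))"
  proof
    fix e assume e: "e \<in> A"
    from e obtain b c where b: "up par rk F b" "e = upedge par b" "c \<in> set cs" "e \<in> set (pedges (snd c))"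
      unfolding A_def by blast
    from chain_cover[OF b(1) b(4)[unfolded b(2)]] obtain a j where
      a: "a \<in> chain_starts (snd c)" "b = (par ^^ j) a"
      "\<forall>i\<le>j. up par rk F ((par ^^ i) a) \<and> upedge par ((par ^^ i) a) \<in> set (pedges (snd c))"
      by (elim bexE exE conjE)
    have "(snd c, a) \<in> Z" unfolding Z_def using a(1) b(3) by simp
    then show "\<exists>x. fst x \<in> Z \<and> e = upedge par ((par ^^ snd x) (snd (fst x))) \<and>
        (\<forall>i\<le>snd x. up par rk F ((par ^^ i) (snd (fst x))))"
      using a b(2) by (intro exI[of _ "((snd c, a), j)"]) simp
  qed
  from bchoice[OF this] obtain w where w: "\<forall>e\<in>A. fst (w e) \<in> Z \<and>
      e = upedge par ((par ^^ snd (w e)) (snd (fst (w e)))) \<and>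
      (\<forall>i\<le>snd (w e). up par rk F ((par ^^ i) (snd (fst (w e)))))" ..
  define zf where "zf e = fst (w e)" for e
  define jf where "jf e = snd (w e)" for e
  note zj = w[folded zf_def jf_def]
  define g where "g e = (zf e, card (D (snd (zf e)) (jf e)))" for e
  have "finite (signature cs ` A) \<and> card (signature cs ` A) \<le> card (Z \<times> {..2 * L})"
  proof (rule card_image_factor)
    show "finite (Z \<times> {..2 * L})" using Zfin by simp
    show "\<forall>e\<in>A. g e \<in> Z \<times> {..2 * L}" using zj Dcard by (simp add: g_def)
    show "\<forall>e\<in>A. \<forall>e'\<in>A. g e = g e' \<longrightarrow> signature cs e = signature cs e'"
    proof (intro ballI impI)
      fix e e' assume e: "e \<in> A" and e': "e' \<in> A" and gg: "g e = g e'"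
      define a where "a = snd (zf e)"
      have a': "a = snd (zf e')" using gg by (simp add: g_def a_def)
      note zz = gg[unfolded g_def prod.inject, THEN conjunct1]
        and cc = gg[unfolded g_def prod.inject, THEN conjunct2]
      have "card (D a (jf e)) = card (D a (jf e'))" using cc unfolding a_def zz .
      from chain_card_eq[OF Dfin Dmono this] have DD: "D a (jf e) = D a (jf e')" .
      have mem: "x \<in> chain (fst z) (snd z) \<longleftrightarrow> jf x \<in> chain_indices a z"
        if "x \<in> A" "a = snd (zf x)" for x z
        using zj[THEN bspec, OF that(1)] that(2) by (simp add: chain_indices_def)
      have "e \<in> set (pedges p) \<longleftrightarrow> e' \<in> set (pedges p)" if p: "p \<in> snd ` set cs" for p
      proof -
        have *: "x \<in> set (pedges p) \<longleftrightarrow> (\<exists>a\<in>chain_starts p. x \<in> chain p a)" if x: "x \<in> A" for x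
        proof -
          from x obtain b where "up par rk F b" "x = upedge par b" unfolding A_def by blast
          then show ?thesis using mem_pedges_iff_chain[of b p] by simp
        qed
        have "e \<in> chain p s \<longleftrightarrow> e' \<in> chain p s" if s: "s \<in> chain_starts p" for s
        proof -
          have "(p, s) \<in> Z" using p s by (simp add: Z_def)
          from D_iff[OF this, of "jf e" a] D_iff[OF this, of "jf e'" a]
          show ?thesis using mem[OF e a_def, of "(p, s)"] mem[OF e' a', of "(p, s)"] DD by simp
        qed
        then show ?thesis using *[OF e] *[OF e'] by blast
      qed
      then show "signature cs e = signature cs e'" unfolding signature_def by simp
    qed
  qed
  moreover have "card (Z \<times> {..2 * L}) \<le> L * (2 * L + 1)"
    using mult_le_mono1[OF Zcard, of "2 * L + 1"] by (simp add: card_cartesian_product)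
  ultimately show ?thesis by linarith
qed

text \<open>Such an edge has an end in \<open>X\<close>, and a path has at most two edges at each
  vertex.\<close>

lemma X_edges_card:
  assumes "gpath p"
  shows "card {e \<in> set (pedges p). \<not> (\<exists>b. up par rk F b \<and> e = upedge par b)} \<le> 2 * card X"
proof -
  have dist: "distinct p" using assms by (simp add: gpath_def)
  note IX = X_indices_card[OF dist]
  let ?A = "(\<lambda>i. norm_edge (p ! i, p ! Suc i)) ` X_indices p \<union> (\<lambda>i. norm_edge (p ! (i - 1), p ! i)) ` X_indices p"
  have "{e \<in> set (pedges p). \<not> (\<exists>b. up par rk F b \<and> e = upedge par b)} \<subseteq> ?A"
  proof
    fix e assume e: "e \<in> {e \<in> set (pedges p). \<not> (\<exists>b. up par rk F b \<and> e = upedge par b)}"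
    then obtain i where i: "Suc i < length p" "e = norm_edge (p ! i, p ! Suc i)"
      by (auto simp: pedges_def set_arcs_nth)
    have "p ! i \<in> X \<or> p ! Suc i \<in> X"
    proof (rule ccontr)
      assume "\<not> (p ! i \<in> X \<or> p ! Suc i \<in> X)"
      then have "{p ! i, p ! Suc i} \<in> F" using gpath_arc[OF assms i(1)] by simp
      from oriented_arc[OF orient this] show False
      proof
        assume "p ! Suc i = par (p ! i) \<and> up par rk F (p ! i)"
        then show False using e i(2) by (auto simp: upedge_def[OF orient])
      next
        assume "p ! i = par (p ! Suc i) \<and> up par rk F (p ! Suc i)"
        moreover have "norm_edge (p ! Suc i, p ! i) = norm_edge (p ! i, p ! Suc i)"
          using norm_edge_swap[of "(p ! i, p ! Suc i)"] by simp
        ultimately show False using e i(2) by (auto simp: upedge_def[OF orient])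
      qed
    qed
    then show "e \<in> ?A"
    proof
      assume "p ! i \<in> X"
      then have "i \<in> X_indices p" using i(1) by (simp add: X_indices_def)
      then show ?thesis using i(2) by blast
    next
      assume "p ! Suc i \<in> X"
      then have "Suc i \<in> X_indices p" using i(1) by (simp add: X_indices_def)
      then show ?thesis using i(2) by (intro UnI2 image_eqI[of _ _ "Suc i"]) simp_all
    qed
  qed
  moreover have "finite ?A" using IX by simp
  ultimately have "card {e \<in> set (pedges p). \<not> (\<exists>b. up par rk F b \<and> e = upedge par b)} \<le> card ?A"
    by (intro card_mono)
  also have "\<dots> \<le> card ((\<lambda>i. norm_edge (p ! i, p ! Suc i)) ` X_indices p) +
      card ((\<lambda>i. norm_edge (p ! (i - 1), p ! i)) ` X_indices p)" by (rule card_Un_le)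
  also have "\<dots> \<le> card (X_indices p) + card (X_indices p)" using IX by (intro add_mono card_image_le) simp_all
  finally show ?thesis using IX by linarith
qed

text \<open>Edges of the forest are counted by signature, while the few edges at \<open>X\<close>
  are simply counted one by one.\<close>

lemma length_representatives:
  fixes cs :: "('d \<times> nat list) list"
  assumes cs: "\<forall>c\<in>set cs. gpath (snd c)"
  defines "L \<equiv> length cs * (2 * card X + 2)"
  shows "length (representatives cs) \<le> L * (2 * L + 1) + L"
proof -
  let ?used = "set (concat (map (\<lambda>c. pedges (snd c)) cs))"
  define A where "A = {e. \<exists>b. up par rk F b \<and> e = upedge par b \<and> (\<exists>c\<in>set cs. e \<in> set (pedges (snd c)))}"
  define B where "B = (\<Union>c\<in>set cs. {e \<in> set (pedges (snd c)). \<not> (\<exists>b. up par rk F b \<and> e = upedge par b)})"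
  have "distinct (map (signature cs) (representatives cs))"
    using dedup_props[of "signature cs" "concat (map (\<lambda>c. pedges (snd c)) cs)"]
    unfolding representatives_def by simp
  from distinct_card[OF this]
  have "length (representatives cs) = card (set (map (signature cs) (representatives cs)))" by simp
  also have "set (map (signature cs) (representatives cs)) = signature cs ` ?used"
    using dedup_props[of "signature cs" "concat (map (\<lambda>c. pedges (snd c)) cs)"]
    unfolding representatives_def by simp
  also have "?used = A \<union> B" unfolding A_def B_def by auto
  also have "card (signature cs ` (A \<union> B)) \<le> card (signature cs ` A) + card (signature cs ` B)"
    unfolding image_Un by (rule card_Un_le)
  also have "card (signature cs ` A) \<le> L * (2 * L + 1)"
    using signature_count_forest[OF cs, folded A_def L_def] by simp
  also have "card (signature cs ` B) \<le> card B"
    by (rule card_image_le) (auto simp: B_def)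
  also have "card B \<le> (\<Sum>c\<in>set cs. card {e \<in> set (pedges (snd c)). \<not> (\<exists>b. up par rk F b \<and> e = upedge par b)})"
    unfolding B_def by (rule card_UN_le) simp
  also have "\<dots> \<le> (\<Sum>c\<in>set cs. 2 * card X)"
    by (rule sum_mono) (use cs X_edges_card in simp)
  also have "\<dots> = card (set cs) * (2 * card X)" by simp
  also have "\<dots> \<le> L" unfolding L_def by (rule mult_le_mono[OF card_length]) simp
  finally show ?thesis by simp
qed

end

section \<open>The main theorem\<close>

subsection \<open>The congestion bound\<close>

text \<open>The number of digits is at most \<open>7 + 6 * ln n\<close>, where
  \<open>ln 2 \<ge> 2 / 3\<close> turns the binary logarithm of \<open>n ^ 4\<close> into
  \<open>6 * ln n\<close>. Adding 3 and using \<open>1 \<le> ln n\<close> gives 16.\<close>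

lemma base_le:
  assumes "length xs \<le> 64 * n ^ 4" and "n \<ge> 3"
  shows "real (base xs) \<le> 16 * ln (real n)"
proof -
  let ?L = "length (loglist xs)"
  have ln3: "1 \<le> ln (real n)"
  proof -
    have "exp 1 \<le> real n" using exp_le assms(2) by linarith
    then have "ln (exp 1) \<le> ln (real n)" by (intro ln_mono) auto
    then show ?thesis by simp
  qed
  have "real ?L * ln 2 \<le> 7 * ln 2 + 4 * ln (real n)"
  proof (cases ?L)
    case 0
    then show ?thesis using ln3 by simp
  next
    case (Suc j)
    have mono: "\<forall>i j. i \<le> j \<longrightarrow> 2 ^ j \<le> length xs \<longrightarrow> 2 ^ i \<le> length xs"
    proof (intro allI impI)
      fix i j :: nat assume "i \<le> j" "2 ^ j \<le> length xs"
      then show "2 ^ i \<le> length xs" using power_increasing[of i j "2 :: nat"] by linarith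
    qed
    from length_filter_antimono[of "\<lambda>j. 2 ^ j \<le> length xs" "length xs", OF mono, folded loglist_def,
        THEN conjunct1, THEN spec, of j] Suc
    have "2 ^ j \<le> length xs" by simp
    then have "2 ^ j \<le> 64 * n ^ 4" using assms(1) by (rule order_trans)
    then have "real (2 ^ j) \<le> real (64 * n ^ 4)" by (simp only: of_nat_le_iff)
    then have "(2 :: real) ^ j \<le> 2 ^ 6 * real n ^ 4" by simp
    then have "ln ((2 :: real) ^ j) \<le> ln (2 ^ 6 * real n ^ 4)" using assms(2) by (intro ln_mono) auto
    also have "\<dots> = 6 * ln 2 + 4 * ln (real n)"
      using assms(2) ln_realpow[of "2 :: real" 6] by (simp add: ln_mult ln_realpow)
    finally have "real j * ln 2 \<le> 6 * ln 2 + 4 * ln (real n)" by (simp add: ln_realpow)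
    then show ?thesis using Suc by (simp add: algebra_simps)
  qed
  moreover have "2 / 3 \<le> ln (2 :: real)" by (rule ln2_ge_two_thirds)
  then have "4 * ln (real n) \<le> 6 * ln (real n) * ln 2"
    using mult_left_mono[of "2 / 3" "ln 2" "6 * ln (real n)"] ln3 by simp
  ultimately have "real ?L * ln 2 \<le> (7 + 6 * ln (real n)) * ln 2" by (simp add: algebra_simps)
  then have "real ?L \<le> 7 + 6 * ln (real n)" by simp
  then show ?thesis using ln3 by (simp add: base_def)
qed

text \<open>For \<open>y \<le> b\<close> the logarithms compare directly. For \<open>b < y\<close>,
  the inequality \<open>ln (y / b) \<le> y / b - 1\<close> bounds \<open>b * ln y\<close> by
  \<open>b * ln b + y - b\<close>, and \<open>1 \<le> ln b\<close> does the rest.\<close>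

lemma ratio_le:
  fixes b y :: real
  assumes b: "3 \<le> b" "b \<le> 16 * y" and y: "1 < y"
  shows "b / ln b \<le> 16 * y / ln y"
proof -
  have lnb: "1 \<le> ln b"
  proof -
    have "exp 1 \<le> b" using exp_le b(1) by linarith
    then have "ln (exp 1) \<le> ln b" by (intro ln_mono) auto
    then show ?thesis by simp
  qed
  have lny: "0 < ln y" using y by simp
  have "b * ln y \<le> 16 * y * ln b"
  proof (cases "y \<le> b")
    case True
    then have "ln y \<le> ln b" using y by simp
    then show ?thesis using b lny by (intro mult_mono) auto
  next
    case False
    have "ln y = ln b + ln (y / b)" using b y by (simp add: ln_div)
    also have "ln (y / b) \<le> y / b - 1" using b y by (intro ln_le_minus_one) simp
    finally have "b * ln y \<le> b * (ln b + (y / b - 1))" using b by (intro mult_left_mono) auto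
    also have "\<dots> = b * ln b + y - b" using b by (simp add: algebra_simps)
    also have "\<dots> \<le> y * ln b + y * ln b"
    proof -
      have "b * ln b \<le> y * ln b" using False lnb by (intro mult_right_mono) auto
      moreover have "y \<le> y * ln b" using y lnb by simp
      ultimately show ?thesis using b by linarith
    qed
    also have "\<dots> \<le> 16 * y * ln b" using y lnb by simp
    finally show ?thesis .
  qed
  then show ?thesis using lnb lny by (simp add: field_simps)
qed

text \<open>\<open>145 = 1 + 9 * 16\<close>: the 1 because minimality speaks of
  \<open>capacity xs - 1\<close>, the 9 from the definition of the capacity, the 16 from
  \<open>base_le\<close>. The 1 is absorbed since \<open>1 \<le> y / ln y\<close>.\<close>

lemma capacity_le:
  assumes "length xs \<le> 64 * n ^ 4" and n: "n \<ge> 3"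
  shows "real (capacity xs) \<le> 145 * log_over_loglog n"
proof -
  define y where "y = ln (real n)"
  have y: "1 < y"
  proof -
    have "ln (3 :: real) \<le> y" unfolding y_def using n by (intro ln_mono) auto
    moreover have "exp 1 < (3 :: real)" using e_less_272 by simp
    then have "ln (exp 1) < ln (3 :: real)" by (subst ln_less_cancel_iff) auto
    ultimately show ?thesis by simp
  qed
  then have lny: "0 < ln y" by simp
  have one: "1 \<le> y / ln y" using ln_le_minus_one[of y] y lny by simp
  let ?b = "real (base xs)"
  have b: "3 \<le> ?b" using base_ge[of xs] by simp
  have lnb: "0 < ln ?b" using b by simp
  have "real (capacity xs) \<le> 1 + 9 * (?b / ln ?b)"
  proof (cases "capacity xs = 0")
    case True
    then show ?thesis using b lnb by simp
  next
    case False
    then have "base xs ^ (capacity xs - 1) < 2 ^ (9 * base xs)" by (intro capacity_props(2)) simp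
    then have "real (base xs ^ (capacity xs - 1)) < real (2 ^ (9 * base xs))" by (simp only: of_nat_less_iff)
    then have "?b ^ (capacity xs - 1) < 2 ^ (9 * base xs)" by simp
    then have "ln (?b ^ (capacity xs - 1)) \<le> ln ((2 :: real) ^ (9 * base xs))"
      using b by (intro ln_mono) auto
    then have "real (capacity xs - 1) * ln ?b \<le> real (9 * base xs) * ln 2"
      using b by (simp only: ln_realpow[of 2] ln_realpow[of ?b])
    also have "\<dots> \<le> real (9 * base xs) * 1"
      using ln_2_less_1 by (intro mult_left_mono) auto
    finally have "real (capacity xs - 1) \<le> 9 * ?b / ln ?b" using lnb by (simp add: field_simps)
    then show ?thesis using False by (simp add: of_nat_diff)
  qed
  also have "\<dots> \<le> 1 + 9 * (16 * y / ln y)"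
    using ratio_le[OF b _ y] base_le[OF assms] by (simp add: y_def)
  also have "\<dots> \<le> 145 * (y / ln y)" using one by simp
  also have "\<dots> = 145 * log_over_loglog n" using n by (simp add: log_over_loglog_def y_def)
  finally show ?thesis .
qed

lemma log_over_loglog_ge: "1 \<le> log_over_loglog n"
proof (cases "3 \<le> n")
  case True
  define y where "y = ln (real n)"
  have "ln (3 :: real) \<le> y" unfolding y_def using True by (intro ln_mono) auto
  moreover have "exp 1 < (3 :: real)" using e_less_272 by simp
  then have "ln (exp 1) < ln (3 :: real)" by (subst ln_less_cancel_iff) auto
  ultimately have y: "1 < y" by simp
  then have "0 < ln y" by simp
  then have "1 \<le> y / ln y" using ln_le_minus_one[of y] y by simp
  then show ?thesis using True by (simp add: log_over_loglog_def y_def)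
qed (simp add: log_over_loglog_def)

subsection \<open>Correctness of the algorithm\<close>

lemma fvs_obtain:
  assumes "simple_graph V E"
  obtains X where "feedback_vertex_set V E X" "card X = fvs_number V E" "finite X"
proof -
  let ?S = "{X. feedback_vertex_set V E X}"
  have fV: "finite V" using assms by (simp add: simple_graph_def)
  have sub: "?S \<subseteq> Pow V" by (auto simp: feedback_vertex_set_def)
  have e0: "{e \<in> E. e \<inter> V = {}} = {}"
  proof -
    have "e \<inter> V \<noteq> {}" if "e \<in> E" for e
    proof -
      have "e \<subseteq> V" "card e = 2" using assms that by (auto simp: simple_graph_def)
      then show ?thesis by (cases "e = {}") auto
    qed
    then show ?thesis by auto
  qed
  have "V \<in> ?S" unfolding feedback_vertex_set_def mem_Collect_eq e0 by (simp add: forest_def is_cycle_def)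
  then have "card ` ?S \<noteq> {}" by blast
  moreover have "finite (card ` ?S)" using finite_subset[OF sub] fV by simp
  ultimately have "fvs_number V E \<in> card ` ?S" unfolding fvs_number_def by (intro Min_in)
  then obtain X where X: "X \<in> ?S" "card X = fvs_number V E" by auto
  moreover have "finite X" using X(1) fV by (auto simp: feedback_vertex_set_def intro: finite_subset)
  ultimately show ?thesis using that by simp
qed

lemma opt_obtain:
  fixes M :: "('a \<times> 'a) list"
  obtains R where "routing V E M R" "edge_disjoint R" "card (dom R) = maxedp_opt V E M"
proof -
  let ?S = "{card (dom R) | R. routing V E M R \<and> edge_disjoint R}"
  have "?S \<subseteq> {..length M}"
  proof
    fix n assume "n \<in> ?S"
    then obtain R where R: "n = card (dom R)" "routing V E M R" by blast
    have "card (dom R) \<le> card {..<length M}"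
      by (rule card_mono) (use R(2) in \<open>auto simp: routing_def\<close>)
    then show "n \<in> {..length M}" using R(1) by simp
  qed
  then have "finite ?S" by (rule finite_subset) simp
  moreover have "card (dom (Map.empty :: nat \<rightharpoonup> 'a list)) \<in> ?S"
    by (intro CollectI exI[of _ Map.empty]) (simp add: routing_def edge_disjoint_def)
  ultimately have "maxedp_opt V E M \<in> ?S" unfolding maxedp_opt_def by (intro Max_in) auto
  then show ?thesis using that by auto
qed

lemma case_filter_map_of:
  "(case filter (\<lambda>c. fst c = i) l of [] \<Rightarrow> None | c # cs \<Rightarrow> Some (snd c)) = map_of l i"
  by (induction l) auto

lemma norm_edge_eq_set: "norm_edge a = norm_edge a' \<longleftrightarrow> {fst a, snd a} = {fst a', snd a'}"
  by (cases a; cases a') (auto simp: norm_edge_eq_iff doubleton_eq_iff)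

lemma path_edges_arcs: "path_edges p = (\<lambda>a. {fst a, snd a}) ` set (arcs p)"
  by (simp add: path_edges_def arcs_def case_prod_beta)

lemma pedges_iff: "norm_edge a \<in> set (pedges p) \<longleftrightarrow> {fst a, snd a} \<in> path_edges p"
  unfolding pedges_def path_edges_arcs set_map image_iff norm_edge_eq_set ..

section \<open>Analysis of the algorithm on a fixed instance\<close>

context
  fixes V :: "nat set" and E :: "nat set set" and M :: "(nat \<times> nat) list" and vs es
  assumes inst: "maxedp_instance V E M" and vs: "set vs = V"
    and es: "distinct (map (\<lambda>(u, v). {u, v}) es)" "(\<lambda>(u, v). {u, v}) ` set es = E"
begin

lemma E_subset: "e \<in> E \<Longrightarrow> e \<subseteq> V"
  using inst unfolding maxedp_instance_def simple_graph_def by blast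

lemma es_arc: "a \<in> set es \<Longrightarrow> {fst a, snd a} \<in> E"
  using es(2) by (auto simp: case_prod_beta)

lemma E_arc: "{u, v} \<in> E \<Longrightarrow> (u, v) \<in> set es \<or> (v, u) \<in> set es"
  using es(2) by (auto simp: doubleton_eq_iff image_iff)

lemma list_graph: "simple_list_graph vs es"
  unfolding simple_list_graph_def
proof
  have "inj_on (\<lambda>(u, v). {u, v}) (set es)" "distinct es" using es(1) by (auto simp: distinct_map)
  moreover have "inj_on norm_edge (set es)"
  proof (rule inj_onI)
    fix a a' assume a: "a \<in> set es" "a' \<in> set es" "norm_edge a = norm_edge a'"
    then have "(\<lambda>(u, v). {u, v}) a = (\<lambda>(u, v). {u, v}) a'" by (simp add: norm_edge_eq_set case_prod_beta)
    with \<open>inj_on (\<lambda>(u, v). {u, v}) (set es)\<close> a(1,2) show "a = a'" by (simp add: inj_on_eq_iff)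
  qed
  ultimately show "distinct (map norm_edge es)" by (simp add: distinct_map)
  show "set es \<subseteq> set vs \<times> set vs"
  proof
    fix a assume "a \<in> set es"
    from E_subset[OF es_arc[OF this]] have "{fst a, snd a} \<subseteq> V" .
    then show "a \<in> set vs \<times> set vs" using vs by (cases a) auto
  qed
qed

lemma list_terminals: "set M \<subseteq> set vs \<times> set vs"
  using inst vs by (simp add: maxedp_instance_def)

lemma walk_in_iff_path:
  assumes "i < length M"
  shows "walk_in es (M ! i) p \<longleftrightarrow> is_path V E p \<and> (hd p, last p) = M ! i"
proof
  assume w: "walk_in es (M ! i) p"
  have arc: "{fst a, snd a} \<in> E" if "a \<in> set (arcs p)" for a
  proof -
    have "a \<in> set es \<or> prod.swap a \<in> set es" using w that by (simp add: walk_in_def)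
    then show ?thesis using es_arc[of a] es_arc[of "prod.swap a"] by (auto simp: insert_commute)
  qed
  have "set p \<subseteq> V"
  proof
    fix v assume "v \<in> set p"
    then obtain j where j: "j < length p" "v = p ! j" by (auto simp: in_set_conv_nth)
    show "v \<in> V"
    proof (cases "Suc j < length p")
      case True
      then have "(p ! j, p ! Suc j) \<in> set (arcs p)" by (auto simp: set_arcs_nth)
      from E_subset[OF arc[OF this]] show ?thesis using j by simp
    next
      case False
      \<comment> \<open>The last vertex starts no arc, and a path of one vertex has none at all;
        here the terminals being vertices is used.\<close>
      then have "j = length p - 1" using j by linarith
      then have "v = last p" using j w by (simp add: walk_in_def last_conv_nth)
      also have "\<dots> = snd (M ! i)" using w by (simp add: walk_in_def prod_eq_iff)
      also have "\<dots> \<in> V" using subsetD[OF list_terminals nth_mem[OF assms]] vs by (simp add: mem_Times_iff)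
      finally show ?thesis .
    qed
  qed
  then show "is_path V E p \<and> (hd p, last p) = M ! i"
    using w arc by (auto simp: is_path_def walk_in_def path_edges_arcs)
next
  assume p: "is_path V E p \<and> (hd p, last p) = M ! i"
  have "a \<in> set es \<or> prod.swap a \<in> set es" if "a \<in> set (arcs p)" for a
  proof -
    have "{fst a, snd a} \<in> E" using p that by (auto simp: is_path_def path_edges_arcs)
    from E_arc[OF this] show ?thesis by (simp add: prod.swap_def)
  qed
  then show "walk_in es (M ! i) p" using p by (simp add: walk_in_def is_path_def)
qed

definition cands :: "(nat \<times> nat list) list" where
  "cands = candidates vs es M (fractional vs es M)"

lemmas cands = candidates_correct[OF list_graph list_terminals, folded cands_def]

lemma cands_opt: "length M * maxedp_opt V E M \<le> 2 * length cands"
proof -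
  obtain R where R: "routing V E M R" "edge_disjoint R" "card (dom R) = maxedp_opt V E M"
    by (rule opt_obtain)
  have dom: "dom R \<subseteq> {..<length M}" using R(1) by (simp add: routing_def)
  have q: "\<forall>i\<in>dom R. walk_in es (M ! i) (the (R i))"
  proof
    fix i assume i: "i \<in> dom R"
    then have "i < length M" using dom by auto
    moreover have "is_path V E (the (R i)) \<and> (hd (the (R i)), last (the (R i))) = M ! i"
      using R(1) i unfolding routing_def by auto
    ultimately show "walk_in es (M ! i) (the (R i))" using walk_in_iff_path by simp
  qed
  have disj: "\<forall>i\<in>dom R. \<forall>j\<in>dom R. i \<noteq> j \<longrightarrow> set (pedges (the (R i))) \<inter> set (pedges (the (R j))) = {}"
  proof (intro ballI impI)
    fix i j assume ij: "i \<in> dom R" "j \<in> dom R" "i \<noteq> j"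
    have pd: "path_edges (the (R i)) \<inter> path_edges (the (R j)) = {}"
      using R(2) ij by (simp add: edge_disjoint_def)
    have "e \<notin> set (pedges (the (R j)))" if "e \<in> set (pedges (the (R i)))" for e
    proof
      assume "e \<in> set (pedges (the (R j)))"
      moreover from that obtain a where "e = norm_edge a" by (auto simp: pedges_def)
      ultimately have "{fst a, snd a} \<in> path_edges (the (R i)) \<inter> path_edges (the (R j))"
        using that by (simp add: pedges_iff)
      then show False using pd by simp
    qed
    then show "set (pedges (the (R i))) \<inter> set (pedges (the (R j))) = {}" by auto
  qed
  have "finite (dom R)" using dom finite_subset by blast
  from fractional_competitive[OF list_graph list_terminals this dom q disj] R(3)
  have f: "copies es * maxedp_opt V E M \<le> 2 * length (fractional vs es M)" by simp
  have "copies es * (length M * maxedp_opt V E M) \<le> length M * (2 * length (fractional vs es M))"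
    using mult_le_mono2[OF f, of "length M"] by (simp add: ac_simps)
  also have "\<dots> \<le> copies es * (2 * length cands)" using cands(4) by simp
  finally show ?thesis using copies_pos[of es] by simp
qed

lemma length_cands: "length cands \<le> length M * length M"
proof -
  have "length cands = (\<Sum>i<length M. length (filter (\<lambda>c. fst c = i \<and> True) cands))"
    by (subst length_filter_index) (use cands(1) in auto)
  also have "\<dots> \<le> (\<Sum>i<length M. length M)" by (rule sum_mono) (use cands(2) in simp)
  finally show ?thesis by simp
qed

lemma round_sound: "set (round_candidates cands) \<subseteq> set cands" "distinct (map fst (round_candidates cands))"
proof -
  let ?r = "representatives cands"
  note ds = disjoint_selection_correct[of cands "length M" "5 * length M"]
  have p: "\<forall>i. length (filter (\<lambda>c. fst c = i) cands) \<le> length M"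
    "\<forall>e. length (filter (\<lambda>c. e \<in> set (pedges (snd c))) cands) \<le> 5 * length M"
    using cands(2,3) by simp_all
  note g = greedy_invariant[of "base ?r" ?r "capacity ?r" "\<lambda>_. cands" "length cands"]
  show "set (round_candidates cands) \<subseteq> set cands"
    using ds(1)[OF p] g unfolding round_candidates_def by auto
  show "distinct (map fst (round_candidates cands))"
    using ds(2)[OF p] g unfolding round_candidates_def by simp
qed

text \<open>\<open>22 = 2 * 11\<close>: the candidates hold half of the optimum, and a disjoint
  choice discards up to \<open>k + 2 * (5 * k) = 11 * k\<close> of them. The greedy alternative
  loses only \<open>2 * k\<close>.\<close>

lemma round_competitive: "maxedp_opt V E M \<le> 22 * length (round_candidates cands)"
proof (cases "length M = 0")
  case True
  obtain R where R: "routing V E M R" "card (dom R) = maxedp_opt V E M" by (rule opt_obtain)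
  have "dom R = {}" using R(1) True by (auto simp: routing_def)
  then show ?thesis using R(2) by simp
next
  case False
  have p: "\<forall>i. length (filter (\<lambda>c. fst c = i) cands) \<le> length M"
    "\<forall>e. length (filter (\<lambda>c. e \<in> set (pedges (snd c))) cands) \<le> 5 * length M"
    using cands(2,3) by simp_all
  have "length cands \<le> 11 * length M * length (round_candidates cands)"
  proof (cases "fst (disjoint_selection cands) = []")
    case True
    from disjoint_selection_correct(4)[OF p True] show ?thesis
      using True by (simp add: round_candidates_def)
  next
    case F: False
    have "length cands \<le> 2 * length M * length (round_candidates cands)"
      using greedy_rounding[OF _ p] False F by (simp add: round_candidates_def)
    also have "\<dots> \<le> 11 * length M * length (round_candidates cands)" by (intro mult_le_mono) auto
    finally show ?thesis .
  qed
  from order_trans[OF cands_opt mult_le_mono2[OF this]]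
  have "length M * maxedp_opt V E M \<le> 2 * (11 * length M * length (round_candidates cands))" .
  also have "\<dots> = length M * (22 * length (round_candidates cands))" by simp
  finally show ?thesis using False by simp
qed

text \<open>Beyond the disjoint case, \<open>r\<close> is positive. If then
  \<open>k * r < 3\<close>, there are at most two pairs and the load is trivially at most 2, which
  the constant branch of \<open>log_over_loglog\<close> covers.\<close>

lemma round_load: "real (load (round_candidates cands) e) \<le> 145 * log_over_loglog (length M * fvs_number V E)"
proof (cases "fst (disjoint_selection cands) = []")
  case True
  have p: "\<forall>i. length (filter (\<lambda>c. fst c = i) cands) \<le> length M"
    "\<forall>e. length (filter (\<lambda>c. e \<in> set (pedges (snd c))) cands) \<le> 5 * length M"
    using cands(2,3) by simp_all
  have "load (round_candidates cands) e \<le> 1"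
    using disjoint_selection_correct(3)[OF p, of e] True by (simp add: round_candidates_def)
  then show ?thesis using log_over_loglog_ge[of "length M * fvs_number V E"] by linarith
next
  case False
  have sg: "simple_graph V E" using inst by (simp add: maxedp_instance_def)
  obtain X where X: "feedback_vertex_set V E X" "card X = fvs_number V E" "finite X"
    using sg by (rule fvs_obtain)
  let ?F = "{e \<in> E. e \<inter> X = {}}"
  have "finite E"
  proof (rule finite_subset)
    show "E \<subseteq> Pow V" using sg by (auto simp: simple_graph_def)
    show "finite (Pow V)" using sg by (simp add: simple_graph_def)
  qed
  then have "finite ?F" by simp
  moreover have "\<forall>e\<in>?F. card e = 2" using sg by (simp add: simple_graph_def)
  moreover have "forest ?F" using X(1) by (simp add: feedback_vertex_set_def)
  ultimately obtain par rk where orient: "oriented par rk ?F" using forest_orientation[of ?F] by blast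
  have cwalk: "walk_in es (M ! fst c) (snd c)" "is_path V E (snd c)" if "c \<in> set cands" for c
    using cands(1)[OF that] walk_in_iff_path[of "fst c" "snd c"] by simp_all
  show ?thesis
  proof (cases "fvs_number V E = 0")
    case True
    then have "X = {}" using X(2,3) by simp
    have "\<exists>c\<in>set R. pivotal R c" if R: "R \<noteq> []" "set R \<subseteq> set cands" for R
    proof (rule pivotal_exists[OF orient R(1)], intro ballI conjI allI impI)
      fix c assume "c \<in> set R"
      then have c: "is_path V E (snd c)" using cwalk R(2) by blast
      show "distinct (snd c)" "snd c \<noteq> []" using c by (simp_all add: is_path_def)
      fix i assume "Suc i < length (snd c)"
      then have "{snd c ! i, snd c ! Suc i} \<in> path_edges (snd c)" unfolding path_edges_nth by blast
      then show "{snd c ! i, snd c ! Suc i} \<in> ?F" using c \<open>X = {}\<close> by (auto simp: is_path_def)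
    qed
    then have "fst (disjoint_selection cands) = []" by (intro disjoint_selection_complete) blast
    then show ?thesis using False by simp
  next
    case r: False
    let ?r = "fvs_number V E" and ?k = "length M" and ?sel = "round_candidates cands"
    have "?k \<noteq> 0"
    proof
      assume "?k = 0"
      then have "cands = []" using length_cands by simp
      then show False using False by (simp add: disjoint_selection_def)
    qed
    show ?thesis
    proof (cases "3 \<le> ?k * ?r")
      case True
      have esF: "\<forall>a\<in>set es. fst a \<notin> X \<longrightarrow> snd a \<notin> X \<longrightarrow> {fst a, snd a} \<in> ?F"
        using es_arc by simp
      have FX: "\<forall>e\<in>?F. e \<inter> X = {}" by simp
      have gp: "\<forall>c\<in>set cands. gpath es (snd c)"
        using cwalk(1) by (simp add: gpath_def[OF orient FX X(3) esF] walk_in_def)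
      define L where "L = length cands * (2 * card X + 2)"
      from length_representatives[OF orient FX X(3) esF gp]
      have len: "length (representatives cands) \<le> L * (2 * L + 1) + L" by (simp add: L_def)
      define n where "n = ?k * ?r"
      \<comment> \<open>Since \<open>r\<close> is positive, \<open>2 * r + 2 \<le> 4 * r\<close>; a
        further factor \<open>r\<close> makes the bound a power of \<open>n = k * r\<close>.\<close>
      have "L \<le> (?k * ?k) * (4 * ?r)"
        unfolding L_def X(2) using length_cands r by (intro mult_le_mono) auto
      also have "\<dots> \<le> (?k * ?k) * (4 * ?r) * ?r" using r by simp
      also have "\<dots> = 4 * n ^ 2" by (simp add: n_def power2_eq_square ac_simps)
      finally have L: "L \<le> 4 * n ^ 2" .
      have "L * (2 * L + 1) + L \<le> (2 * L + 2) * L" by (simp add: algebra_simps)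
      also have "\<dots> \<le> (2 * (4 * n ^ 2) + 2 * n ^ 2) * (4 * n ^ 2)"
      proof -
        have "1 \<le> n ^ 2" by (rule one_le_power) (use True n_def in linarith)
        then have "2 * L + 2 \<le> 2 * (4 * n ^ 2) + 2 * n ^ 2" using L by linarith
        then show ?thesis using L by (rule mult_le_mono)
      qed
      also have "\<dots> = 40 * n ^ 4" by (simp add: power2_eq_square power4_eq_xxxx)
      also have "\<dots> \<le> 64 * n ^ 4" by simp
      finally have "length (representatives cands) \<le> 64 * n ^ 4" using len by linarith
      from capacity_le[OF this] True have cap: "real (capacity (representatives cands)) \<le> 145 * log_over_loglog n"
        by (simp add: n_def)
      have "load ?sel e \<le> capacity (representatives cands)"
        using greedy_invariant[of "base (representatives cands)" "representatives cands"
            "capacity (representatives cands)" "\<lambda>_. cands" "length cands", THEN conjunct2, THEN conjunct1, THEN spec, of e]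
          False by (simp add: round_candidates_def)
      then have "real (load ?sel e) \<le> real (capacity (representatives cands))" by simp
      then show ?thesis using cap unfolding n_def by linarith
    next
      case False
      have "?k * 1 \<le> ?k * ?r" using r by (intro mult_le_mono2) simp
      then have "?k \<le> 2" using False by linarith
      have "load ?sel e \<le> length (map fst ?sel)" using load_le_length by simp
      also have "\<dots> = card (fst ` set ?sel)" using distinct_card[OF round_sound(2)] by simp
      also have "\<dots> \<le> card {..<?k}"
        by (rule card_mono) (use round_sound(1) cands(1) in auto)
      finally have "load ?sel e \<le> 2" using \<open>?k \<le> 2\<close> by simp
      then show ?thesis using log_over_loglog_ge[of "?k * ?r"] by linarith
    qed
  qed
qed

lemma algorithm_correct:
  defines "R \<equiv> map_of (round_candidates cands)"
  shows "maxedp_algorithm (vs, es, M) = map R [0..<length M]"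
    and "routing V E M R"
    and "1 / 22 * real (maxedp_opt V E M) \<le> real (card (dom R))"
    and "congestion_at_most E R (145 * log_over_loglog (length M * fvs_number V E))"
proof -
  let ?sel = "round_candidates cands"
  show "maxedp_algorithm (vs, es, M) = map R [0..<length M]"
    unfolding maxedp_algorithm_def fst_conv snd_conv cands_def[symmetric] case_filter_map_of R_def ..
  have mem: "i < length M \<and> is_path V E p \<and> (hd p, last p) = M ! i" if "R i = Some p" for i p
  proof -
    have "(i, p) \<in> set cands" using that round_sound(1) map_of_SomeD unfolding R_def by fast
    from cands(1)[OF this] show ?thesis using walk_in_iff_path[of i p] by simp
  qed
  then show "routing V E M R" unfolding routing_def by auto
  have "card (dom R) = length ?sel"
    unfolding R_def dom_map_of_conv_image_fst using distinct_card[OF round_sound(2)] by simp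
  then show "1 / 22 * real (maxedp_opt V E M) \<le> real (card (dom R))" using round_competitive by simp
  show "congestion_at_most E R (145 * log_over_loglog (length M * fvs_number V E))"
    unfolding congestion_at_most_def
  proof
    fix e assume "e \<in> E"
    then obtain a where a: "e = {fst a, snd a}" using es(2) by (auto simp: case_prod_beta)
    let ?f = "filter (\<lambda>c. norm_edge a \<in> set (pedges (snd c))) ?sel"
    have "{i \<in> dom R. e \<in> path_edges (the (R i))} \<subseteq> fst ` set ?f"
    proof
      fix i assume "i \<in> {i \<in> dom R. e \<in> path_edges (the (R i))}"
      then obtain p where p: "R i = Some p" "e \<in> path_edges p" by auto
      then have "(i, p) \<in> set ?sel" unfolding R_def by (auto dest: map_of_SomeD)
      then have "(i, p) \<in> set ?f" using p(2) a by (simp add: pedges_iff)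
      then show "i \<in> fst ` set ?f" by (rule rev_image_eqI) simp
    qed
    then have "edge_load R e \<le> card (fst ` set ?f)" unfolding edge_load_def by (intro card_mono) auto
    also have "\<dots> \<le> length ?f" by (rule order_trans[OF card_image_le card_length]) simp
    finally have "edge_load R e \<le> load ?sel (norm_edge a)" by (simp add: load_def)
    then have "real (edge_load R e) \<le> real (load ?sel (norm_edge a))" by simp
    then show "real (edge_load R e) \<le> 145 * log_over_loglog (length M * fvs_number V E)"
      using round_load[of "norm_edge a"] by linarith
  qed
qed

end

lemma enc_list_map: "enc_list f (map g xs) = enc_list (\<lambda>x. f (g x)) xs"
  by (induction xs) auto

lemma enc_nat_list: "enc (xs :: nat list) = enc_list Num xs"
  by (induction xs) (auto simp: enc_list_def)

lemma enc_arc_list: "enc (xs :: (nat \<times> nat) list) = enc_list enc_pair xs"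
  by (induction xs) (auto simp: enc_list_def enc_pair_def)

lemma enc_routing_eq: "enc_routing k R = enc (map R [0..<k])"
proof -
  have "enc_option (enc_list Num) = (enc :: nat list option \<Rightarrow> val)"
  proof
    fix x :: "nat list option"
    show "enc_option (enc_list Num) x = enc x" by (cases x) (simp_all add: enc_nat_list)
  qed
  then show ?thesis unfolding enc_routing_def by (simp add: enc_list_def enc_list_map)
qed

theorem theorem1:
  "\<exists>(A :: com) (q :: nat poly) (\<delta> :: real) (\<alpha> :: real) (c :: real).
     0 < \<delta> \<and> 0 < \<alpha> \<and> 0 < c \<and>
     (\<forall>(V :: nat set) (E :: nat set set) (M :: (nat \<times> nat) list) (x :: val) (k :: nat) (r :: nat).
        maxedp_instance V E M \<and> encodes_instance x V E M \<and> k = length M \<and> r = fvs_number V E \<longrightarrow>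
        halts_within A x (poly q (val_size x)) \<and>
        \<delta> \<le> output_prob A x (poly q (val_size x))
          (\<lambda>y. \<exists>R. y = enc_routing k R \<and> routing V E M R \<and>
             \<alpha> * real (maxedp_opt V E M) \<le> real (card (dom R)) \<and>
             congestion_at_most E R (c * log_over_loglog (k * r))))"
proof -
  obtain A n h where A: "runs A n maxedp_algorithm h" "polybound h"
    using polytime_maxedp_algorithm by (rule polytimeE)
  obtain a where a: "\<And>x. h x \<le> (esize x + 2) ^ a" using A(2) unfolding polybound_def by blast
  define q :: "nat poly" where "q = [:2, 1:] ^ a"
  have q: "poly q s = (s + 2) ^ a" for s by (simp add: q_def poly_power add.commute)
  show ?thesis
  proof (rule exI[of _ A], rule exI[of _ q], rule exI[of _ "1 :: real"], rule exI[of _ "1 / 22 :: real"],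
      rule exI[of _ "145 :: real"], intro conjI allI impI)
    fix V :: "nat set" and E :: "nat set set" and M :: "(nat \<times> nat) list" and x k r
    assume H: "maxedp_instance V E M \<and> encodes_instance x V E M \<and> k = length M \<and> r = fvs_number V E"
    then obtain vs es where v: "set vs = V" "distinct (map (\<lambda>(u, v). {u, v}) es)"
      "(\<lambda>(u, v). {u, v}) ` set es = E"
      "x = Cell (enc_list Num vs) (Cell (enc_list enc_pair es) (enc_list enc_pair M))"
      unfolding encodes_instance_def by blast
    have inst: "maxedp_instance V E M" using H by simp
    have x: "x = enc (vs, es, M)" unfolding v(4) by (simp add: enc_nat_list enc_arc_list)
    note correct = algorithm_correct[OF inst v(1-3)]
    \<comment> \<open>The output is the same for all random bits, so the success probability is
      1.\<close>
    have run: "\<exists>t. computes A x w t (enc (maxedp_algorithm (vs, es, M))) \<and> t \<le> poly q (val_size x)" for w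
    proof -
      have "((\<lambda>_. Num 0)(0 := x)) 0 = enc (vs, es, M)" by (simp add: x)
      with A(1) obtain t s' where t: "exec A ((\<lambda>_. Num 0)(0 := x)) w t s' w" "t \<le> h (vs, es, M)"
        "s' 0 = enc (maxedp_algorithm (vs, es, M))"
        by (rule runsE) blast
      have "t \<le> poly q (val_size x)" using t(2) a[of "(vs, es, M)"] unfolding q x by linarith
      then show ?thesis using t unfolding computes_def by blast
    qed
    show "halts_within A x (poly q (val_size x))" unfolding halts_within_def using run by blast
    let ?Q = "\<lambda>y. \<exists>R. y = enc_routing k R \<and> routing V E M R \<and>
       1 / 22 * real (maxedp_opt V E M) \<le> real (card (dom R)) \<and>
       congestion_at_most E R (145 * log_over_loglog (k * r))"
    have "?Q (enc (maxedp_algorithm (vs, es, M)))"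
      using correct H by (auto simp: enc_routing_eq)
    then have "{w. \<exists>t y. computes A x w t y \<and> ?Q y} = UNIV" using run by blast
    then show "1 \<le> output_prob A x (poly q (val_size x)) ?Q" unfolding output_prob_def by simp
  qed simp_all
qed

end
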